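(* Fix $\alpha>0$. There is a randomized algorithm which, given any $n$-element set $A\subset\mathbb{R}^3$ in general position with $\Delta(A)\le\alpha n^{1/3}$, runs in $\mathcal{O}(n\log n)$ expected time and outputs a subset of $A$ in convex position whose size is at least $c\,n^{-1/6}\cdot \mathrm{OPT}(A)$, where $c=c(\alpha)>0$ is a constant and $\mathrm{OPT}(A)$ is the maximum size of a subset of $A$ in convex position (i.e., it is an $\Omega(n^{-1/6})$-factor approximation).
   Context: A finite set of points in $\mathbb{R}^3$ is in general position if any $4$ or fewer of its points are affinely independent, and in convex position if no point lies in the convex hull of the others. The spread $\Delta(A)$ of a finite set $A$ is the ratio of the maximum pairwise Euclidean distance to the minimum pairwise Euclidean distance among points of $A$. *)

theory Defs
  imports "HOL-Probability.Probability" "HOL-Library.Log_Nat"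
begin

section \<open>Point sets in space\<close>

definition general_position :: "(real ^ 3) set \<Rightarrow> bool" where
  "general_position A \<longleftrightarrow> (\<forall>S \<subseteq> A. card S \<le> 4 \<and> finite S \<longrightarrow> \<not> affine_dependent S)"

definition convex_position :: "(real ^ 3) set \<Rightarrow> bool" where
  "convex_position A \<longleftrightarrow> (\<forall>x\<in>A. x \<notin> convex hull (A - {x}))"

definition pair_dists :: "(real ^ 3) set \<Rightarrow> real set" where
  "pair_dists A = {dist p q | p q. p \<in> A \<and> q \<in> A \<and> p \<noteq> q}"

text \<open>Only meaningful for finite sets with at least two points.\<close>
definition spread :: "(real ^ 3) set \<Rightarrow> real" where
  "spread A = Max (pair_dists A) / Min (pair_dists A)"

definition opt_convex :: "(real ^ 3) set \<Rightarrow> nat" where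
  "opt_convex A = Max {card S | S. S \<subseteq> A \<and> convex_position S}"


section \<open>A randomized real RAM\<close>

text \<open>
  The machine has a memory of words, i.e. natural numbers below \<open>2 ^ w\<close>, and a separate memory
  of exact real numbers; both are addressed by words, so indirect addressing is available.
  Reals support the four arithmetic operations and comparison.  Words can be converted to reals,
  but there is no floor function or other conversion from reals to words, and no root extraction.
  Only rational constants may occur in a program.  Randomness is provided by drawing a uniformly
  distributed word.
\<close>

datatype wexp =
    WConst nat
  | WMem wexp
  | WAdd wexp wexp
  | WSub wexp wexp
  | WMul wexp wexp
  | WDiv wexp wexp

datatype rexp =
    RConst rat
  | RMem wexp
  | ROfWord wexp
  | RAdd rexp rexp
  | RSub rexp rexp
  | RMul rexp rexp
  | RDiv rexp rexp

datatype bexp =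
    WLess wexp wexp
  | RLess rexp rexp
  | BNot bexp
  | BAnd bexp bexp

datatype com =
    Skip
  | WStore wexp wexp
  | RStore wexp rexp
  | RandWord wexp
  | Seq com com
  | Cond bexp com com
  | While bexp com

text \<open>The field \<open>draws\<close> counts the random words consumed so far.\<close>
record machine =
  words :: "nat \<Rightarrow> nat"
  reals :: "nat \<Rightarrow> real"
  draws :: nat

text \<open>Addition and multiplication wrap around at \<open>2 ^ w\<close>; subtraction is truncated at \<open>0\<close>.
  Division by zero yields \<open>0\<close>, for words and for reals.\<close>
primrec wval :: "nat \<Rightarrow> machine \<Rightarrow> wexp \<Rightarrow> nat" where
  "wval w s (WConst c) = c mod 2 ^ w"
| "wval w s (WMem a) = words s (wval w s a)"
| "wval w s (WAdd a b) = (wval w s a + wval w s b) mod 2 ^ w"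
| "wval w s (WSub a b) = wval w s a - wval w s b"
| "wval w s (WMul a b) = (wval w s a * wval w s b) mod 2 ^ w"
| "wval w s (WDiv a b) = wval w s a div wval w s b"

primrec rval :: "nat \<Rightarrow> machine \<Rightarrow> rexp \<Rightarrow> real" where
  "rval w s (RConst c) = of_rat c"
| "rval w s (RMem a) = reals s (wval w s a)"
| "rval w s (ROfWord a) = real (wval w s a)"
| "rval w s (RAdd a b) = rval w s a + rval w s b"
| "rval w s (RSub a b) = rval w s a - rval w s b"
| "rval w s (RMul a b) = rval w s a * rval w s b"
| "rval w s (RDiv a b) = rval w s a / rval w s b"

primrec bval :: "nat \<Rightarrow> machine \<Rightarrow> bexp \<Rightarrow> bool" where
  "bval w s (WLess a b) \<longleftrightarrow> wval w s a < wval w s b"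
| "bval w s (RLess a b) \<longleftrightarrow> rval w s a < rval w s b"
| "bval w s (BNot b) \<longleftrightarrow> \<not> bval w s b"
| "bval w s (BAnd b c) \<longleftrightarrow> bval w s b \<and> bval w s c"

text \<open>
  \<open>exec w \<omega> P s t s'\<close>: with word length \<open>w\<close> and random words \<open>\<omega> 0, \<omega> 1, \<dots>\<close>, the program \<open>P\<close>
  started in \<open>s\<close> halts in \<open>s'\<close> after \<open>t\<close> steps.  Every executed basic command and every evaluated
  guard costs one step.  As the expressions of a fixed program have bounded size, this agrees with
  the number of elementary machine operations up to a constant factor depending on the program.
\<close>
inductive exec :: "nat \<Rightarrow> (nat \<Rightarrow> nat) \<Rightarrow> com \<Rightarrow> machine \<Rightarrow> nat \<Rightarrow> machine \<Rightarrow> bool"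
  for w :: nat and \<omega> :: "nat \<Rightarrow> nat" where
  exec_Skip: "exec w \<omega> Skip s 1 s"
| exec_WStore: "exec w \<omega> (WStore a e) s 1 (s\<lparr>words := (words s)(wval w s a := wval w s e)\<rparr>)"
| exec_RStore: "exec w \<omega> (RStore a e) s 1 (s\<lparr>reals := (reals s)(wval w s a := rval w s e)\<rparr>)"
| exec_RandWord: "exec w \<omega> (RandWord a) s 1
    (s\<lparr>words := (words s)(wval w s a := \<omega> (draws s)), draws := Suc (draws s)\<rparr>)"
| exec_Seq: "exec w \<omega> P s t s' \<Longrightarrow> exec w \<omega> Q s' u s'' \<Longrightarrow> exec w \<omega> (Seq P Q) s (t + u) s''"
| exec_CondTrue: "bval w s b \<Longrightarrow> exec w \<omega> P s t s' \<Longrightarrow> exec w \<omega> (Cond b P Q) s (Suc t) s'"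
| exec_CondFalse: "\<not> bval w s b \<Longrightarrow> exec w \<omega> Q s t s' \<Longrightarrow> exec w \<omega> (Cond b P Q) s (Suc t) s'"
| exec_WhileFalse: "\<not> bval w s b \<Longrightarrow> exec w \<omega> (While b P) s 1 s"
| exec_WhileTrue: "bval w s b \<Longrightarrow> exec w \<omega> P s t s' \<Longrightarrow> exec w \<omega> (While b P) s' u s'' \<Longrightarrow>
    exec w \<omega> (While b P) s (Suc (t + u)) s''"

inductive_cases exec_SkipE: "exec w \<omega> Skip s t s'"
inductive_cases exec_WStoreE: "exec w \<omega> (WStore a e) s t s'"
inductive_cases exec_RStoreE: "exec w \<omega> (RStore a e) s t s'"
inductive_cases exec_RandWordE: "exec w \<omega> (RandWord a) s t s'"
inductive_cases exec_SeqE: "exec w \<omega> (Seq P Q) s t s'"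
inductive_cases exec_CondE: "exec w \<omega> (Cond b P Q) s t s'"
inductive_cases exec_WhileE: "exec w \<omega> (While b P) s t s'"

lemma exec_deterministic:
  assumes "exec w \<omega> P s t s'" "exec w \<omega> P s u s''"
  shows "t = u \<and> s' = s''"
  using assms
proof (induction arbitrary: u s'' rule: exec.induct)
  case exec_Skip
  from exec_Skip.prems show ?case by (rule exec_SkipE) simp
next
  case exec_WStore
  from exec_WStore.prems show ?case by (rule exec_WStoreE) simp
next
  case exec_RStore
  from exec_RStore.prems show ?case by (rule exec_RStoreE) simp
next
  case exec_RandWord
  from exec_RandWord.prems show ?case by (rule exec_RandWordE) simp
next
  case exec_Seq
  from exec_Seq.prems show ?case
    by (rule exec_SeqE) (use exec_Seq.IH in blast)
next
  case exec_CondTrue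
  from exec_CondTrue.prems show ?case
    by (rule exec_CondE) (use exec_CondTrue.IH exec_CondTrue.hyps in blast)+
next
  case exec_CondFalse
  from exec_CondFalse.prems show ?case
    by (rule exec_CondE) (use exec_CondFalse.IH exec_CondFalse.hyps in blast)+
next
  case exec_WhileFalse
  from exec_WhileFalse.prems show ?case
    by (rule exec_WhileE) (use exec_WhileFalse.hyps in simp_all)
next
  case exec_WhileTrue
  from exec_WhileTrue.prems show ?case
    by (rule exec_WhileE) (use exec_WhileTrue.IH exec_WhileTrue.hyps in blast)+
qed

lemma exec_draws:
  assumes "exec w \<omega> P s t s'"
  shows "draws s \<le> draws s' \<and> draws s' \<le> draws s + t"
  using assms by (induction rule: exec.induct) auto

lemma exec_local:
  assumes "exec w \<omega> P s t s'" "\<And>i. i < draws s' \<Longrightarrow> \<omega>' i = \<omega> i"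
  shows "exec w \<omega>' P s t s'"
  using assms
proof (induction rule: exec.induct)
  case (exec_RandWord a s)
  then show ?case
    using exec.exec_RandWord[of w \<omega>' a s] by simp
next
  case (exec_Seq P s t s' Q u s'')
  have "draws s' \<le> draws s''" using exec_Seq.hyps(2) exec_draws by blast
  then show ?case using exec_Seq by (auto intro!: exec.exec_Seq)
next
  case (exec_WhileTrue s b P t s' u s'')
  have "draws s' \<le> draws s''" using exec_WhileTrue.hyps(3) exec_draws by blast
  then show ?case using exec_WhileTrue by (auto intro!: exec.exec_WhileTrue)
qed (blast intro: exec.intros)+

text \<open>The running time is \<open>\<infinity>\<close> if the program does not halt, and otherwise the number of steps of
  the only halting execution, by \<open>exec_deterministic\<close>.\<close>
definition runtime :: "nat \<Rightarrow> com \<Rightarrow> machine \<Rightarrow> (nat \<Rightarrow> nat) \<Rightarrow> ennreal" where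
  "runtime w P s \<omega> = (INF t \<in> {t. \<exists>s'. exec w \<omega> P s t s'}. ennreal (real t))"

definition random_tape :: "nat \<Rightarrow> (nat \<Rightarrow> nat) measure" where
  "random_tape w = (\<Pi>\<^sub>M i\<in>UNIV. measure_pmf (pmf_of_set {..<2 ^ w}))"

lemma space_random_tape [simp]: "space (random_tape w) = UNIV"
  by (simp add: random_tape_def space_PiM)

lemma prob_space_random_tape: "prob_space (random_tape w)"
  unfolding random_tape_def by (intro prob_space_PiM prob_space_measure_pmf)

lemma measurable_random_tape_component:
  "(\<lambda>\<omega>. \<omega> i) \<in> measurable (random_tape w) (count_space UNIV)"
proof -
  have "(\<lambda>\<omega>. \<omega> i) \<in> measurable (random_tape w) (measure_pmf (pmf_of_set {..<2 ^ w}))"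
    unfolding random_tape_def by (rule measurable_component_singleton) simp
  then show ?thesis by (simp cong: measurable_cong_sets)
qed

lemma halting_measurable: "{\<omega>. \<exists>s'. exec w \<omega> P s t s'} \<in> sets (random_tape w)"
proof -
  let ?E = "{\<omega>. \<exists>s'. exec w \<omega> P s t s'}"
  define N where "N = draws s + t"
  define cyl where "cyl l = {\<omega> :: nat \<Rightarrow> nat. \<forall>i<N. \<omega> i = l ! i}" for l
  have local: "\<omega>' \<in> ?E" if "\<omega> \<in> ?E" "\<And>i. i < N \<Longrightarrow> \<omega>' i = \<omega> i" for \<omega> \<omega>'
  proof -
    from that(1) obtain s' where s': "exec w \<omega> P s t s'" by blast
    then have "draws s' \<le> N" using exec_draws N_def by blast
    then have "exec w \<omega>' P s t s'" using exec_local[OF s'] that(2) by simp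
    then show ?thesis by blast
  qed
  have cyl_sets: "cyl l \<in> sets (random_tape w)" for l
  proof -
    have "{\<omega> \<in> space (random_tape w). \<forall>i\<in>{..<N}. \<omega> i = l ! i} \<in> sets (random_tape w)"
    proof (rule sets.sets_Collect_finite_All)
      fix i
      have "(\<lambda>\<omega>. \<omega> i) -` {l ! i} \<inter> space (random_tape w) \<in> sets (random_tape w)"
        by (rule measurable_sets[OF measurable_random_tape_component]) simp
      then show "{\<omega> \<in> space (random_tape w). \<omega> i = l ! i} \<in> sets (random_tape w)"
        by (simp add: vimage_def)
    qed simp
    then show ?thesis by (simp add: cyl_def Ball_def)
  qed
  have "?E = (\<Union>l \<in> (\<lambda>\<omega>. map \<omega> [0..<N]) ` ?E. cyl l)"
  proof (intro equalityI subsetI)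
    fix \<omega> assume "\<omega> \<in> ?E"
    moreover have "\<omega> \<in> cyl (map \<omega> [0..<N])" by (simp add: cyl_def)
    ultimately show "\<omega> \<in> (\<Union>l \<in> (\<lambda>\<omega>. map \<omega> [0..<N]) ` ?E. cyl l)" by blast
  next
    fix \<omega>' assume "\<omega>' \<in> (\<Union>l \<in> (\<lambda>\<omega>. map \<omega> [0..<N]) ` ?E. cyl l)"
    then obtain \<omega> where "\<omega> \<in> ?E" "\<omega>' \<in> cyl (map \<omega> [0..<N])" by blast
    then show "\<omega>' \<in> ?E" using local[of \<omega> \<omega>'] by (simp add: cyl_def)
  qed
  also have "\<dots> \<in> sets (random_tape w)"
    using cyl_sets by (intro sets.countable_UN') auto
  finally show ?thesis .
qed

lemma runtime_measurable: "runtime w P s \<in> borel_measurable (random_tape w)"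
proof -
  let ?f = "\<lambda>t \<omega>. if \<omega> \<in> {\<omega>. \<exists>s'. exec w \<omega> P s t s'} then ennreal (real t) else \<infinity>"
  have "runtime w P s = (\<lambda>\<omega>. INF t. ?f t \<omega>)"
  proof (rule ext, rule antisym)
    fix \<omega>
    show "runtime w P s \<omega> \<le> (INF t. ?f t \<omega>)"
    proof (rule INF_greatest)
      fix t
      show "runtime w P s \<omega> \<le> ?f t \<omega>"
        unfolding runtime_def by (cases "\<exists>s'. exec w \<omega> P s t s'") (auto intro: INF_lower)
    qed
    show "(INF t. ?f t \<omega>) \<le> runtime w P s \<omega>"
      unfolding runtime_def
    proof (rule INF_greatest)
      fix t assume "t \<in> {t. \<exists>s'. exec w \<omega> P s t s'}"
      then show "(INF t. ?f t \<omega>) \<le> ennreal (real t)"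
        by (intro INF_lower2[of t]) auto
    qed
  qed
  also have "\<dots> \<in> borel_measurable (random_tape w)"
    using halting_measurable[of w P s]
    by (intro borel_measurable_INF measurable_If_set) auto
  finally show ?thesis .
qed

lemma runtime_eq: "exec w \<omega> P s t s' \<Longrightarrow> runtime w P s \<omega> = ennreal (real t)"
proof -
  assume *: "exec w \<omega> P s t s'"
  then have "{t. \<exists>s'. exec w \<omega> P s t s'} = {t}"
    using exec_deterministic by blast
  then show ?thesis by (simp add: runtime_def)
qed

definition expected_time :: "nat \<Rightarrow> com \<Rightarrow> machine \<Rightarrow> ennreal" where
  "expected_time w P s = (\<integral>\<^sup>+ \<omega>. runtime w P s \<omega> \<partial>random_tape w)"


section \<open>Algorithms on point sets\<close>

definition coord :: "real ^ 3 \<Rightarrow> nat \<Rightarrow> real" where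
  "coord p j = (if j = 0 then p $ 1 else if j = 1 then p $ 2 else p $ 3)"

text \<open>The input points are given in an arbitrary order as a list: the first word is the number
  of points, and real cells \<open>3 * i\<close>, \<open>3 * i + 1\<close>, \<open>3 * i + 2\<close> hold the \<open>i\<close>-th point.\<close>
definition ram_input :: "(real ^ 3) list \<Rightarrow> machine" where
  "ram_input xs = \<lparr>words = (\<lambda>i. if i = 0 then length xs else 0),
     reals = (\<lambda>i. if i < 3 * length xs then coord (xs ! (i div 3)) (i mod 3) else 0),
     draws = 0\<rparr>"

text \<open>The first word of the final state announces how many of the following words are to be read
  as the indices of the selected input points.\<close>
definition ram_output :: "machine \<Rightarrow> nat set" where
  "ram_output s = words s ` {1..words s 0}"

text \<open>Words have \<open>k\<close> times as many bits as the binary representation of \<open>n\<close>.\<close>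
definition word_length :: "nat \<Rightarrow> nat \<Rightarrow> nat" where
  "word_length k n = k * floorlog 2 n"

end

theory Submission
  imports Defs
begin

text \<open>
  Rescale the points to \<open>[-1, 1]^3\<close>.  Two points of a slab of thickness \<open>\<eta>\<close> above a translate of the
  paraboloid \<open>z = x^2 + y^2\<close> are separated by a plane parallel to a tangent plane as soon as their
  squared horizontal distance exceeds \<open>\<eta>\<close>, so a set of horizontally far points of the slab is in convex position.
  With \<open>\<eta>\<close> of order \<open>n^(-1/2)\<close>, a random tilt and a random offset, the slab contains \<open>\<Theta>(n \<eta>)\<close>
  points in expectation.  Two points at distance \<open>d\<close> share a slab with probability \<open>O(\<eta>^2 / d)\<close>, and summing
  this over the \<open>n^(-1/3)\<close>-separated set shows that horizontally close pairs are expected to be a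
  small fraction of that.  Hence a greedy scan of the slab keeps \<open>\<Omega>(n^(1/2))\<close> points with constant
  probability, in time \<open>O(n)\<close>, and the trial is repeated until it succeeds.  On the other hand, a subset in
  convex position behaves like a separated set on a sphere and has only \<open>O(n^(2/3))\<close> points.
\<close>

section \<open>Packing and counting\<close>

text \<open>A random offset alone would not suffice: two points on one translate of the paraboloid
  would share a slab with probability of order \<eta>, whatever their distance, and a point may have
  about n^(1/4) others within distance n^(-1/4). The tilt supplies a second factor \<eta>, because
  the height difference of two points is affine in the tilt, and for pairs that ever share a slab
  its slope is comparable to their distance d. Summing \<eta>^2/d over a separated set within radius
  of order \<eta>^(1/2) gives order \<eta> * (n \<eta>^2) per point. So \<eta> must be a small
  multiple of n^(-1/2): a wider slab drowns in close pairs, a thinner one holds too few points. The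
  greedy scan is quadratic in the number of slab points, so each trial stops after O(n^(1/2)) of
  them. A trial is accepted by counting the kept points, so chance affects the time but not the
  quality. Since n^(2/3) * n^(-1/6) = n^(1/2), the ratio follows. The machine has no roots: n^(1/2)
  becomes an integer K with n \<le> K^2 \<le> 4n, and the word length makes a random word split
  exactly into three uniform digits.\<close>

lemma grid_cell_dist:
  fixes a b s M :: real
  assumes "0 < s" "\<lfloor>(a + M) / s\<rfloor> = \<lfloor>(b + M) / s\<rfloor>"
  shows "\<bar>a - b\<bar> < s"
proof -
  have "\<bar>(a + M) / s - (b + M) / s\<bar> < 1" using assms(2) by linarith
  moreover have "(a + M) / s - (b + M) / s = (a - b) / s" by (simp add: diff_divide_distrib add_divide_distrib)
  ultimately show ?thesis using \<open>0 < s\<close> by (simp add: abs_divide)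
qed

lemma grid_cell_range:
  fixes a s M :: real
  assumes "0 < s" "\<bar>a\<bar> \<le> M"
  shows "\<lfloor>(a + M) / s\<rfloor> \<in> {0..\<lfloor>2 * M / s\<rfloor>}"
proof -
  have "(a + M) / s \<le> 2 * M / s" using assms by (simp add: divide_right_mono)
  then show ?thesis using assms by (auto intro: floor_mono)
qed

text \<open>Two points in one grid cell of side \<open>s\<close> would violate \<open>sep\<close> in
  both coordinates at once, so assigning cells is injective and it suffices to count cells.\<close>

lemma card_le_grid2:
  fixes f g :: "'a \<Rightarrow> real"
  assumes "finite S" "0 < s" "0 \<le> M"
    and "\<And>i. i \<in> S \<Longrightarrow> \<bar>f i\<bar> \<le> M" "\<And>i. i \<in> S \<Longrightarrow> \<bar>g i\<bar> \<le> M"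
    and sep: "\<And>i j. i \<in> S \<Longrightarrow> j \<in> S \<Longrightarrow> i \<noteq> j \<Longrightarrow> s \<le> \<bar>f i - f j\<bar> \<or> s \<le> \<bar>g i - g j\<bar>"
  shows "real (card S) \<le> (2 * M / s + 1)\<^sup>2"
proof -
  define cell where "cell h i = \<lfloor>(h i + M) / s\<rfloor>" for h :: "'a \<Rightarrow> real" and i
  define J where "J = {0..\<lfloor>2 * M / s\<rfloor>}"
  have cell_in: "cell h i \<in> J" if "\<bar>h i\<bar> \<le> M" for h i
    unfolding cell_def J_def by (rule grid_cell_range[OF \<open>0 < s\<close> that])
  have "inj_on (\<lambda>i. (cell f i, cell g i)) S"
  proof (rule inj_onI, rule ccontr)
    fix i j assume "i \<in> S" "j \<in> S" "(cell f i, cell g i) = (cell f j, cell g j)" "i \<noteq> j"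
    then show False using \<open>0 < s\<close> sep[of i j] grid_cell_dist[of s "f i" M "f j"] grid_cell_dist[of s "g i" M "g j"]
      by (auto simp: cell_def)
  qed
  then have "card S \<le> card (J \<times> J)"
    using assms cell_in by (intro card_inj_on_le[of "\<lambda>i. (cell f i, cell g i)"]) (auto simp: J_def)
  then have "real (card S) \<le> (real (card J))\<^sup>2"
    by (metis card_cartesian_product of_nat_le_iff of_nat_mult power2_eq_square)
  also have "\<dots> \<le> (2 * M / s + 1)\<^sup>2"
    using assms by (intro power_mono) (auto simp: J_def)
  finally show ?thesis .
qed

lemma card_le_grid3:
  fixes f g h :: "'a \<Rightarrow> real"
  assumes "finite S" "0 < s" "0 \<le> M"
    and "\<And>i. i \<in> S \<Longrightarrow> \<bar>f i\<bar> \<le> M" "\<And>i. i \<in> S \<Longrightarrow> \<bar>g i\<bar> \<le> M" "\<And>i. i \<in> S \<Longrightarrow> \<bar>h i\<bar> \<le> M"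
    and sep: "\<And>i j. i \<in> S \<Longrightarrow> j \<in> S \<Longrightarrow> i \<noteq> j \<Longrightarrow>
      s \<le> \<bar>f i - f j\<bar> \<or> s \<le> \<bar>g i - g j\<bar> \<or> s \<le> \<bar>h i - h j\<bar>"
  shows "real (card S) \<le> (2 * M / s + 1) ^ 3"
proof -
  define cell where "cell h i = \<lfloor>(h i + M) / s\<rfloor>" for h :: "'a \<Rightarrow> real" and i
  define J where "J = {0..\<lfloor>2 * M / s\<rfloor>}"
  have cell_in: "cell h i \<in> J" if "\<bar>h i\<bar> \<le> M" for h i
    unfolding cell_def J_def by (rule grid_cell_range[OF \<open>0 < s\<close> that])
  have "inj_on (\<lambda>i. (cell f i, cell g i, cell h i)) S"
  proof (rule inj_onI, rule ccontr)
    fix i j assume "i \<in> S" "j \<in> S" "(cell f i, cell g i, cell h i) = (cell f j, cell g j, cell h j)" "i \<noteq> j"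
    then show False using \<open>0 < s\<close> sep[of i j] grid_cell_dist[of s "f i" M "f j"] grid_cell_dist[of s "g i" M "g j"] grid_cell_dist[of s "h i" M "h j"]
      by (auto simp: cell_def)
  qed
  then have "card S \<le> card (J \<times> J \<times> J)"
    using assms cell_in by (intro card_inj_on_le[of "\<lambda>i. (cell f i, cell g i, cell h i)"]) (auto simp: J_def)
  also have "\<dots> = card J ^ 3" by (simp add: card_cartesian_product power3_eq_cube)
  finally have "real (card S) \<le> real (card J) ^ 3"
    by (metis of_nat_le_iff of_nat_power)
  also have "\<dots> \<le> (2 * M / s + 1) ^ 3"
    using assms by (intro power_mono) (auto simp: J_def)
  finally show ?thesis .
qed

text \<open>The potential \<open>1/r\<close> is summed over dyadic shells; the shell of radius \<open>\<rho>\<close> holds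
  \<open>O(\<rho>^3/s^3)\<close> points.\<close>
lemma sum_inverse_dist_le:
  fixes r :: "'a \<Rightarrow> real"
  assumes "finite S" "0 < s" and low: "\<And>i. i \<in> S \<Longrightarrow> s \<le> r i"
    and ball: "\<And>\<rho>. s \<le> \<rho> \<Longrightarrow> real (card {i \<in> S. r i \<le> \<rho>}) \<le> (2 * \<rho> / s + 1) ^ 3"
  shows "0 \<le> \<rho> \<Longrightarrow> (\<Sum>i | i \<in> S \<and> r i \<le> \<rho>. 1 / r i) \<le> 72 * \<rho>\<^sup>2 / s ^ 3"
proof -
  have "(\<Sum>i | i \<in> S \<and> r i \<le> \<rho>. 1 / r i) \<le> 72 * \<rho>\<^sup>2 / s ^ 3" if "0 \<le> \<rho>" "\<rho> < s * 2 ^ k" for k \<rho>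
    using that
  proof (induction k arbitrary: \<rho>)
    case 0
    have "{i. i \<in> S \<and> r i \<le> \<rho>} = {}" using low 0 by force
    then have "(\<Sum>i | i \<in> S \<and> r i \<le> \<rho>. 1 / r i) = 0" by (simp only: sum.empty)
    then show ?case using \<open>0 < s\<close> by simp
  next
    case (Suc k)
    show ?case
    proof (cases "s \<le> \<rho>")
      case True
      let ?A = "{i. i \<in> S \<and> r i \<le> \<rho>}" and ?B = "{i. i \<in> S \<and> r i \<le> \<rho> / 2}"
      have "(\<Sum>i\<in>?A. 1 / r i) = (\<Sum>i\<in>?B. 1 / r i) + (\<Sum>i\<in>?A - ?B. 1 / r i)"
        using \<open>finite S\<close> Suc.prems by (subst sum.subset_diff[of ?B ?A]) auto
      \<comment> \<open>The constant solves C = C/4 + 54: the half-radius ball takes a quarter of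
        the bound, and the outer shell has at most (3 \<rho>/s)^3 points, each contributing at most
        2/\<rho>.\<close>
      also have "(\<Sum>i\<in>?B. 1 / r i) \<le> 72 * (\<rho> / 2)\<^sup>2 / s ^ 3"
        using Suc.prems by (intro Suc.IH) auto
      also have "(\<Sum>i\<in>?A - ?B. 1 / r i) \<le> (\<Sum>i\<in>?A - ?B. 2 / \<rho>)"
        using True \<open>0 < s\<close> by (intro sum_mono) (auto simp: field_simps)
      also have "\<dots> \<le> (2 * \<rho> / s + 1) ^ 3 * (2 / \<rho>)"
      proof -
        have "real (card (?A - ?B)) \<le> real (card ?A)"
          using \<open>finite S\<close> by (intro of_nat_mono card_mono) auto
        also have "\<dots> \<le> (2 * \<rho> / s + 1) ^ 3" by (rule ball[OF True])
        finally show ?thesis using True \<open>0 < s\<close>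
          by (simp add: divide_right_mono)
      qed
      also have "\<dots> \<le> (3 * \<rho> / s) ^ 3 * (2 / \<rho>)"
        using True \<open>0 < s\<close> by (intro mult_right_mono power_mono) (auto simp: field_simps)
      also have "\<dots> = 54 * \<rho>\<^sup>2 / s ^ 3"
        using True \<open>0 < s\<close> by (simp add: field_simps power2_eq_square power3_eq_cube)
      finally show ?thesis by (simp add: field_simps)
    next
      case False
      have "{i. i \<in> S \<and> r i \<le> \<rho>} = {}" using low False by force
      then have "(\<Sum>i | i \<in> S \<and> r i \<le> \<rho>. 1 / r i) = 0" by (simp only: sum.empty)
      then show ?thesis using \<open>0 < s\<close> by simp
    qed
  qed
  moreover obtain k where "\<rho> / s < 2 ^ k" using real_arch_pow[of 2 "\<rho> / s"] by auto
  ultimately show "0 \<le> \<rho> \<Longrightarrow> (\<Sum>i | i \<in> S \<and> r i \<le> \<rho>. 1 / r i) \<le> 72 * \<rho>\<^sup>2 / s ^ 3"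
    using \<open>0 < s\<close> by (simp add: field_simps)
qed

lemma card_nat_Ioc_bounds:
  fixes a L :: real
  assumes "0 \<le> a" "0 \<le> L"
  shows "real (card {k::nat. a < real k \<and> real k \<le> a + L}) \<ge> L - 1"
    and "real (card {k::nat. a < real k \<and> real k \<le> a + L}) \<le> L + 1"
proof -
  have "{k::nat. a < real k \<and> real k \<le> a + L} = {nat \<lfloor>a\<rfloor> <.. nat \<lfloor>a + L\<rfloor>}"
    using assms by (auto simp: le_nat_floor le_nat_iff floor_less_iff le_floor_iff nat_less_iff)
  then have "real (card {k::nat. a < real k \<and> real k \<le> a + L}) = real (nat \<lfloor>a + L\<rfloor> - nat \<lfloor>a\<rfloor>)"
    by simp
  also have "\<dots> = real_of_int \<lfloor>a + L\<rfloor> - real_of_int \<lfloor>a\<rfloor>"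
    using assms by (simp add: nat_mono floor_mono of_nat_diff)
  finally show "real (card {k::nat. a < real k \<and> real k \<le> a + L}) \<ge> L - 1"
    "real (card {k::nat. a < real k \<and> real k \<le> a + L}) \<le> L + 1" by linarith+
qed

text \<open>The values at the extreme indices of the set differ by less than 2 \<eta> and are linear
  in the index, which bounds the index range.\<close>

lemma card_grid_near_zero_le:
  fixes c u :: real
  assumes "u \<noteq> 0" "0 < b" "0 \<le> \<eta>"
  shows "real (card {k\<in>{..<b}. \<bar>c + real k / real b * u\<bar> < \<eta>}) \<le> 2 * \<eta> * b / \<bar>u\<bar> + 1"
proof -
  define S where "S = {k\<in>{..<b}. \<bar>c + real k / real b * u\<bar> < \<eta>}"
  show ?thesis
  proof (cases "S = {}")
    case True
    then show ?thesis using assms unfolding S_def[symmetric] by simp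
  next
    case False
    have fin: "finite S" by (simp add: S_def)
    define m M where "m = Min S" and "M = Max S"
    have mM: "m \<in> S" "M \<in> S" "m \<le> M" using fin False unfolding m_def M_def by auto
    have "S \<subseteq> {m..M}" using fin unfolding m_def M_def by auto
    then have "card S \<le> Suc M - m" using card_mono[of "{m..M}" S] by simp
    then have "real (card S) \<le> real M - real m + 1" using mM by linarith
    moreover have "(real M - real m) * \<bar>u\<bar> \<le> 2 * \<eta> * b"
    proof -
      have "\<bar>(c + real M / real b * u) - (c + real m / real b * u)\<bar> < 2 * \<eta>"
        using mM unfolding S_def by (auto simp: abs_less_iff)
      also have "(c + real M / real b * u) - (c + real m / real b * u) = (real M - real m) * u / b"
        by (simp add: algebra_simps diff_divide_distrib)
      finally show ?thesis using \<open>0 < b\<close> mM by (simp add: abs_mult field_simps)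
    qed
    then have "real M - real m \<le> 2 * \<eta> * b / \<bar>u\<bar>" using assms by (simp add: field_simps)
    ultimately show ?thesis unfolding S_def[symmetric] by simp
  qed
qed

section \<open>Slabs above a random paraboloid\<close>

text \<open>Level sets of this function are translates of z = x^2 + y^2: the linear terms only move
  the vertex. They leave the convexity untouched but shift the heights of two points against each
  other.\<close>

definition tilted_height :: "(nat \<Rightarrow> nat \<Rightarrow> real) \<Rightarrow> real \<Rightarrow> real \<Rightarrow> nat \<Rightarrow> real" where
  "tilted_height q l m i = q i 2 - ((q i 0)\<^sup>2 + (q i 1)\<^sup>2) + l * q i 0 + m * q i 1"

text \<open>Heights lie in [-5, 5] and \<eta> \<le> 1, so lower ends running through [-6, 6) reach
  every slab that can contain a point.\<close>

definition offsets :: "nat \<Rightarrow> real \<Rightarrow> real \<Rightarrow> nat set" where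
  "offsets b \<eta> g = {k. 12 * (real k / real b) - 6 \<le> g \<and> g < 12 * (real k / real b) - 6 + \<eta>}"

text \<open>For \<open>v < b ^ 3\<close>, the first two base-\<open>b\<close> digits of \<open>v\<close> tilt the paraboloid, the third one
  selects the offset of the slab in \<open>[-6, 6)\<close>.\<close>
definition in_slab :: "nat \<Rightarrow> real \<Rightarrow> (nat \<Rightarrow> nat \<Rightarrow> real) \<Rightarrow> nat \<Rightarrow> nat \<Rightarrow> bool" where
  "in_slab b \<eta> q v i \<longleftrightarrow> v div b div b \<in> offsets b \<eta>
     (tilted_height q (real (v mod b) / real b) (real (v div b mod b) / real b) i)"

definition near :: "real \<Rightarrow> (nat \<Rightarrow> nat \<Rightarrow> real) \<Rightarrow> nat \<Rightarrow> nat \<Rightarrow> bool" where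
  "near \<eta> q i j \<longleftrightarrow> (q i 0 - q j 0)\<^sup>2 + (q i 1 - q j 1)\<^sup>2 \<le> \<eta>"

lemma sum_card_swap:
  assumes "finite V" "finite I"
  shows "(\<Sum>v\<in>V. card {i\<in>I. P v i}) = (\<Sum>i\<in>I. card {v\<in>V. P v i})"
  using sum_multicount_gen[OF assms, of P] by simp

text \<open>Base-\<open>b\<close> expansion is a bijection between {..<b^3} and triples of digits;
  this turns one uniform word into three independent uniform digits.\<close>

lemma card_digits:
  fixes P :: "nat \<Rightarrow> nat \<Rightarrow> nat \<Rightarrow> bool"
  assumes "0 < b"
  shows "card {v\<in>{..<b^3}. P (v mod b) (v div b mod b) (v div b div b)} =
    card {(i, j, k). i < b \<and> j < b \<and> k < b \<and> P i j k}"
proof (rule bij_betw_same_card[of "\<lambda>v. (v mod b, v div b mod b, v div b div b)"],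
    rule bij_betw_byWitness[of _ "\<lambda>(i, j, k). i + b * (j + b * k)"], goal_cases)
  case 1
  show ?case by auto
next
  case 2
  show ?case using assms by (auto simp: div_mult_self2 mod_mult_self2)
next
  case 3
  show ?case using assms by (auto simp: power3_eq_cube less_mult_imp_div_less mult.assoc)
next
  case 4
  have "i + b * (j + b * k) < b ^ 3" if "i < b" "j < b" "k < b" for i j k
  proof -
    have "j + b * k < b + b * k" using that by simp
    also have "\<dots> = b * (k + 1)" by simp
    also have "\<dots> \<le> b * b" using that by (intro mult_left_mono) auto
    finally have "j + b * k + 1 \<le> b * b" by simp
    then have "b * (j + b * k + 1) \<le> b * (b * b)" by (rule mult_left_mono) simp
    then show ?thesis using that by (simp add: power3_eq_cube algebra_simps)
  qed
  then show ?case using assms by (auto simp: div_mult_self2 mod_mult_self2)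
qed

text \<open>\<open>2 * \<eta> \<le> s\<close> makes slabs thinner than the separation;
  \<open>24 \<le> \<eta> * real b\<close> makes the offset and tilt grids fine enough that rounding
  costs only constant factors; \<open>volume\<close>, with 2985984 = 12^6, is exactly what
  \<open>sum_crowding\<close> consumes.\<close>

locale scaled_points =
  fixes n b :: nat and q :: "nat \<Rightarrow> nat \<Rightarrow> real" and s \<eta> :: real
  assumes bounded: "\<And>i c. i < n \<Longrightarrow> c < 3 \<Longrightarrow> \<bar>q i c\<bar> \<le> 1"
    and separated: "\<And>i j. i < n \<Longrightarrow> j < n \<Longrightarrow> i \<noteq> j \<Longrightarrow>
      s \<le> \<bar>q i 0 - q j 0\<bar> \<or> s \<le> \<bar>q i 1 - q j 1\<bar> \<or> s \<le> \<bar>q i 2 - q j 2\<bar>"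
    and eta: "0 < \<eta>" "\<eta> \<le> 1" "2 * \<eta> \<le> s" "24 \<le> \<eta> * real b"
    and volume: "2985984 * \<eta>\<^sup>2 \<le> s ^ 3"
begin

lemma b_pos: "0 < b"
  using eta by (cases b) auto

lemma s_pos: "0 < s"
  using eta by linarith

lemma bounded':
  assumes "i < n"
  shows "\<bar>q i 0\<bar> \<le> 1" "\<bar>q i 1\<bar> \<le> 1" "\<bar>q i 2\<bar> \<le> 1"
  using bounded[of i] assms by auto

lemma tilted_height_bound:
  assumes "i < n" "0 \<le> l" "l \<le> 1" "0 \<le> m" "m \<le> 1"
  shows "\<bar>tilted_height q l m i\<bar> \<le> 5"
proof -
  note B = bounded'[OF assms(1)]
  have "(q i 0)\<^sup>2 \<le> 1" "(q i 1)\<^sup>2 \<le> 1" using B by (auto simp: abs_le_square_iff[of _ 1, simplified])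
  moreover have "\<bar>l * q i 0\<bar> \<le> 1 * 1" "\<bar>m * q i 1\<bar> \<le> 1 * 1"
    unfolding abs_mult using assms B by (intro mult_mono; simp)+
  moreover have "0 \<le> (q i 0)\<^sup>2" "0 \<le> (q i 1)\<^sup>2" by auto
  ultimately show ?thesis unfolding tilted_height_def using B by linarith
qed

text \<open>The admissible offsets are the integers in a half-open interval of length \<eta> b / 12
  \<ge> 2, so the rounding error of 1 costs at most a factor 2 either way.\<close>

lemma card_offsets:
  assumes "\<bar>g\<bar> \<le> 5"
  shows "offsets b \<eta> g \<subseteq> {..<b}"
    and "\<eta> * b / 24 \<le> real (card (offsets b \<eta> g))"
    and "real (card (offsets b \<eta> g)) \<le> \<eta> * b / 6"
proof -
  define a where "a = b * (g + 6 - \<eta>) / 12"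
  have bp: "0 < real b" using b_pos by simp
  have eq: "offsets b \<eta> g = {k. a < real k \<and> real k \<le> a + \<eta> * b / 12}"
    using bp by (auto simp: a_def offsets_def field_simps)
  show "offsets b \<eta> g \<subseteq> {..<b}"
  proof
    fix k assume "k \<in> offsets b \<eta> g"
    then have "real k \<le> b * (g + 6) / 12" using bp by (simp add: offsets_def field_simps)
    also have "\<dots> \<le> b * 11 / 12" using assms bp by (intro divide_right_mono mult_left_mono) auto
    also have "\<dots> < real b" using bp by simp
    finally show "k \<in> {..<b}" by simp
  qed
  have "0 \<le> a" unfolding a_def using assms eta by (intro divide_nonneg_pos mult_nonneg_nonneg) auto
  moreover have "2 \<le> \<eta> * b / 12" using eta by simp
  ultimately show "\<eta> * b / 24 \<le> real (card (offsets b \<eta> g))"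
    "real (card (offsets b \<eta> g)) \<le> \<eta> * b / 6"
    using card_nat_Ioc_bounds[of a "\<eta> * b / 12"] unfolding eq by linarith+
qed

text \<open>For a single point the random offset already suffices: the estimate of
  \<open>card_offsets\<close> holds for each tilt separately and is summed over all b^2
  tilts.\<close>

lemma card_slab_draws:
  assumes "i < n"
  shows "\<eta> * b ^ 3 / 24 \<le> real (card {v\<in>{..<b^3}. in_slab b \<eta> q v i})"
    and "real (card {v\<in>{..<b^3}. in_slab b \<eta> q v i}) \<le> \<eta> * b ^ 3 / 6"
proof -
  define h where "h l m = tilted_height q (real l / real b) (real m / real b) i" for l m :: nat
  have h: "\<bar>h l m\<bar> \<le> 5" if "l < b" "m < b" for l m
    unfolding h_def using assms that by (intro tilted_height_bound) auto
  have "card {v\<in>{..<b^3}. in_slab b \<eta> q v i} =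
      card {(l, m, k). l < b \<and> m < b \<and> k < b \<and> k \<in> offsets b \<eta> (h l m)}"
    unfolding in_slab_def h_def by (rule card_digits[OF b_pos])
  also have "{(l, m, k). l < b \<and> m < b \<and> k < b \<and> k \<in> offsets b \<eta> (h l m)} =
      (SIGMA l:{..<b}. SIGMA m:{..<b}. offsets b \<eta> (h l m))"
    using card_offsets(1)[OF h] by blast
  also have "card \<dots> = (\<Sum>l<b. \<Sum>m<b. card (offsets b \<eta> (h l m)))"
    using finite_subset[OF card_offsets(1)[OF h]]
    by (subst card_SigmaI) (auto intro!: sum.cong)
  finally have eq: "real (card {v\<in>{..<b^3}. in_slab b \<eta> q v i}) =
      (\<Sum>l<b. \<Sum>m<b. real (card (offsets b \<eta> (h l m))))"
    by simp
  have "(\<Sum>l<b. \<Sum>m<b. \<eta> * b / 24) \<le> (\<Sum>l<b. \<Sum>m<b. real (card (offsets b \<eta> (h l m))))"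
    using card_offsets(2)[OF h] by (intro sum_mono) auto
  then show "\<eta> * b ^ 3 / 24 \<le> real (card {v\<in>{..<b^3}. in_slab b \<eta> q v i})"
    unfolding eq by (simp add: power3_eq_cube mult_ac)
  have "(\<Sum>l<b. \<Sum>m<b. real (card (offsets b \<eta> (h l m)))) \<le> (\<Sum>l<b. \<Sum>m<b. \<eta> * b / 6)"
    using card_offsets(3)[OF h] by (intro sum_mono) auto
  then show "real (card {v\<in>{..<b^3}. in_slab b \<eta> q v i}) \<le> \<eta> * b ^ 3 / 6"
    unfolding eq by (simp add: power3_eq_cube mult_ac)
qed

definition cheb :: "nat \<Rightarrow> nat \<Rightarrow> real" where
  "cheb i j = max \<bar>q i 0 - q j 0\<bar> (max \<bar>q i 1 - q j 1\<bar> \<bar>q i 2 - q j 2\<bar>)"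

lemma cheb_ge: "i < n \<Longrightarrow> j < n \<Longrightarrow> i \<noteq> j \<Longrightarrow> s \<le> cheb i j"
  using separated[of i j] unfolding cheb_def by linarith

text \<open>Two points in a common slab cannot be close to vertically above one another, since the slab
  is thinner than the separation and its boundary has bounded slope.\<close>
lemma cheb_le_horizontal:
  assumes "i < n" "j < n" "i \<noteq> j" "0 \<le> l" "l \<le> 1" "0 \<le> m" "m \<le> 1"
    and "\<bar>tilted_height q l m i - tilted_height q l m j\<bar> < \<eta>"
  shows "cheb i j \<le> 12 * max \<bar>q i 0 - q j 0\<bar> \<bar>q i 1 - q j 1\<bar>"
proof -
  have sq: "\<bar>x\<^sup>2 - y\<^sup>2\<bar> \<le> 2 * \<bar>x - y\<bar>" if "\<bar>x\<bar> \<le> 1" "\<bar>y\<bar> \<le> 1" for x y :: real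
  proof -
    have "x\<^sup>2 - y\<^sup>2 = (x + y) * (x - y)" by (simp add: power2_eq_square algebra_simps)
    then have "\<bar>x\<^sup>2 - y\<^sup>2\<bar> = \<bar>x + y\<bar> * \<bar>x - y\<bar>" by (simp only: abs_mult)
    also have "\<dots> \<le> 2 * \<bar>x - y\<bar>" using that by (intro mult_right_mono) auto
    finally show ?thesis .
  qed
  note B = bounded'[OF assms(1)] bounded'[OF assms(2)]
  have eq: "tilted_height q l m i - tilted_height q l m j = (q i 2 - q j 2) - ((q i 0)\<^sup>2 - (q j 0)\<^sup>2)
      - ((q i 1)\<^sup>2 - (q j 1)\<^sup>2) + l * (q i 0 - q j 0) + m * (q i 1 - q j 1)"
    by (simp add: tilted_height_def algebra_simps)
  have squares: "\<bar>(q i 0)\<^sup>2 - (q j 0)\<^sup>2\<bar> \<le> 2 * \<bar>q i 0 - q j 0\<bar>" "\<bar>(q i 1)\<^sup>2 - (q j 1)\<^sup>2\<bar> \<le> 2 * \<bar>q i 1 - q j 1\<bar>"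
    using B by (auto intro: sq)
  have tilt: "\<bar>l * (q i 0 - q j 0)\<bar> \<le> 1 * \<bar>q i 0 - q j 0\<bar>" "\<bar>m * (q i 1 - q j 1)\<bar> \<le> 1 * \<bar>q i 1 - q j 1\<bar>"
    unfolding abs_mult using assms by (intro mult_right_mono; simp)+
  \<comment> \<open>The slope 3 is 2 from the squares on [-1, 1] plus 1 from the tilt.\<close>
  have "\<bar>d\<bar> \<le> \<eta> + 3 * a + 3 * a'"
    if "t = d - x - y + e + f" "\<bar>t\<bar> < \<eta>" "\<bar>x\<bar> \<le> 2 * a" "\<bar>y\<bar> \<le> 2 * a'" "\<bar>e\<bar> \<le> 1 * a" "\<bar>f\<bar> \<le> 1 * a'"
    for t d x y e f a a' :: real
    using that unfolding abs_le_iff abs_less_iff by linarith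
  from this[OF eq assms(8) squares tilt]
  have vertical: "\<bar>q i 2 - q j 2\<bar> \<le> \<eta> + 3 * \<bar>q i 0 - q j 0\<bar> + 3 * \<bar>q i 1 - q j 1\<bar>" .
  have thin: "2 * \<eta> \<le> cheb i j" using cheb_ge[OF assms(1-3)] eta by linarith
  \<comment> \<open>If the vertical difference z dominates, then e \<le> z/2 is absorbed, leaving z
    \<le> 6x + 6y \<le> 12 max x y.\<close>
  have "max x (max y z) \<le> 12 * max x y"
    if "z \<le> e + 3 * x + 3 * y" "2 * e \<le> max x (max y z)" "0 \<le> x" "0 \<le> y" for x y z e :: real
  proof (cases "z \<le> max x y")
    case True
    then have "max x (max y z) \<le> max x y" by simp
    moreover have "0 \<le> max x y" using that(3) by (simp add: le_max_iff_disj)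
    ultimately show ?thesis by linarith
  next
    case False
    then have "max x (max y z) = z" by simp
    then show ?thesis using that False max.cobounded1[of x y] max.cobounded2[of y x] by linarith
  qed
  from this[OF vertical thin[unfolded cheb_def]] show ?thesis unfolding cheb_def by simp
qed

text \<open>Fix the digit with the smaller slope and vary the other one over a line of grid points.
  The additive 1 of the one-dimensional count is absorbed because the slope is at most 2 and \<eta>
  b \<ge> 24.\<close>

lemma card_grid2_near_zero_le:
  fixes c u w :: real
  assumes "max \<bar>u\<bar> \<bar>w\<bar> \<le> 2" "0 < max \<bar>u\<bar> \<bar>w\<bar>"
  shows "real (card {(l, m). l < b \<and> m < b \<and> \<bar>c + real l / real b * u + real m / real b * w\<bar> < \<eta>})
    \<le> 3 * \<eta> * b\<^sup>2 / max \<bar>u\<bar> \<bar>w\<bar>"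
proof -
  have main: "real (card {(l, m). l < b \<and> m < b \<and> \<bar>c + real l / real b * u + real m / real b * w\<bar> < \<eta>})
      \<le> 3 * \<eta> * b\<^sup>2 / \<bar>w\<bar>" if w: "\<bar>w\<bar> \<le> 2" "0 < \<bar>w\<bar>" for u w
  proof -
    let ?T = "\<lambda>l. {m\<in>{..<b}. \<bar>(c + real l / real b * u) + real m / real b * w\<bar> < \<eta>}"
    have "{(l, m). l < b \<and> m < b \<and> \<bar>c + real l / real b * u + real m / real b * w\<bar> < \<eta>} =
        (SIGMA l:{..<b}. ?T l)" by auto
    then have "real (card {(l, m). l < b \<and> m < b \<and> \<bar>c + real l / real b * u + real m / real b * w\<bar> < \<eta>}) =
        (\<Sum>l<b. real (card (?T l)))" by simp
    also have "\<dots> \<le> (\<Sum>l<b. 3 * \<eta> * b / \<bar>w\<bar>)"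
    proof (rule sum_mono)
      fix l
      have "real (card (?T l)) \<le> 2 * \<eta> * b / \<bar>w\<bar> + 1"
        using card_grid_near_zero_le[of w b \<eta>] w b_pos eta by auto
      also have "1 \<le> \<eta> * b / \<bar>w\<bar>" using w eta by (simp add: field_simps)
      finally show "real (card (?T l)) \<le> 3 * \<eta> * b / \<bar>w\<bar>" by (simp add: field_simps)
    qed
    also have "\<dots> = 3 * \<eta> * b\<^sup>2 / \<bar>w\<bar>" by (simp add: power2_eq_square)
    finally show ?thesis .
  qed
  show ?thesis
  proof (cases "\<bar>u\<bar> \<le> \<bar>w\<bar>")
    case True
    then show ?thesis using main[of w u] assms by (simp add: max_def)
  next
    case False
    have "card {(l, m). l < b \<and> m < b \<and> \<bar>c + real l / real b * u + real m / real b * w\<bar> < \<eta>} =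
       card {(m, l). m < b \<and> l < b \<and> \<bar>c + real m / real b * w + real l / real b * u\<bar> < \<eta>}"
      by (rule bij_betw_same_card[of prod.swap], rule bij_betw_byWitness[of _ prod.swap])
        (auto simp: algebra_simps)
    then show ?thesis using main[of u w] False assms by (simp add: max_def)
  qed
qed

text \<open>A common slab forces the tilt into the strip \<open>T\<close> where the heights differ
  by less than \<eta>, which has at most 36 \<eta> b^2 / \<open>cheb i j\<close> tilts; each of
  these leaves at most \<eta> b / 6 offsets. If \<open>T\<close> is nonempty, a tilt in it bounds
  the full distance by 12 times the horizontal one, which explains the cutoff for near
  points.\<close>

lemma card_common_slab_le:
  assumes "i < n" "j < n" "i \<noteq> j" "near \<eta> q i j"
  shows "real (card {v\<in>{..<b^3}. in_slab b \<eta> q v i \<and> in_slab b \<eta> q v j})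
    \<le> (if cheb i j \<le> 12 * sqrt \<eta> then 6 * \<eta>\<^sup>2 * b ^ 3 / cheb i j else 0)"
proof -
  define h where "h i l m = tilted_height q (real l / real b) (real m / real b) i" for l m i :: nat
  have h: "\<bar>h i l m\<bar> \<le> 5" if "l < b" "m < b" for l m
    unfolding h_def using assms that by (intro tilted_height_bound) auto
  define T where "T = {(l, m). l < b \<and> m < b \<and> \<bar>h i l m - h j l m\<bar> < \<eta>}"
  define u w where "u = q i 0 - q j 0" and "w = q i 1 - q j 1"
  have "T \<subseteq> {..<b} \<times> {..<b}" by (auto simp: T_def)
  then have finT: "finite T" by (rule finite_subset) auto
  let ?D = "{(l, m, k). l < b \<and> m < b \<and> k < b \<and> k \<in> offsets b \<eta> (h i l m) \<and> k \<in> offsets b \<eta> (h j l m)}"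
  let ?E = "SIGMA x:T. offsets b \<eta> (h i (fst x) (snd x))"
  have finE: "finite ?E"
    using finT finite_subset[OF card_offsets(1)[OF h]] by (intro finite_SigmaI) (auto simp: T_def)
  have "card {v\<in>{..<b^3}. in_slab b \<eta> q v i \<and> in_slab b \<eta> q v j} = card ?D"
    unfolding in_slab_def h_def by (rule card_digits[OF b_pos])
  also have "card ?D \<le> card ?E"
  proof (rule card_inj_on_le[of "\<lambda>(l, m, k). ((l, m), k)"])
    have "\<bar>g - g'\<bar> < \<eta>" if "k \<in> offsets b \<eta> g" "k \<in> offsets b \<eta> g'" for k g g'
      using that unfolding offsets_def by auto
    then show "(\<lambda>(l, m, k). ((l, m), k)) ` ?D \<subseteq> ?E" by (auto simp: T_def)
  qed (auto simp: inj_on_def finE)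
  also have "card ?E = (\<Sum>x\<in>T. card (offsets b \<eta> (h i (fst x) (snd x))))"
    using finT finite_subset[OF card_offsets(1)[OF h]] by (intro card_SigmaI) (auto simp: T_def)
  finally have "real (card {v\<in>{..<b^3}. in_slab b \<eta> q v i \<and> in_slab b \<eta> q v j}) \<le>
      (\<Sum>x\<in>T. real (card (offsets b \<eta> (h i (fst x) (snd x)))))"
    by (simp flip: of_nat_sum)
  also have "\<dots> \<le> (\<Sum>x\<in>T. \<eta> * b / 6)"
    using card_offsets(3)[OF h] by (intro sum_mono) (auto simp: T_def)
  finally have le: "real (card {v\<in>{..<b^3}. in_slab b \<eta> q v i \<and> in_slab b \<eta> q v j}) \<le>
      real (card T) * (\<eta> * b / 6)" by simp
  show ?thesis
  proof (cases "T = {}")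
    case True
    have "0 \<le> 6 * \<eta>\<^sup>2 * b ^ 3 / cheb i j"
      using cheb_ge[OF assms(1-3)] s_pos by simp
    moreover have "real (card {v\<in>{..<b^3}. in_slab b \<eta> q v i \<and> in_slab b \<eta> q v j}) \<le> 0"
      using True le by simp
    ultimately show ?thesis by (smt (verit) of_nat_power)
  next
    case False
    then obtain l m where lm: "l < b" "m < b" "\<bar>h i l m - h j l m\<bar> < \<eta>" by (auto simp: T_def)
    have cheb: "cheb i j \<le> 12 * max \<bar>u\<bar> \<bar>w\<bar>"
      unfolding u_def w_def using assms lm
      by (intro cheb_le_horizontal[of i j "real l / real b" "real m / real b"]) (auto simp: h_def)
    have cheb_pos: "0 < cheb i j" using cheb_ge[OF assms(1-3)] s_pos by linarith
    have "u\<^sup>2 + w\<^sup>2 \<le> \<eta>" using assms(4) by (simp add: near_def u_def w_def)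
    then have "u\<^sup>2 \<le> \<eta>" "w\<^sup>2 \<le> \<eta>" using zero_le_power2[of u] zero_le_power2[of w] by linarith+
    then have "max \<bar>u\<bar> \<bar>w\<bar> \<le> sqrt \<eta>"
      by (intro max.boundedI real_le_rsqrt) auto
    then have small: "cheb i j \<le> 12 * sqrt \<eta>" using cheb by linarith
    have "\<bar>u\<bar> \<le> 2" "\<bar>w\<bar> \<le> 2"
      using bounded'[OF assms(1)] bounded'[OF assms(2)] unfolding u_def w_def by linarith+
    then have uw: "max \<bar>u\<bar> \<bar>w\<bar> \<le> 2" "0 < max \<bar>u\<bar> \<bar>w\<bar>"
      using cheb cheb_pos by (simp, linarith)
    \<comment> \<open>The quadratic parts cancel into the constant term: the height difference is
      affine in the tilt with the horizontal differences as slopes.\<close>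
    have "T = {(l, m). l < b \<and> m < b \<and>
        \<bar>(h i 0 0 - h j 0 0) + real l / real b * u + real m / real b * w\<bar> < \<eta>}"
      unfolding T_def h_def tilted_height_def u_def w_def by (simp add: algebra_simps)
    then have "real (card T) \<le> 3 * \<eta> * b\<^sup>2 / max \<bar>u\<bar> \<bar>w\<bar>"
      using card_grid2_near_zero_le[OF uw, of "h i 0 0 - h j 0 0"] by simp
    also have "\<dots> \<le> 3 * \<eta> * b\<^sup>2 / (cheb i j / 12)"
      using cheb cheb_pos eta uw by (intro divide_left_mono) auto
    finally have "real (card T) * (\<eta> * b / 6) \<le> 3 * \<eta> * b\<^sup>2 / (cheb i j / 12) * (\<eta> * b / 6)"
      using eta by (intro mult_right_mono) auto
    also have "\<dots> = 6 * \<eta>\<^sup>2 * b ^ 3 / cheb i j"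
      by (simp add: power2_eq_square power3_eq_cube)
    finally show ?thesis using le small by simp
  qed
qed

section \<open>Expected slab size and expected number of close pairs\<close>

definition slab_size :: "nat \<Rightarrow> nat" where
  "slab_size v = card {i\<in>{..<n}. in_slab b \<eta> q v i}"

definition crowding :: "nat \<Rightarrow> nat" where
  "crowding v = card {p\<in>{..<n} \<times> {..<n}. snd p < fst p \<and> near \<eta> q (fst p) (snd p) \<and>
     in_slab b \<eta> q v (fst p) \<and> in_slab b \<eta> q v (snd p)}"

text \<open>Every slab point missing from \<open>Z\<close> is the larger index of some crowding
  pair. This is applied both to an ideal greedy set and to the actual output of the program.\<close>

lemma slab_size_le:
  assumes "finite Z"
    and "\<And>i. i < n \<Longrightarrow> in_slab b \<eta> q v i \<Longrightarrow> i \<notin> Z \<Longrightarrow>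
      \<exists>j<i. in_slab b \<eta> q v j \<and> near \<eta> q i j"
  shows "slab_size v \<le> card Z + crowding v"
proof -
  define Q where "Q = {p\<in>{..<n} \<times> {..<n}. snd p < fst p \<and> near \<eta> q (fst p) (snd p) \<and>
     in_slab b \<eta> q v (fst p) \<and> in_slab b \<eta> q v (snd p)}"
  have "finite Q" by (simp add: Q_def)
  have "{i\<in>{..<n}. in_slab b \<eta> q v i} \<subseteq> Z \<union> fst ` Q"
  proof
    fix i assume i: "i \<in> {i\<in>{..<n}. in_slab b \<eta> q v i}"
    show "i \<in> Z \<union> fst ` Q"
    proof (cases "i \<in> Z")
      case False
      then obtain j where "j < i" "in_slab b \<eta> q v j" "near \<eta> q i j" using assms(2) i by auto
      then have "(i, j) \<in> Q" using i by (simp add: Q_def)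
      then show ?thesis by force
    qed simp
  qed
  then have "slab_size v \<le> card (Z \<union> fst ` Q)"
    unfolding slab_size_def using assms(1) \<open>finite Q\<close> by (intro card_mono) auto
  also have "\<dots> \<le> card Z + card (fst ` Q)" by (rule card_Un_le)
  also have "card (fst ` Q) \<le> crowding v"
    unfolding crowding_def Q_def[symmetric] by (rule card_image_le[OF \<open>finite Q\<close>])
  finally show ?thesis by simp
qed

text \<open>The slab points without an earlier near point are pairwise horizontally far, so the
  planar packing bound limits them; all other slab points are charged to
  \<open>crowding\<close>.\<close>

lemma excess_le: "real (slab_size v) - real (crowding v) \<le> 25 / \<eta>"
proof -
  define Z where "Z = {i\<in>{..<n}. \<not> (\<exists>j<i. in_slab b \<eta> q v j \<and> near \<eta> q i j) \<and> in_slab b \<eta> q v i}"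
  have finZ: "finite Z" by (simp add: Z_def)
  have far: "\<not> near \<eta> q i j" if "i \<in> Z" "j \<in> Z" "i \<noteq> j" for i j
  proof (cases "j < i")
    case False
    then have "\<not> near \<eta> q j i" using that by (auto simp: Z_def)
    then show ?thesis by (simp add: near_def power2_commute)
  qed (use that in \<open>auto simp: Z_def\<close>)
  have "real (card Z) \<le> (2 * 1 / (sqrt \<eta> / 2) + 1)\<^sup>2"
  proof (rule card_le_grid2[where f = "\<lambda>i. q i 0" and g = "\<lambda>i. q i 1", OF finZ])
    fix i j assume ij: "i \<in> Z" "j \<in> Z" "i \<noteq> j"
    show "sqrt \<eta> / 2 \<le> \<bar>q i 0 - q j 0\<bar> \<or> sqrt \<eta> / 2 \<le> \<bar>q i 1 - q j 1\<bar>"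
    proof (rule ccontr)
      assume "\<not> ?thesis"
      then have "\<bar>q i 0 - q j 0\<bar>\<^sup>2 \<le> (sqrt \<eta> / 2)\<^sup>2" "\<bar>q i 1 - q j 1\<bar>\<^sup>2 \<le> (sqrt \<eta> / 2)\<^sup>2"
        by (intro power_mono; simp)+
      then have "near \<eta> q i j" using eta unfolding near_def by (simp add: power_divide)
      then show False using far[OF ij] by simp
    qed
  qed (use eta bounded' in \<open>auto simp: Z_def\<close>)
  also have "\<dots> \<le> (5 / sqrt \<eta>)\<^sup>2"
  proof (rule power_mono)
    have "1 \<le> 1 / sqrt \<eta>" using eta by simp
    then show "2 * 1 / (sqrt \<eta> / 2) + 1 \<le> 5 / sqrt \<eta>" by simp
  qed (use eta in simp)
  also have "\<dots> = 25 / \<eta>" using eta by (simp add: power_divide)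
  finally have "real (card Z) \<le> 25 / \<eta>" .
  moreover have "slab_size v \<le> card Z + crowding v"
    by (rule slab_size_le[OF finZ]) (auto simp: Z_def)
  ultimately show ?thesis by linarith
qed

lemma sum_slab_size:
  shows "real n * \<eta> * b ^ 3 / 24 \<le> (\<Sum>v<b^3. real (slab_size v))"
    and "(\<Sum>v<b^3. real (slab_size v)) \<le> real n * \<eta> * b ^ 3 / 6"
proof -
  have eq: "(\<Sum>v<b^3. real (slab_size v)) = (\<Sum>i<n. real (card {v\<in>{..<b^3}. in_slab b \<eta> q v i}))"
    unfolding slab_size_def of_nat_sum[symmetric] by (subst sum_card_swap) auto
  have "(\<Sum>i<n. \<eta> * b ^ 3 / 24) \<le> (\<Sum>i<n. real (card {v\<in>{..<b^3}. in_slab b \<eta> q v i}))"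
    using card_slab_draws by (intro sum_mono) auto
  then show "real n * \<eta> * b ^ 3 / 24 \<le> (\<Sum>v<b^3. real (slab_size v))" unfolding eq by simp
  have "(\<Sum>i<n. real (card {v\<in>{..<b^3}. in_slab b \<eta> q v i})) \<le> (\<Sum>i<n. \<eta> * b ^ 3 / 6)"
    using card_slab_draws by (intro sum_mono) auto
  then show "(\<Sum>v<b^3. real (slab_size v)) \<le> real n * \<eta> * b ^ 3 / 6" unfolding eq by simp
qed

lemma sum_inverse_cheb_le:
  assumes "i < n" "0 \<le> \<rho>"
  shows "(\<Sum>j | j \<in> {..<n} - {i} \<and> cheb i j \<le> \<rho>. 1 / cheb i j) \<le> 72 * \<rho>\<^sup>2 / s ^ 3"
proof (rule sum_inverse_dist_le[OF _ s_pos _ _ assms(2)])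
  fix \<sigma> assume "s \<le> \<sigma>"
  show "real (card {j \<in> {..<n} - {i}. cheb i j \<le> \<sigma>}) \<le> (2 * \<sigma> / s + 1) ^ 3"
  proof (rule card_le_grid3[where f = "\<lambda>j. q j 0 - q i 0" and g = "\<lambda>j. q j 1 - q i 1"
        and h = "\<lambda>j. q j 2 - q i 2", OF _ s_pos])
    fix j j'
    assume "j \<in> {j \<in> {..<n} - {i}. cheb i j \<le> \<sigma>}" "j' \<in> {j \<in> {..<n} - {i}. cheb i j \<le> \<sigma>}" "j \<noteq> j'"
    then show "s \<le> \<bar>q j 0 - q i 0 - (q j' 0 - q i 0)\<bar> \<or> s \<le> \<bar>q j 1 - q i 1 - (q j' 1 - q i 1)\<bar> \<or>
        s \<le> \<bar>q j 2 - q i 2 - (q j' 2 - q i 2)\<bar>"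
      using separated[of j j'] by simp
  qed (use \<open>s \<le> \<sigma>\<close> s_pos in \<open>auto simp: cheb_def abs_minus_commute\<close>)
qed (use assms cheb_ge in auto)

text \<open>The target 1/48 is half of the lower constant 1/24 in \<open>sum_slab_size\<close>. With
  pair constant 6, potential constant 72 and radius 12 \<eta>^(1/2), the requirement is 6 * 72 *
  12^2 * 48 = 12^6 times \<eta>^2 \<le> s^3, that is \<open>volume\<close>.\<close>

lemma sum_crowding: "(\<Sum>v<b^3. real (crowding v)) \<le> real n * \<eta> * b ^ 3 / 48"
proof -
  let ?P = "\<lambda>v p. snd p < fst p \<and> near \<eta> q (fst p) (snd p) \<and>
     in_slab b \<eta> q v (fst p) \<and> in_slab b \<eta> q v (snd p)"
  let ?R = "12 * sqrt \<eta>"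
  define f where "f i j = (if j \<noteq> i \<and> cheb i j \<le> ?R then 6 * \<eta>\<^sup>2 * b ^ 3 / cheb i j else 0)" for i j
  have f_nonneg: "0 \<le> f i j" if "i < n" "j < n" for i j
    using cheb_ge[of i j] s_pos that by (auto simp: f_def)
  have "(\<Sum>v<b^3. real (crowding v)) = (\<Sum>p\<in>{..<n}\<times>{..<n}. real (card {v\<in>{..<b^3}. ?P v p}))"
    unfolding crowding_def of_nat_sum[symmetric] by (subst sum_card_swap) auto
  also have "\<dots> \<le> (\<Sum>p\<in>{..<n}\<times>{..<n}. f (fst p) (snd p))"
  proof (rule sum_mono)
    fix p assume p: "p \<in> {..<n} \<times> {..<n}"
    show "real (card {v\<in>{..<b^3}. ?P v p}) \<le> f (fst p) (snd p)"
    proof (cases "snd p < fst p \<and> near \<eta> q (fst p) (snd p)")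
      case True
      then show ?thesis using p card_common_slab_le[of "fst p" "snd p"] by (auto simp: f_def)
    next
      case False
      then have "{v\<in>{..<b^3}. ?P v p} = {}" by auto
      then show ?thesis using f_nonneg[of "fst p" "snd p"] p by (simp only:) auto
    qed
  qed
  also have "\<dots> = (\<Sum>i<n. \<Sum>j<n. f i j)"
    by (simp add: sum.cartesian_product split_beta)
  also have "\<dots> \<le> (\<Sum>i<n. \<eta> * b ^ 3 / 48)"
  proof (rule sum_mono)
    fix i assume "i \<in> {..<n}"
    have "(\<Sum>j<n. f i j) = (\<Sum>j | j \<in> {..<n} - {i} \<and> cheb i j \<le> ?R. 6 * \<eta>\<^sup>2 * b ^ 3 / cheb i j)"
      unfolding f_def by (rule sum.mono_neutral_cong_right) auto
    also have "\<dots> = 6 * \<eta>\<^sup>2 * b ^ 3 * (\<Sum>j | j \<in> {..<n} - {i} \<and> cheb i j \<le> ?R. 1 / cheb i j)"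
      by (simp add: sum_distrib_left)
    also have "\<dots> \<le> 6 * \<eta>\<^sup>2 * b ^ 3 * (72 * ?R\<^sup>2 / s ^ 3)"
      using \<open>i \<in> {..<n}\<close> eta by (intro mult_left_mono sum_inverse_cheb_le) auto
    also have "\<dots> = \<eta> * b ^ 3 / 48 * (2985984 * \<eta>\<^sup>2 / s ^ 3)"
      using eta by (simp add: power_mult_distrib power2_eq_square)
    also have "\<dots> \<le> \<eta> * b ^ 3 / 48 * 1"
      using volume s_pos eta by (intro mult_left_mono) (auto simp: field_simps)
    finally show "(\<Sum>j<n. f i j) \<le> \<eta> * b ^ 3 / 48" by simp
  qed
  finally show ?thesis by simp
qed

text \<open>The first moment of \<open>slab_size - crowding\<close> together with its uniform upper bound makes it
  large with constant probability; Markov's inequality rules out overfull slabs.\<close>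
lemma card_good_draws:
  assumes "800 \<le> \<eta> * L"
  shows "real n * \<eta>\<^sup>2 / 4800 * b ^ 3 \<le> real (card {v\<in>{..<b^3}.
    real (slab_size v) < L \<and> real n * \<eta> / 96 \<le> real (slab_size v) - real (crowding v)})"
proof -
  define W where "W v = real (slab_size v) - real (crowding v)" for v
  define m where "m = real n * \<eta> / 96"
  define H where "H = {v\<in>{..<b^3}. m \<le> W v}"
  define G where "G = {v\<in>{..<b^3}. L \<le> real (slab_size v)}"
  have L: "0 < L" using assms eta by (smt (verit) mult_nonneg_nonpos)
  \<comment> \<open>The threshold \<open>m\<close> is half of the guaranteed mean excess 1/24 - 1/48
    = 1/48 (times n \<eta>), so half of the total must come from draws in \<open>H\<close>.\<close>
  have "m * b ^ 3 * 2 = real n * \<eta> * b ^ 3 / 24 - real n * \<eta> * b ^ 3 / 48" by (simp add: m_def)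
  also have "\<dots> \<le> (\<Sum>v<b^3. W v)"
    unfolding W_def sum_subtractf by (intro diff_mono sum_slab_size sum_crowding)
  also have "\<dots> \<le> (\<Sum>v<b^3. (if v \<in> H then 25 / \<eta> else 0) + m)"
    using excess_le eta by (intro sum_mono) (auto simp: H_def W_def m_def add_increasing2)
  also have "\<dots> = real (card H) * (25 / \<eta>) + m * b ^ 3"
    by (simp add: sum.distrib H_def Int_def sum.If_cases)
  finally have "m * b ^ 3 \<le> real (card H) * (25 / \<eta>)" by simp
  then have H: "real n * \<eta>\<^sup>2 / 2400 * b ^ 3 \<le> real (card H)"
    using eta by (simp add: m_def field_simps power2_eq_square)
  \<comment> \<open>Markov's inequality; 800 is chosen so that overfull slabs cost at most half of
    the lower bound for \<open>H\<close>, as 6 * 800 = 2 * 2400.\<close>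
  have "real (card G) * L = (\<Sum>v\<in>G. L)" by simp
  also have "\<dots> \<le> (\<Sum>v\<in>G. real (slab_size v))" by (intro sum_mono) (auto simp: G_def)
  also have "\<dots> \<le> (\<Sum>v<b^3. real (slab_size v))" by (intro sum_mono2) (auto simp: G_def)
  also have "\<dots> \<le> real n * \<eta> * b ^ 3 / 6" by (rule sum_slab_size)
  finally have "real (card G) \<le> real n * \<eta> * b ^ 3 / 6 / L" using L by (simp add: field_simps)
  also have "\<dots> = real n * \<eta> * b ^ 3 / 6 * (1 / L)" by simp
  also have "\<dots> \<le> real n * \<eta> * b ^ 3 / 6 * (\<eta> / 800)"
  proof (rule mult_left_mono)
    show "1 / L \<le> \<eta> / 800" using assms L by (simp add: field_simps)
  qed (use eta in simp)
  finally have G: "real (card G) \<le> real n * \<eta>\<^sup>2 / 4800 * b ^ 3"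
    by (simp add: power2_eq_square mult_ac)
  have "{v\<in>{..<b^3}. real (slab_size v) < L \<and> real n * \<eta> / 96 \<le> real (slab_size v) - real (crowding v)}
      = H - G"
    by (auto simp: H_def G_def m_def W_def)
  moreover have "real (card H) - real (card G) \<le> real (card (H - G))"
    using diff_card_le_card_Diff[of G H] by (simp add: G_def)
  moreover have "real n * \<eta>\<^sup>2 / 2400 * b ^ 3 = 2 * (real n * \<eta>\<^sup>2 / 4800 * b ^ 3)" by simp
  ultimately show ?thesis using H G by simp
qed

end

section \<open>Points in convex position\<close>

lemma convex_positionI:
  assumes "\<And>x. x \<in> S \<Longrightarrow> \<exists>a. \<forall>y\<in>S - {x}. inner a x < inner a y"
  shows "convex_position S"
  unfolding convex_position_def
proof (intro ballI notI)
  fix x assume "x \<in> S" "x \<in> convex hull (S - {x})"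
  then obtain a where "\<forall>y\<in>S - {x}. inner a x < inner a y" using assms by blast
  then have "convex hull (S - {x}) \<subseteq> {y. inner a x < inner a y}"
    by (intro hull_minimal convex_halfspace_gt) auto
  then show False using \<open>x \<in> convex hull (S - {x})\<close> by blast
qed

text \<open>The first input point serves as origin and \<Delta> will be the largest coordinate
  deviation from it, both computable without square roots.\<close>

definition scaled_coord :: "(real ^ 3) list \<Rightarrow> real \<Rightarrow> nat \<Rightarrow> nat \<Rightarrow> real" where
  "scaled_coord xs \<Delta> i c = (coord (xs ! i) c - coord (xs ! 0) c) / \<Delta>"

text \<open>The plane through \<open>i\<close> parallel to the tangent plane of the tilted paraboloid lies below all
  other points: the paraboloid bends away from it by more than the thickness of the slab.\<close>
lemma convex_position_slab:
  assumes "0 < \<Delta>"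
    and slab: "\<And>i. i \<in> Z \<Longrightarrow> in_slab b \<eta> (scaled_coord xs \<Delta>) v i"
    and far: "\<And>i j. i \<in> Z \<Longrightarrow> j \<in> Z \<Longrightarrow> i \<noteq> j \<Longrightarrow> \<not> near \<eta> (scaled_coord xs \<Delta>) i j"
  shows "convex_position ((!) xs ` Z)"
proof (rule convex_positionI)
  fix x assume "x \<in> (!) xs ` Z"
  then obtain i where i: "i \<in> Z" "x = xs ! i" by auto
  let ?q = "scaled_coord xs \<Delta>"
  define l m where "l = real (v mod b) / real b" and "m = real (v div b mod b) / real b"
  \<comment> \<open>The gradient of the tilted height at the point \<open>i\<close>, a normal of the
    tilted paraboloid there.\<close>
  define a :: "real ^ 3" where "a = vector [l - 2 * ?q i 0, m - 2 * ?q i 1, 1]"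
  have "inner a x < inner a y" if "y \<in> (!) xs ` Z - {x}" for y
  proof -
    from that i obtain j where j: "j \<in> Z" "y = xs ! j" "j \<noteq> i" by auto
    have height_diff: "tilted_height ?q l m i - tilted_height ?q l m j < \<eta>"
      using slab[OF i(1)] slab[OF j(1)] unfolding in_slab_def offsets_def l_def m_def by auto
    have far': "\<eta> < (?q i 0 - ?q j 0)\<^sup>2 + (?q i 1 - ?q j 1)\<^sup>2"
      using far[OF i(1) j(1)] j(3) by (auto simp: near_def)
    have coord_diff: "coord y c - coord x c = \<Delta> * (?q j c - ?q i c)" for c
      using assms(1) i j by (simp add: scaled_coord_def field_simps)
    have "inner a y - inner a x = (l - 2 * ?q i 0) * (coord y 0 - coord x 0) +
        (m - 2 * ?q i 1) * (coord y 1 - coord x 1) + (coord y 2 - coord x 2)"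
      by (simp add: a_def inner_vec_def sum_3 coord_def algebra_simps)
    \<comment> \<open>Exact second-order expansion: the height is quadratic, so its deviation from
      the linearization at \<open>i\<close> is just the squared horizontal distance.\<close>
    also have "\<dots> = \<Delta> * ((?q i 0 - ?q j 0)\<^sup>2 + (?q i 1 - ?q j 1)\<^sup>2 -
        (tilted_height ?q l m i - tilted_height ?q l m j))"
      unfolding coord_diff by (simp add: tilted_height_def power2_eq_square algebra_simps)
    finally have "inner a y - inner a x = \<Delta> * ((?q i 0 - ?q j 0)\<^sup>2 + (?q i 1 - ?q j 1)\<^sup>2 -
        (tilted_height ?q l m i - tilted_height ?q l m j))" .
    moreover have "0 < \<dots>" using height_diff far' assms(1) by (intro mult_pos_pos) auto
    ultimately show ?thesis by linarith
  qed
  then show "\<exists>a. \<forall>y\<in>(!) xs ` Z - {x}. inner a x < inner a y" by blast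
qed

text \<open>Moving every point outwards along a normal of a supporting plane, up to the surface of a
  larger cube, does not decrease distances; on the surface a planar packing bound applies.\<close>
lemma card_convex_position_le:
  fixes S :: "(real ^ 3) set" and z :: "real ^ 3"
  assumes fin: "finite S" and conv: "convex_position S" and "0 < R" "0 < d"
    and cube: "\<And>p k. p \<in> S \<Longrightarrow> \<bar>p $ k - z $ k\<bar> \<le> R"
    and sep: "\<And>p p'. p \<in> S \<Longrightarrow> p' \<in> S \<Longrightarrow> p \<noteq> p' \<Longrightarrow> d \<le> dist p p'"
  shows "real (card S) \<le> 6 * (8 * R / d + 1)\<^sup>2"
proof -
  have "\<exists>u. u \<noteq> 0 \<and> (\<forall>y\<in>S - {p}. inner u (y - p) < 0)" if "p \<in> S" for p
  proof (cases "S - {p} = {}")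
    case True
    have "axis 1 1 \<noteq> (0 :: real ^ 3)" by (simp add: axis_eq_0_iff)
    then show ?thesis using True by blast
  next
    case False
    have "p \<notin> convex hull (S - {p})" using conv that by (simp add: convex_position_def)
    then obtain a c where "inner a p < c" "\<forall>x\<in>convex hull (S - {p}). c < inner a x"
      using separating_hyperplane_closed_point[of "convex hull (S - {p})" p] fin
      by (auto simp: convex_convex_hull compact_imp_closed finite_imp_compact_convex_hull)
    then have lt: "inner a p < inner a y" if "y \<in> S - {p}" for y
      using hull_inc[OF that, of convex] by force
    from False obtain y where "y \<in> S - {p}" by blast
    from lt[OF this] have "- a \<noteq> 0" by auto
    moreover have "inner (- a) (y - p) < 0" if "y \<in> S - {p}" for y
      using lt[OF that] by (simp add: inner_diff_right)
    ultimately show ?thesis by blast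
  qed
  then have "\<exists>u. \<forall>p\<in>S. u p \<noteq> 0 \<and> (\<forall>y\<in>S - {p}. inner (u p) (y - p) < 0)"
    by (intro bchoice ballI)
  then obtain u where u: "\<And>p. p \<in> S \<Longrightarrow> u p \<noteq> 0"
    "\<And>p y. p \<in> S \<Longrightarrow> y \<in> S \<Longrightarrow> y \<noteq> p \<Longrightarrow> inner (u p) (y - p) < 0"
    by auto
  have "\<exists>t\<ge>0. infnorm (p - z + t *\<^sub>R u p) = 2 * R" if "p \<in> S" for p
  proof -
    let ?f = "\<lambda>t. infnorm (p - z + t *\<^sub>R u p)"
    have base: "infnorm (p - z) \<le> R"
      using cube[OF that] unfolding infnorm_Max by (subst Max_le_iff) (auto simp: Basis_vec_def inner_axis)
    have pos: "0 < infnorm (u p)" using u(1)[OF that] by (simp add: infnorm_pos_lt)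
    \<comment> \<open>A displacement of sup norm 3R, starting within R of the centre, ends at sup
      norm at least 2R, so the intermediate value theorem yields a point on the surface.\<close>
    define T where "T = 3 * R / infnorm (u p)"
    have T: "0 \<le> T" using pos \<open>0 < R\<close> by (simp add: T_def)
    have "infnorm (T *\<^sub>R u p) \<le> ?f T + infnorm (- (p - z))"
      using infnorm_triangle[of "p - z + T *\<^sub>R u p" "- (p - z)"] by simp
    moreover have "infnorm (T *\<^sub>R u p) = 3 * R" using pos T \<open>0 < R\<close> by (simp add: infnorm_mul T_def)
    ultimately have "2 * R \<le> ?f T" using base infnorm_neg[of "p - z"] by linarith
    moreover have "?f 0 \<le> 2 * R" using base \<open>0 < R\<close> by simp
    moreover have "continuous_on {0..T} ?f"
      by (intro continuous_intros)
    ultimately show ?thesis using IVT'[of ?f 0 "2 * R" T] T by auto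
  qed
  then have "\<exists>T. \<forall>p\<in>S. 0 \<le> T p \<and> infnorm (p - z + T p *\<^sub>R u p) = 2 * R"
    by (intro bchoice ballI) blast
  then obtain T where T: "\<And>p. p \<in> S \<Longrightarrow> 0 \<le> T p"
    "\<And>p. p \<in> S \<Longrightarrow> infnorm (p - z + T p *\<^sub>R u p) = 2 * R"
    by auto
  define e where "e p = p - z + T p *\<^sub>R u p" for p
  have expand: "d \<le> norm (e p - e y)" if "p \<in> S" "y \<in> S" "p \<noteq> y" for p y
  proof -
    have "e p - e y = (p - y) + (T p *\<^sub>R u p - T y *\<^sub>R u y)" by (simp add: e_def)
    \<comment> \<open>Each outward normal contributes nonnegatively in the direction
      \<open>p - y\<close>, so the displacements only push points apart; Cauchy-Schwarz then
      compares the norms.\<close>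
    then have "inner (e p - e y) (p - y) =
        (norm (p - y))\<^sup>2 + (T p * inner (u p) (p - y) - T y * inner (u y) (p - y))"
      by (simp only: inner_add_left inner_diff_left inner_scaleR_left dot_square_norm)
    moreover have "0 \<le> T p * inner (u p) (p - y)"
      using u(2)[of p y] T(1)[of p] that by (intro mult_nonneg_nonneg) (auto simp: inner_diff_right)
    moreover have "T y * inner (u y) (p - y) \<le> 0"
      using u(2)[of y p] T(1)[of y] that by (intro mult_nonneg_nonpos) (auto simp: inner_diff_right)
    ultimately have "(norm (p - y))\<^sup>2 \<le> norm (e p - e y) * norm (p - y)"
      using norm_cauchy_schwarz[of "e p - e y" "p - y"] by linarith
    then have "norm (p - y) \<le> norm (e p - e y)" using that by (simp add: power2_eq_square)
    then show ?thesis using sep[OF that] by (simp add: dist_norm)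
  qed
  have e_le: "\<bar>e p $ k\<bar> \<le> 2 * R" if "p \<in> S" for p k
    using component_le_infnorm_cart[of "e p" k] T(2)[OF that] by (simp add: e_def)
  define F where "F k \<sigma> = {p \<in> S. e p $ k = \<sigma>}" for k :: 3 and \<sigma>
  have "S \<subseteq> (\<Union>k. F k (2 * R) \<union> F k (- 2 * R))"
  proof
    fix p assume p: "p \<in> S"
    have "infnorm (e p) \<in> (\<lambda>i. \<bar>inner (e p) i\<bar>) ` Basis"
      unfolding infnorm_Max by (rule Max_in) auto
    then obtain k where "\<bar>e p $ k\<bar> = 2 * R"
      using T(2)[OF p] by (auto simp: e_def[symmetric] Basis_vec_def inner_axis)
    then have "e p $ k = 2 * R \<or> e p $ k = - 2 * R" by linarith
    then have "p \<in> F k (2 * R) \<union> F k (- 2 * R)" using p by (simp add: F_def)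
    then show "p \<in> (\<Union>k. F k (2 * R) \<union> F k (- 2 * R))" by blast
  qed
  also have "\<dots> = F 1 (2 * R) \<union> (F 1 (- 2 * R) \<union> (F 2 (2 * R) \<union> (F 2 (- 2 * R) \<union> (F 3 (2 * R) \<union> F 3 (- 2 * R)))))"
    by (auto simp: UNIV_3)
  finally have "card S \<le> card \<dots>" using fin by (intro card_mono) (auto simp: F_def)
  also have "\<dots> \<le> card (F 1 (2 * R)) + (card (F 1 (- 2 * R)) + (card (F 2 (2 * R)) + (card (F 2 (- 2 * R)) +
      (card (F 3 (2 * R)) + card (F 3 (- 2 * R))))))"
    by (intro order_trans[OF card_Un_le] add_left_mono order_refl)
  finally have card_S: "card S \<le> \<dots>" .
  \<comment> \<open>On a face one coordinate is constant, so distance \<open>d\<close> must show up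
    as a difference of at least d/2 in one of the other two.\<close>
  have face: "real (card (F k \<sigma>)) \<le> (8 * R / d + 1)\<^sup>2" for k \<sigma>
  proof -
    obtain k1 k2 where k12: "\<And>x :: real ^ 3. (norm x)\<^sup>2 = (x $ k)\<^sup>2 + (x $ k1)\<^sup>2 + (x $ k2)\<^sup>2"
    proof -
      have norm_sq: "(norm x)\<^sup>2 = (x $ 1)\<^sup>2 + (x $ 2)\<^sup>2 + (x $ 3)\<^sup>2" for x :: "real ^ 3"
        unfolding power2_norm_eq_inner by (simp add: inner_vec_def sum_3 power2_eq_square)
      consider "k = 1" | "k = 2" | "k = 3" using exhaust_3 by blast
      then show thesis
      proof cases
        case 1
        then show thesis using that[of 2 3] norm_sq by simp
      next
        case 2
        then show thesis using that[of 1 3] norm_sq by simp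
      next
        case 3
        then show thesis using that[of 1 2] norm_sq by simp
      qed
    qed
    have "real (card (F k \<sigma>)) \<le> (2 * (2 * R) / (d / 2) + 1)\<^sup>2"
    proof (rule card_le_grid2[where f = "\<lambda>p. e p $ k1" and g = "\<lambda>p. e p $ k2"])
      fix p y assume py: "p \<in> F k \<sigma>" "y \<in> F k \<sigma>" "p \<noteq> y"
      show "d / 2 \<le> \<bar>e p $ k1 - e y $ k1\<bar> \<or> d / 2 \<le> \<bar>e p $ k2 - e y $ k2\<bar>"
      proof (rule ccontr)
        assume "\<not> ?thesis"
        then have "\<bar>e p $ k1 - e y $ k1\<bar>\<^sup>2 \<le> (d / 2)\<^sup>2" "\<bar>e p $ k2 - e y $ k2\<bar>\<^sup>2 \<le> (d / 2)\<^sup>2"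
          by (intro power_mono; simp)+
        then have "(norm (e p - e y))\<^sup>2 \<le> d\<^sup>2 / 2"
          using py by (simp add: k12 F_def power_divide)
        also have "\<dots> < d\<^sup>2" using \<open>0 < d\<close> by simp
        finally have "norm (e p - e y) < d" using \<open>0 < d\<close> by (simp add: power_less_imp_less_base)
        then show False using expand[of p y] py by (simp add: F_def)
      qed
    qed (use fin e_le \<open>0 < d\<close> \<open>0 < R\<close> in \<open>auto simp: F_def\<close>)
    then show ?thesis by simp
  qed
  have "real (card S) \<le> real (card (F 1 (2 * R))) + (real (card (F 1 (- 2 * R))) + (real (card (F 2 (2 * R))) +
      (real (card (F 2 (- 2 * R))) + (real (card (F 3 (2 * R))) + real (card (F 3 (- 2 * R)))))))"
    using card_S by linarith
  also have "\<dots> \<le> 6 * (8 * R / d + 1)\<^sup>2"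
    using face[of 1 "2 * R"] face[of 1 "- 2 * R"] face[of 2 "2 * R"] face[of 2 "- 2 * R"]
      face[of 3 "2 * R"] face[of 3 "- 2 * R"] by linarith
  finally show ?thesis .
qed

lemma opt_convex_le:
  fixes A :: "(real ^ 3) set" and z :: "real ^ 3"
  assumes fin: "finite A" and "0 < R" "0 < d"
    and cube: "\<And>p k. p \<in> A \<Longrightarrow> \<bar>p $ k - z $ k\<bar> \<le> R"
    and sep: "\<And>p p'. p \<in> A \<Longrightarrow> p' \<in> A \<Longrightarrow> p \<noteq> p' \<Longrightarrow> d \<le> dist p p'"
  shows "real (opt_convex A) \<le> 6 * (8 * R / d + 1)\<^sup>2"
proof -
  let ?C = "{card S | S. S \<subseteq> A \<and> convex_position S}"
  have "finite ?C" using fin by simp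
  moreover have "0 \<in> ?C" by (auto intro!: exI[of _ "{}"] simp: convex_position_def)
  ultimately have "opt_convex A \<in> ?C" unfolding opt_convex_def by (intro Max_in) auto
  then obtain S where "S \<subseteq> A" "convex_position S" "opt_convex A = card S" by auto
  then have "real (card S) \<le> 6 * (8 * R / d + 1)\<^sup>2"
    using finite_subset[OF _ fin] cube sep
    by (intro card_convex_position_le[OF _ _ \<open>0 < R\<close> \<open>0 < d\<close>, of S z]) blast+
  then show ?thesis using \<open>opt_convex A = card S\<close> by simp
qed

section \<open>Repeated random trials\<close>

definition avoids :: "nat set \<Rightarrow> nat \<Rightarrow> (nat \<Rightarrow> nat) set" where
  "avoids G i = {\<omega>. \<forall>j<i. \<omega> j \<notin> G}"

lemma avoids_eq_prod_emb:
  "avoids G i = prod_emb UNIV (\<lambda>i. measure_pmf (pmf_of_set {..<2 ^ w})) {..<i} (Pi\<^sub>E {..<i} (\<lambda>_. - G))"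
  by (auto simp: avoids_def prod_emb_def space_PiM PiE_def Pi_def)

lemma sets_avoids [measurable]: "avoids G i \<in> sets (random_tape w)"
  unfolding avoids_eq_prod_emb[of G i w] random_tape_def
  by (rule sets_PiM_I) auto

text \<open>One draw misses \<open>G\<close> with probability at most 1 - p, and the coordinates of
  the tape are independent.\<close>

lemma emeasure_avoids_le:
  assumes "0 \<le> p" "p \<le> 1" "p * 2 ^ w \<le> real (card {v\<in>{..<2 ^ w}. v \<in> G})"
  shows "emeasure (random_tape w) (avoids G i) \<le> ennreal ((1 - p) ^ i)"
proof -
  interpret product_prob_space "\<lambda>i :: nat. measure_pmf (pmf_of_set {..<(2::nat) ^ w})" UNIV
    by unfold_locales
  have ne: "{..<(2::nat) ^ w} \<noteq> {}" by (auto simp: lessThan_empty_iff)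
  have "measure_pmf.prob (pmf_of_set {..<(2::nat) ^ w}) (- G) =
      real (card ({..<2 ^ w} - {v\<in>{..<2 ^ w}. v \<in> G})) / 2 ^ w"
    by (subst measure_pmf_of_set[OF ne]) (auto intro!: arg_cong[where f = card])
  also have "\<dots> \<le> 1 - p"
  proof -
    have "real (card ({..<2 ^ w} - {v\<in>{..<2 ^ w}. v \<in> G})) = 2 ^ w - real (card {v\<in>{..<2 ^ w}. v \<in> G})"
      using card_mono[of "{..<(2::nat) ^ w}" "{v\<in>{..<2 ^ w}. v \<in> G}"]
      by (subst card_Diff_subset) (auto simp: of_nat_diff subset_eq)
    then show ?thesis using assms by (simp add: field_simps)
  qed
  finally have le: "measure_pmf.prob (pmf_of_set {..<(2::nat) ^ w}) (- G) \<le> 1 - p" .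
  have "emeasure (random_tape w) (avoids G i) = (\<Prod>j<i. emeasure (measure_pmf (pmf_of_set {..<(2::nat) ^ w})) (- G))"
    unfolding random_tape_def avoids_eq_prod_emb[of G i w] by (rule emeasure_PiM_emb) auto
  also have "\<dots> = ennreal (measure_pmf.prob (pmf_of_set {..<(2::nat) ^ w}) (- G) ^ i)"
    by (simp add: measure_pmf.emeasure_eq_measure ennreal_power)
  also have "\<dots> \<le> ennreal ((1 - p) ^ i)"
    using le by (intro ennreal_leI power_mono) auto
  finally show ?thesis .
qed

text \<open>The number of trials is geometrically distributed, and the running time is at most
  \<open>T\<close> times the sum of the indicators of the events that the first \<open>i\<close> trials fail.\<close>
lemma expected_time_repeated_trials:
  fixes a T p :: real
  assumes p: "0 < p" "p \<le> 1" "p * 2 ^ w \<le> real (card {v\<in>{..<2 ^ w}. v \<in> G})"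
    and "0 \<le> a" "0 \<le> T"
    and halts: "\<And>(\<omega> :: nat \<Rightarrow> nat) (i :: nat). \<omega> i \<in> G \<Longrightarrow> (\<And>j. j < i \<Longrightarrow> \<omega> j \<notin> G) \<Longrightarrow>
      \<exists>t s'. exec w \<omega> P s t s' \<and> real t \<le> a + T * real (Suc i) \<and> Q s'"
  shows "expected_time w P s \<le> ennreal (a + T / p)"
    and "AE \<omega> in random_tape w. \<exists>t s'. exec w \<omega> P s t s' \<and> Q s'"
proof -
  interpret prob_space "random_tape w" by (rule prob_space_random_tape)
  have first_hit: "\<exists>i. \<omega> i \<in> G \<and> (\<forall>j<i. \<omega> j \<notin> G)" if "\<omega> j \<in> G" for \<omega> :: "nat \<Rightarrow> nat" and j
    using that exists_least_iff[of "\<lambda>i. \<omega> i \<in> G"] by blast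
  have avoid_null: "(\<Inter>i. avoids G i) \<in> null_sets (random_tape w)"
  proof (rule null_setsI)
    have "emeasure (random_tape w) (\<Inter>i. avoids G i) \<le> ennreal ((1 - p) ^ i)" for i
      using emeasure_mono[of "\<Inter>i. avoids G i" "avoids G i" "random_tape w"]
        emeasure_avoids_le[of p w G i] p by (auto intro: order_trans)
    moreover have "(\<lambda>i. ennreal ((1 - p) ^ i)) \<longlonglongrightarrow> ennreal 0"
      using p by (intro tendsto_ennrealI LIMSEQ_realpow_zero) auto
    ultimately have "emeasure (random_tape w) (\<Inter>i. avoids G i) \<le> ennreal 0"
      by (intro LIMSEQ_le_const) auto
    then show "emeasure (random_tape w) (\<Inter>i. avoids G i) = 0" by simp
  qed auto
  have AE_hit: "AE \<omega> in random_tape w. \<exists>j. \<omega> j \<in> G"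
    by (rule AE_I'[OF avoid_null]) (auto simp: avoids_def)
  then show "AE \<omega> in random_tape w. \<exists>t s'. exec w \<omega> P s t s' \<and> Q s'"
  proof (rule AE_mp, intro AE_I2 impI)
    fix \<omega> :: "nat \<Rightarrow> nat" assume "\<exists>j. \<omega> j \<in> G"
    then obtain i where "\<omega> i \<in> G" "\<And>j. j < i \<Longrightarrow> \<omega> j \<notin> G" using first_hit by blast
    from halts[of \<omega> i, OF this] show "\<exists>t s'. exec w \<omega> P s t s' \<and> Q s'" by blast
  qed
  have "expected_time w P s \<le> (\<integral>\<^sup>+ \<omega>. ennreal a + (\<Sum>i. ennreal T * indicator (avoids G i) \<omega>) \<partial>random_tape w)"
    unfolding expected_time_def
  proof (rule nn_integral_mono_AE, rule AE_mp[OF AE_hit], intro AE_I2 impI)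
    fix \<omega> :: "nat \<Rightarrow> nat" assume "\<exists>j. \<omega> j \<in> G"
    then obtain i where i: "\<omega> i \<in> G" "\<And>j. j < i \<Longrightarrow> \<omega> j \<notin> G" using first_hit by blast
    from halts[of \<omega> i, OF this] obtain t s' where t: "exec w \<omega> P s t s'" "real t \<le> a + T * real (Suc i)"
      by blast
    have "runtime w P s \<omega> = ennreal (real t)" by (rule runtime_eq[OF t(1)])
    also have "\<dots> \<le> ennreal (a + T * real (Suc i))" by (rule ennreal_leI[OF t(2)])
    also have "\<dots> = ennreal a + (\<Sum>j<Suc i. ennreal T * indicator (avoids G j) \<omega>)"
    proof -
      \<comment> \<open>\<open>avoids G 0\<close> is the whole space and \<open>avoids G i\<close>
        only concerns draws before \<open>i\<close>, so all \<open>Suc i\<close> indicators equal 1: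
        one for each trial, including the successful one.\<close>
      have "(\<Sum>j<Suc i. ennreal T * indicator (avoids G j) \<omega>) = (\<Sum>j<Suc i. ennreal T)"
        using i by (intro sum.cong) (auto simp: avoids_def indicator_def)
      also have "\<dots> = ennreal (T * real (Suc i))"
        using \<open>0 \<le> T\<close> by (simp add: ennreal_of_nat_eq_real_of_nat ennreal_mult'' mult.commute del: of_nat_Suc)
      finally show ?thesis using \<open>0 \<le> a\<close> \<open>0 \<le> T\<close> by (simp add: ennreal_plus del: of_nat_Suc)
    qed
    also have "\<dots> \<le> ennreal a + (\<Sum>j. ennreal T * indicator (avoids G j) \<omega>)"
      by (intro add_left_mono sum_le_suminf) auto
    finally show "runtime w P s \<omega> \<le> ennreal a + (\<Sum>j. ennreal T * indicator (avoids G j) \<omega>)" .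
  qed
  also have "\<dots> = ennreal a + (\<Sum>i. ennreal T * emeasure (random_tape w) (avoids G i))"
    using emeasure_space_1
    by (subst nn_integral_add, simp, simp, subst nn_integral_suminf, simp, subst nn_integral_cmult_indicator) simp_all
  also have "\<dots> \<le> ennreal a + (\<Sum>i. ennreal (T * (1 - p) ^ i))"
    using p \<open>0 \<le> T\<close> emeasure_avoids_le[of p w G]
    by (intro add_left_mono suminf_le) (auto simp: ennreal_mult intro!: mult_left_mono)
  also have "(\<Sum>i. ennreal (T * (1 - p) ^ i)) = ennreal (T / p)"
  proof (rule suminf_ennreal_eq)
    show "(\<lambda>i. T * (1 - p) ^ i) sums (T / p)"
      using sums_mult[OF geometric_sums[of "1 - p"], of T] p by simp
  qed (use p \<open>0 \<le> T\<close> in auto)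
  also have "ennreal a + ennreal (T / p) = ennreal (a + T / p)"
    using p \<open>0 \<le> a\<close> \<open>0 \<le> T\<close> by (simp add: ennreal_plus)
  finally show "expected_time w P s \<le> ennreal (a + T / p)" by simp
qed

section \<open>The program\<close>

text \<open>A total-correctness judgement with an upper bound on the time; bounds instead of exact
  times let branches of different cost be merged.\<close>

definition runs :: "nat \<Rightarrow> (nat \<Rightarrow> nat) \<Rightarrow> com \<Rightarrow> machine \<Rightarrow> nat \<Rightarrow> (machine \<Rightarrow> bool) \<Rightarrow> bool" where
  "runs w \<omega> P s T Q \<longleftrightarrow> (\<exists>t s'. exec w \<omega> P s t s' \<and> t \<le> T \<and> Q s')"

lemma runs_weaken:
  assumes "runs w \<omega> P s T Q" "T \<le> T'" "\<And>s'. Q s' \<Longrightarrow> Q' s'"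
  shows "runs w \<omega> P s T' Q'"
  using assms unfolding runs_def by (meson order_trans)

lemma runs_Skip: "Q s \<Longrightarrow> runs w \<omega> Skip s 1 Q"
  unfolding runs_def using exec_Skip by blast

lemma runs_Seq:
  assumes "runs w \<omega> P s T (\<lambda>s'. runs w \<omega> P' s' T' Q)"
  shows "runs w \<omega> (Seq P P') s (T + T') Q"
  using assms unfolding runs_def by (meson add_mono exec_Seq)

lemma runs_Cond:
  assumes "bval w s b \<Longrightarrow> runs w \<omega> P s T Q" "\<not> bval w s b \<Longrightarrow> runs w \<omega> P' s T Q"
  shows "runs w \<omega> (Cond b P P') s (Suc T) Q"
  using assms unfolding runs_def by (meson Suc_le_mono exec_CondTrue exec_CondFalse)

text \<open>The potential serves as termination measure and time bound at once: an iteration pays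
  for its guard and body, and the remaining unit pays for the final failing guard.\<close>

lemma runs_While:
  fixes pot :: "machine \<Rightarrow> nat"
  assumes "Inv s"
    and step: "\<And>s. Inv s \<Longrightarrow> bval w s b \<Longrightarrow>
      \<exists>T. runs w \<omega> P s T (\<lambda>s'. Inv s' \<and> Suc T + pot s' \<le> pot s)"
    and pos: "\<And>s. Inv s \<Longrightarrow> 1 \<le> pot s"
  shows "runs w \<omega> (While b P) s (pot s) (\<lambda>s'. Inv s' \<and> \<not> bval w s' b)"
  using assms(1)
proof (induction "pot s" arbitrary: s rule: less_induct)
  case less
  show ?case
  proof (cases "bval w s b")
    case True
    from step[OF less.prems this] obtain T t s' where
      s': "exec w \<omega> P s t s'" "t \<le> T" "Inv s'" "Suc T + pot s' \<le> pot s"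
      unfolding runs_def by blast
    then have "runs w \<omega> (While b P) s' (pot s') (\<lambda>s'. Inv s' \<and> \<not> bval w s' b)"
      by (intro less.hyps) auto
    then obtain u s'' where s'': "exec w \<omega> (While b P) s' u s''" "u \<le> pot s'" "Inv s''" "\<not> bval w s'' b"
      unfolding runs_def by blast
    have "exec w \<omega> (While b P) s (Suc (t + u)) s''" by (rule exec_WhileTrue[OF True s'(1) s''(1)])
    moreover have "Suc (t + u) \<le> pot s" using s' s'' by linarith
    ultimately show ?thesis unfolding runs_def using s'' by blast
  next
    case False
    then show ?thesis unfolding runs_def using exec_WhileFalse[OF False] pos[OF less.prems] less.prems by blast
  qed
qed

text \<open>Word \<open>0\<close> keeps the number \<open>n\<close> of points until the very end, words \<open>1..n\<close> hold the output
  list, and the word variable \<open>j\<close> is stored at \<open>n + 1 + j\<close>.  The only real variable, the scale,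
  sits right behind the input.\<close>
definition ram :: "nat \<Rightarrow> (nat \<Rightarrow> real) \<Rightarrow> real \<Rightarrow> (nat \<Rightarrow> nat) \<Rightarrow> (nat \<Rightarrow> nat) \<Rightarrow> nat \<Rightarrow> machine" where
  "ram n I r out V d = \<lparr>words = (\<lambda>a. if a = 0 then n else if a \<le> n then out a else V (a - Suc n)),
     reals = (\<lambda>a. if a = 3 * n then r else I a), draws = d\<rparr>"

section \<open>Expressions and commands of the sampling program\<close>

definition "num = WMem (WConst 0)"
definition "addr j = WAdd num (WConst (Suc j))"
definition "var j = WMem (addr j)"
definition "assign j e = WStore (addr j) e"
definition "scale_addr = WMul (WConst 3) num"

abbreviation "base_var \<equiv> var 0"
abbreviation "root_var \<equiv> var 1"
abbreviation "i_var \<equiv> var 2"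
abbreviation "j_var \<equiv> var 3"
abbreviation "count_var \<equiv> var 4"
abbreviation "visited_var \<equiv> var 5"
abbreviation "draw_var \<equiv> var 6"

definition "crd e c = RDiv (RSub (RMem (WAdd (WMul (WConst 3) e) (WConst c))) (RMem (WConst c))) (RMem scale_addr)"
text \<open>The remainder of \<open>e\<close> modulo the base, divided by the base; the machine has
  no remainder operation, so it is formed from a quotient.\<close>

definition "digit_exp e = RDiv (RSub (ROfWord e) (RMul (ROfWord base_var) (ROfWord (WDiv e base_var)))) (ROfWord base_var)"
definition "sq e = RMul e e"
definition "height_exp e = RAdd (RAdd (RSub (crd e 2) (RAdd (sq (crd e 0)) (sq (crd e 1))))
  (RMul (digit_exp draw_var) (crd e 0))) (RMul (digit_exp (WDiv draw_var base_var)) (crd e 1))"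
definition "offset_exp = RSub (RMul (RConst 12) (RDiv (ROfWord (WDiv (WDiv draw_var base_var) base_var)) (ROfWord base_var))) (RConst 6)"
definition "width_exp N = RDiv (RConst 1) (RMul (RConst (of_nat N)) (ROfWord root_var))"
definition "slab_test N e = BAnd (BNot (RLess (height_exp e) offset_exp)) (RLess (height_exp e) (RAdd offset_exp (width_exp N)))"
definition "far_test N e e' = RLess (width_exp N) (RAdd (sq (RSub (crd e 0) (crd e' 0))) (sq (RSub (crd e 1) (crd e' 1))))"

definition "search N = While (BAnd (BNot (WLess count_var j_var)) (far_test N i_var (WMem j_var)))
  (assign 3 (WAdd j_var (WConst 1)))"
definition "process N = Seq (assign 5 (WAdd visited_var (WConst 1))) (Seq (assign 3 (WConst 1)) (Seq (search N)
  (Cond (WLess count_var j_var) (Seq (assign 4 (WAdd count_var (WConst 1))) (WStore count_var i_var)) Skip)))"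
text \<open>The cap on visited slab points keeps the quadratic search cost linear in the number of
  input points.\<close>

definition "scan N = While (BAnd (WLess i_var num) (WLess visited_var (WMul (WConst (800 * N)) root_var)))
  (Seq (Cond (slab_test N i_var) (process N) Skip) (assign 2 (WAdd i_var (WConst 1))))"
definition "trial N = Seq (RandWord (addr 6)) (Seq (assign 2 (WConst 0)) (Seq (assign 4 (WConst 0))
  (Seq (assign 5 (WConst 0)) (scan N))))"
definition "main_loop N = While (WLess (WMul (WConst (384 * N)) count_var) root_var) (trial N)"

text \<open>The exponent is fixed with the program, so the power is a single expression and its
  assignment takes one step.\<close>

primrec pow_exp :: "wexp \<Rightarrow> nat \<Rightarrow> wexp" where
  "pow_exp e 0 = WConst 1"
| "pow_exp e (Suc k) = WMul e (pow_exp e k)"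

definition "base_loop = While (BNot (WLess num base_var)) (assign 0 (WMul (WConst 2) base_var))"
definition "root_loop = While (WLess (WMul root_var root_var) num) (assign 1 (WAdd root_var (WConst 1)))"
definition "diff_exp = RSub (RMem i_var) (RMem (WSub i_var (WMul (WConst 3) (WDiv i_var (WConst 3)))))"
definition "scale_loop = While (WLess i_var (WMul (WConst 3) num))
  (Seq (Cond (RLess (RMem scale_addr) diff_exp) (RStore scale_addr diff_exp) Skip)
  (Seq (Cond (RLess (RMem scale_addr) (RSub (RConst 0) diff_exp)) (RStore scale_addr (RSub (RConst 0) diff_exp)) Skip)
    (assign 2 (WAdd i_var (WConst 1)))))"

definition "preprocess k = Seq (assign 0 (WConst 1)) (Seq base_loop
  (Seq (assign 0 (pow_exp base_var k)) (Seq root_loop scale_loop)))"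

definition "program N k = Seq (preprocess k) (Seq (main_loop N) (WStore (WConst 0) count_var))"

definition input_reals :: "(real ^ 3) list \<Rightarrow> nat \<Rightarrow> real" where
  "input_reals xs a = (if a < 3 * length xs then coord (xs ! (a div 3)) (a mod 3) else 0)"

lemma ram_input_eq: "ram_input xs = ram (length xs) (input_reals xs) 0 (\<lambda>_. 0) (\<lambda>_. 0) 0"
  by (auto simp: ram_input_def ram_def input_reals_def fun_eq_iff)

text \<open>The size bound rules out wraparound in address arithmetic and in the squares compared by
  \<open>root_loop\<close>, which stay below 4n.\<close>

locale small_input =
  fixes w n :: nat and xs :: "(real ^ 3) list"
  assumes len: "length xs = n" and n_pos: "0 < n" and fits: "8 * n + 20 < 2 ^ w"
begin

lemma fits': "2 ^ w > (20 :: nat)" "n < 2 ^ w" "3 * n < 2 ^ w"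
  using fits by linarith+

lemma wval_const [simp]: "c \<le> 20 \<Longrightarrow> wval w s (WConst c) = c"
  using fits' by simp

lemma wval_num [simp]: "wval w (ram n I r out V d) num = n"
  by (simp add: num_def ram_def)

lemma wval_addr [simp]: "j < 8 \<Longrightarrow> wval w (ram n I r out V d) (addr j) = n + Suc j"
  using fits by (simp add: addr_def del: wval.simps(1))

lemma wval_var [simp]: "j < 8 \<Longrightarrow> wval w (ram n I r out V d) (var j) = V j"
  unfolding var_def by (simp, simp add: ram_def)

lemma wval_scale_addr [simp]: "wval w (ram n I r out V d) scale_addr = 3 * n"
  using fits by (simp add: scale_addr_def del: wval.simps(1))

lemma rval_scale [simp]: "rval w (ram n I r out V d) (RMem scale_addr) = r"
  by (simp, simp add: ram_def)

section \<open>Effect of basic commands on states of the form \<open>ram\<close>, and values of the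
  program's expressions\<close>

lemma runs_assign:
  assumes "j < 8" "Q (ram n I r out (V(j := wval w (ram n I r out V d) e)) d)"
  shows "runs w \<omega> (assign j e) (ram n I r out V d) 1 Q"
proof -
  let ?s = "ram n I r out V d"
  have "exec w \<omega> (assign j e) ?s 1 (?s\<lparr>words := (words ?s)(wval w ?s (addr j) := wval w ?s e)\<rparr>)"
    unfolding assign_def by (rule exec_WStore)
  also have "?s\<lparr>words := (words ?s)(wval w ?s (addr j) := wval w ?s e)\<rparr> =
      ram n I r out (V(j := wval w ?s e)) d"
    unfolding wval_addr[OF assms(1)] by (auto simp: ram_def fun_eq_iff)
  finally show ?thesis unfolding runs_def using assms(2) by blast
qed

lemma runs_assign_Seq:
  assumes "j < 8" "wval w (ram n I r out V d) e = x" "runs w \<omega> P (ram n I r out (V(j := x)) d) T Q"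
  shows "runs w \<omega> (Seq (assign j e) P) (ram n I r out V d) (Suc T) Q"
  using assms runs_Seq[OF runs_assign[of j "\<lambda>s'. runs w \<omega> P s' T Q"]] by simp

lemma runs_output:
  assumes "0 < wval w (ram n I r out V d) e" "wval w (ram n I r out V d) e \<le> n"
    and "Q (ram n I r (out(wval w (ram n I r out V d) e := wval w (ram n I r out V d) e')) V d)"
  shows "runs w \<omega> (WStore e e') (ram n I r out V d) 1 Q"
proof -
  let ?s = "ram n I r out V d"
  have "exec w \<omega> (WStore e e') ?s 1 (?s\<lparr>words := (words ?s)(wval w ?s e := wval w ?s e')\<rparr>)"
    by (rule exec_WStore)
  also have "?s\<lparr>words := (words ?s)(wval w ?s e := wval w ?s e')\<rparr> =
      ram n I r (out(wval w ?s e := wval w ?s e')) V d"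
    using assms(1,2) by (auto simp: ram_def fun_eq_iff)
  finally show ?thesis unfolding runs_def using assms(3) by blast
qed

lemma runs_draw:
  assumes "Q (ram n I r out (V(6 := \<omega> d)) (Suc d))"
  shows "runs w \<omega> (RandWord (addr 6)) (ram n I r out V d) 1 Q"
proof -
  let ?s = "ram n I r out V d"
  have "exec w \<omega> (RandWord (addr 6)) ?s 1
      (?s\<lparr>words := (words ?s)(wval w ?s (addr 6) := \<omega> (draws ?s)), draws := Suc (draws ?s)\<rparr>)"
    by (rule exec_RandWord)
  also have "?s\<lparr>words := (words ?s)(wval w ?s (addr 6) := \<omega> (draws ?s)), draws := Suc (draws ?s)\<rparr> =
      ram n I r out (V(6 := \<omega> d)) (Suc d)"
    by (subst wval_addr) (auto simp: ram_def fun_eq_iff)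
  finally show ?thesis unfolding runs_def using assms by blast
qed

lemma runs_store_scale:
  assumes "Q (ram n I (rval w (ram n I r out V d) e) out V d)"
  shows "runs w \<omega> (RStore scale_addr e) (ram n I r out V d) 1 Q"
proof -
  let ?s = "ram n I r out V d"
  have "exec w \<omega> (RStore scale_addr e) ?s 1 (?s\<lparr>reals := (reals ?s)(wval w ?s scale_addr := rval w ?s e)\<rparr>)"
    by (rule exec_RStore)
  also have "?s\<lparr>reals := (reals ?s)(wval w ?s scale_addr := rval w ?s e)\<rparr> = ram n I (rval w ?s e) out V d"
    unfolding wval_scale_addr by (auto simp: ram_def fun_eq_iff)
  finally show ?thesis unfolding runs_def using assms by blast
qed

abbreviation "st \<equiv> ram n (input_reals xs)"

lemma rval_input:
  assumes "wval w (st r out V d) e = a" "a < 3 * n"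
  shows "rval w (st r out V d) (RMem e) = coord (xs ! (a div 3)) (a mod 3)"
  unfolding rval.simps assms(1) using assms(2) by (simp add: ram_def input_reals_def len)

lemma rval_crd:
  assumes "wval w (st r out V d) e = i" "i < n" "c < 3"
  shows "rval w (st r out V d) (crd e c) = scaled_coord xs r i c"
proof -
  let ?s = "st r out V d"
  have "wval w ?s (WAdd (WMul (WConst 3) e) (WConst c)) = 3 * i + c"
    using assms fits by (simp del: wval.simps(1))
  then have "rval w ?s (RMem (WAdd (WMul (WConst 3) e) (WConst c))) = coord (xs ! ((3 * i + c) div 3)) ((3 * i + c) mod 3)"
    using assms by (intro rval_input) auto
  moreover have "rval w ?s (RMem (WConst c)) = coord (xs ! (c div 3)) (c mod 3)"
    using assms n_pos by (intro rval_input wval_const) auto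
  ultimately show ?thesis
    using assms unfolding crd_def rval.simps(5,7) rval_scale by (simp add: scaled_coord_def)
qed

lemma rval_digit_exp:
  assumes "V 0 = b"
  shows "rval w (st r out V d) (digit_exp e) = real (wval w (st r out V d) e mod b) / real b"
proof -
  have "real (v mod b) = real v - real b * real (v div b)" for v
    by (simp add: minus_mult_div_eq_mod [symmetric] of_nat_diff)
  then show ?thesis using assms by (simp add: digit_exp_def)
qed

lemma rval_height_exp:
  assumes "V 0 = b" "V 6 = v" "wval w (st r out V d) e = i" "i < n"
  shows "rval w (st r out V d) (height_exp e) =
    tilted_height (scaled_coord xs r) (real (v mod b) / real b) (real (v div b mod b) / real b) i"
  unfolding height_exp_def sq_def rval.simps(4-6)
  using assms by (simp add: rval_crd rval_digit_exp tilted_height_def power2_eq_square)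

lemma rval_width_exp: "V 1 = K \<Longrightarrow> rval w (st r out V d) (width_exp N) = 1 / (real N * real K)"
  by (simp add: width_exp_def)

lemma rval_offset_exp:
  "V 0 = b \<Longrightarrow> V 6 = v \<Longrightarrow> rval w (st r out V d) offset_exp = 12 * (real (v div b div b) / real b) - 6"
  by (simp add: offset_exp_def)

lemma bval_slab_test:
  assumes "V 0 = b" "V 1 = K" "V 6 = v" "wval w (st r out V d) e = i" "i < n"
  shows "bval w (st r out V d) (slab_test N e) \<longleftrightarrow> in_slab b (1 / (real N * real K)) (scaled_coord xs r) v i"
  using rval_height_exp[OF assms(1,3-5)] rval_offset_exp[of V b v, OF assms(1,3)] rval_width_exp[of V K, OF assms(2)]
  by (auto simp: slab_test_def in_slab_def offsets_def not_less simp del: rval.simps(1-3))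

lemma bval_far_test:
  assumes "V 1 = K" "wval w (st r out V d) e = i" "i < n" "wval w (st r out V d) e' = j" "j < n"
  shows "bval w (st r out V d) (far_test N e e') \<longleftrightarrow> \<not> near (1 / (real N * real K)) (scaled_coord xs r) i j"
  unfolding far_test_def bval.simps sq_def rval.simps(4-6) rval_width_exp[of V K, OF assms(1)]
  using assms by (simp add: rval_crd near_def power2_eq_square not_le)

lemma wval_output:
  assumes "wval w (st r out V d) e = a" "0 < a" "a \<le> n"
  shows "wval w (st r out V d) (WMem e) = out a"
  unfolding wval.simps assms(1) using assms(2,3) by (simp add: ram_def)

end

section \<open>Correctness of a trial and of the main loop\<close>

text \<open>\<open>limits\<close> keeps the products in the guards of \<open>scan\<close> and
  \<open>main_loop\<close> exact, the number of kept points being at most n.\<close>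

locale sampler = small_input +
  fixes N b K :: nat and r :: real
  assumes N_pos: "0 < N" and K_pos: "0 < K"
    and limits: "800 * N * K < 2 ^ w" "384 * N * n < 2 ^ w"
begin

definition slab :: "nat \<Rightarrow> nat \<Rightarrow> bool" where
  "slab v i \<longleftrightarrow> in_slab b (1 / (real N * real K)) (scaled_coord xs r) v i"

definition close :: "nat \<Rightarrow> nat \<Rightarrow> bool" where
  "close i j \<longleftrightarrow> near (1 / (real N * real K)) (scaled_coord xs r) i j"

text \<open>Scan invariant: \<open>m\<close> points have been read, \<open>x\<close> of them lie in the slab, \<open>c\<close> have been kept.\<close>
definition greedy :: "nat \<Rightarrow> nat \<Rightarrow> (nat \<Rightarrow> nat) \<Rightarrow> nat \<Rightarrow> nat \<Rightarrow> bool" where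
  "greedy v m out c x \<longleftrightarrow> x = card {i. i < m \<and> slab v i} \<and> c \<le> x \<and>
     (\<forall>a\<in>{1..c}. out a < m \<and> slab v (out a)) \<and>
     (\<forall>a\<in>{1..c}. \<forall>a'\<in>{1..c}. a \<noteq> a' \<longrightarrow> \<not> close (out a) (out a')) \<and>
     (\<forall>i<m. slab v i \<longrightarrow> i \<notin> out ` {1..c} \<longrightarrow> (\<exists>j<i. slab v j \<and> close i j))"

lemma greedy_0: "greedy v 0 out 0 0"
  by (simp add: greedy_def)

lemma greedy_le: "greedy v m out c x \<Longrightarrow> c \<le> x \<and> x \<le> m"
  using card_mono[of "{..<m}" "{i. i < m \<and> slab v i}"] by (auto simp: greedy_def)

lemma card_slab_Suc:
  "card {i. i < Suc m \<and> slab v i} = (if slab v m then Suc (card {i. i < m \<and> slab v i}) else card {i. i < m \<and> slab v i})"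
proof (cases "slab v m")
  case True
  then have "{i. i < Suc m \<and> slab v i} = insert m {i. i < m \<and> slab v i}" by (auto simp: less_Suc_eq)
  then show ?thesis using True by simp
next
  case False
  then have "{i. i < Suc m \<and> slab v i} = {i. i < m \<and> slab v i}" by (auto simp: less_Suc_eq)
  then show ?thesis using False by simp
qed

lemma greedy_skip: "greedy v m out c x \<Longrightarrow> \<not> slab v m \<Longrightarrow> greedy v (Suc m) out c x"
  unfolding greedy_def card_slab_Suc by (auto simp: less_Suc_eq)

lemma close_sym: "close i j \<longleftrightarrow> close j i"
  by (simp add: close_def near_def power2_commute)

lemma greedy_append:
  assumes "greedy v m out c x" "slab v m" "\<And>a. a \<in> {1..c} \<Longrightarrow> \<not> close m (out a)"
  shows "greedy v (Suc m) (out(Suc c := m)) (Suc c) (Suc x)"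
proof -
  have eq: "{1..Suc c} = insert (Suc c) {1..c}" by auto
  have img: "(out(Suc c := m)) ` {1..Suc c} = insert m (out ` {1..c})"
    unfolding eq by (auto simp: image_iff)
  have far: "\<not> close (out a) m" if "a \<in> {1..c}" for a using assms(3)[OF that] close_sym by blast
  show ?thesis
    unfolding greedy_def img
  proof (intro conjI)
    show "Suc x = card {i. i < Suc m \<and> slab v i}" "Suc c \<le> Suc x"
      using assms unfolding card_slab_Suc by (auto simp: greedy_def)
    show "\<forall>a\<in>{1..Suc c}. (out(Suc c := m)) a < Suc m \<and> slab v ((out(Suc c := m)) a)"
      using assms unfolding eq by (auto simp: greedy_def less_Suc_eq)
    show "\<forall>a\<in>{1..Suc c}. \<forall>a'\<in>{1..Suc c}. a \<noteq> a' \<longrightarrow> \<not> close ((out(Suc c := m)) a) ((out(Suc c := m)) a')"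
      using assms far unfolding eq by (auto simp: greedy_def)
    show "\<forall>i<Suc m. slab v i \<longrightarrow> i \<notin> insert m (out ` {1..c}) \<longrightarrow> (\<exists>j<i. slab v j \<and> close i j)"
      using assms by (auto simp: greedy_def less_Suc_eq)
  qed
qed

lemma greedy_reject:
  assumes "greedy v m out c x" "slab v m" "a \<in> {1..c}" "close m (out a)"
  shows "greedy v (Suc m) out c (Suc x)"
  using assms unfolding greedy_def card_slab_Suc by (auto simp: less_Suc_eq)

lemma runs_search:
  assumes "V 1 = K" "V 2 = i" "i < n" "V 3 = 1" "V 4 = c" "c \<le> n" "\<And>a. a \<in> {1..c} \<Longrightarrow> out a < n"
  shows "runs w \<omega> (search N) (st r out V d) (2 * c + 3)
    (\<lambda>s. \<exists>j. s = st r out (V(3 := j)) d \<and> 1 \<le> j \<and> j \<le> Suc c \<and> (\<forall>a\<in>{1..<j}. \<not> close i (out a)) \<and>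
      (j \<le> c \<longrightarrow> close i (out j)))"
proof -
  define Inv where "Inv s \<longleftrightarrow> (\<exists>j. s = st r out (V(3 := j)) d \<and> 1 \<le> j \<and> j \<le> Suc c \<and> (\<forall>a\<in>{1..<j}. \<not> close i (out a)))" for s
  \<comment> \<open>Two steps per comparison: the guard and the increment of the position.\<close>
  define pot where "pot s = 2 * (Suc c - wval w s j_var) + 1" for s
  have test: "bval w (st r out (V(3 := j)) d) (BAnd (BNot (WLess count_var j_var)) (far_test N i_var (WMem j_var)))
      \<longleftrightarrow> j \<le> c \<and> \<not> close i (out j)" if "1 \<le> j" "j \<le> Suc c" for j
  proof (cases "j \<le> c")
    case True
    have "wval w (st r out (V(3 := j)) d) (WMem j_var) = out j"
      using that True assms by (intro wval_output) auto
    then have "bval w (st r out (V(3 := j)) d) (far_test N i_var (WMem j_var)) \<longleftrightarrow> \<not> close i (out j)"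
      using assms that True unfolding close_def by (intro bval_far_test) auto
    then show ?thesis using True assms by simp
  qed (use assms in simp)
  have "runs w \<omega> (search N) (st r out V d) (pot (st r out V d)) (\<lambda>s. Inv s \<and>
      \<not> bval w s (BAnd (BNot (WLess count_var j_var)) (far_test N i_var (WMem j_var))))"
    unfolding search_def
  proof (rule runs_While)
    have "V(3 := 1) = V" using assms(4) by auto
    then show "Inv (st r out V d)" unfolding Inv_def by (intro exI[of _ 1]) auto
  next
    fix s assume "Inv s" and b: "bval w s (BAnd (BNot (WLess count_var j_var)) (far_test N i_var (WMem j_var)))"
    then obtain j where j: "s = st r out (V(3 := j)) d" "1 \<le> j" "j \<le> Suc c"
      "\<forall>a\<in>{1..<j}. \<not> close i (out a)" unfolding Inv_def by blast
    have far: "j \<le> c" "\<not> close i (out j)" using b test[OF j(2,3)] j(1) by auto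
    have "wval w (st r out (V(3 := j)) d) (WAdd j_var (WConst 1)) = Suc j"
      using far assms fits by (simp del: wval.simps(1))
    moreover have "Inv (st r out (V(3 := Suc j)) d)"
      unfolding Inv_def using far j by (intro exI[of _ "Suc j"]) (auto simp: less_Suc_eq)
    moreover have "Suc 1 + pot (st r out (V(3 := Suc j)) d) \<le> pot s"
      using far unfolding pot_def j(1) by simp
    ultimately have "runs w \<omega> (assign 3 (WAdd j_var (WConst 1))) s 1 (\<lambda>s'. Inv s' \<and> Suc 1 + pot s' \<le> pot s)"
      unfolding j(1) by (intro runs_assign) auto
    then show "\<exists>T. runs w \<omega> (assign 3 (WAdd j_var (WConst 1))) s T (\<lambda>s'. Inv s' \<and> Suc T + pot s' \<le> pot s)" ..
  qed (simp add: pot_def)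
  then show ?thesis
  proof (rule runs_weaken)
    show "pot (st r out V d) \<le> 2 * c + 3" using assms by (simp add: pot_def)
  next
    fix s assume s: "Inv s \<and> \<not> bval w s (BAnd (BNot (WLess count_var j_var)) (far_test N i_var (WMem j_var)))"
    then obtain j where j: "s = st r out (V(3 := j)) d" "1 \<le> j" "j \<le> Suc c"
      "\<forall>a\<in>{1..<j}. \<not> close i (out a)" unfolding Inv_def by blast
    then have "j \<le> c \<longrightarrow> close i (out j)" using s test[OF j(2,3)] by blast
    then show "\<exists>j. s = st r out (V(3 := j)) d \<and> 1 \<le> j \<and> j \<le> Suc c \<and> (\<forall>a\<in>{1..<j}. \<not> close i (out a)) \<and>
      (j \<le> c \<longrightarrow> close i (out j))" using j by blast
  qed
qed

lemma runs_process:
  assumes V: "V 1 = K" "V 2 = i" "V 4 = c" "V 5 = x" and i: "i < n"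
    and greedy: "greedy v i out c x" and "slab v i"
  shows "runs w \<omega> (process N) (st r out V d) (2 * c + 8)
    (\<lambda>s. \<exists>V' out'. s = st r out' V' d \<and> (\<forall>k\<in>{0,1,2,6}. V' k = V k) \<and> V' 5 = Suc x \<and>
      greedy v (Suc i) out' (V' 4) (Suc x))"
    (is "runs _ _ _ _ _ ?Q")
proof -
  have bnd: "c \<le> x" "x \<le> i" using greedy_le[OF greedy] by auto
  have out_lt: "out a < n" if "a \<in> {1..c}" for a using greedy i that unfolding greedy_def by (meson order_less_trans)
  define V1 where "V1 = V(5 := Suc x, 3 := 1)"
  have inner: "runs w \<omega> (Cond (WLess count_var j_var) (Seq (assign 4 (WAdd count_var (WConst 1))) (WStore count_var i_var)) Skip)
      (st r out (V1(3 := j)) d) 3 ?Q"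
    if j: "1 \<le> j" "j \<le> Suc c" "\<forall>a\<in>{1..<j}. \<not> close i (out a)" "j \<le> c \<longrightarrow> close i (out j)" for j
  proof -
    let ?s = "st r out (V1(3 := j)) d"
    have "runs w \<omega> (Cond (WLess count_var j_var) (Seq (assign 4 (WAdd count_var (WConst 1))) (WStore count_var i_var)) Skip)
      ?s (Suc 2) ?Q"
    proof (rule runs_Cond)
      assume "bval w ?s (WLess count_var j_var)"
      then have "j = Suc c" using j V by (simp add: V1_def)
      then have far: "\<And>a. a \<in> {1..c} \<Longrightarrow> \<not> close i (out a)" using j by auto
      have c1: "wval w ?s (WAdd count_var (WConst 1)) = Suc c"
        using bnd i V fits by (simp add: V1_def del: wval.simps(1))
      have "runs w \<omega> (WStore count_var i_var) (st r out (V1(3 := j, 4 := Suc c)) d) 1 ?Q"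
      proof (rule runs_output)
        have "?Q (st r (out(Suc c := i)) (V1(3 := j, 4 := Suc c)) d)"
          using greedy_append[OF greedy \<open>slab v i\<close> far]
          by (intro exI[of _ "V1(3 := j, 4 := Suc c)"] exI[of _ "out(Suc c := i)"]) (simp add: V1_def V)
        then show "?Q (st r (out(wval w (st r out (V1(3 := j, 4 := Suc c)) d) count_var :=
            wval w (st r out (V1(3 := j, 4 := Suc c)) d) i_var)) (V1(3 := j, 4 := Suc c)) d)"
          by (simp add: V1_def V)
      qed (use bnd i in \<open>simp_all\<close>)
      then have "runs w \<omega> (Seq (assign 4 (WAdd count_var (WConst 1))) (WStore count_var i_var)) ?s (1 + 1) ?Q"
        using c1 by (intro runs_Seq runs_assign) auto
      then show "runs w \<omega> (Seq (assign 4 (WAdd count_var (WConst 1))) (WStore count_var i_var)) ?s 2 ?Q"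
        by (rule runs_weaken) simp_all
    next
      assume "\<not> bval w ?s (WLess count_var j_var)"
      then have "j \<le> c" using j V by (simp add: V1_def)
      then have "greedy v (Suc i) out c (Suc x)"
        using j by (intro greedy_reject[OF greedy \<open>slab v i\<close>]) auto
      then have "?Q ?s" by (intro exI[of _ "V1(3 := j)"] exI[of _ out]) (simp add: V1_def V)
      from runs_Skip[of ?Q, OF this] show "runs w \<omega> Skip ?s 2 ?Q" by (rule runs_weaken) simp_all
    qed
    then show ?thesis by (rule runs_weaken) simp_all
  qed
  have "runs w \<omega> (search N) (st r out V1 d) (2 * c + 3) (\<lambda>s. \<exists>j. s = st r out (V1(3 := j)) d \<and> 1 \<le> j \<and>
      j \<le> Suc c \<and> (\<forall>a\<in>{1..<j}. \<not> close i (out a)) \<and> (j \<le> c \<longrightarrow> close i (out j)))"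
    using V i bnd out_lt by (intro runs_search) (auto simp: V1_def)
  then have "runs w \<omega> (Seq (search N) (Cond (WLess count_var j_var) (Seq (assign 4 (WAdd count_var (WConst 1)))
      (WStore count_var i_var)) Skip)) (st r out V1 d) (2 * c + 3 + 3) ?Q"
    by (intro runs_Seq, elim runs_weaken[OF _ order_refl]) (elim exE conjE, simp only:, rule inner)
  then have "runs w \<omega> (Seq (assign 3 (WConst 1)) (Seq (search N) (Cond (WLess count_var j_var)
      (Seq (assign 4 (WAdd count_var (WConst 1))) (WStore count_var i_var)) Skip)))
      (st r out (V(5 := Suc x)) d) (Suc (2 * c + 3 + 3)) ?Q"
    unfolding V1_def by (intro runs_assign_Seq[OF _ wval_const]) simp_all
  note rest = this
  have incr: "wval w (st r out V d) (WAdd visited_var (WConst 1)) = Suc x"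
    using bnd i V fits by (simp del: wval.simps(1))
  have "runs w \<omega> (process N) (st r out V d) (Suc (Suc (2 * c + 3 + 3))) ?Q"
    unfolding process_def by (rule runs_assign_Seq[OF _ incr rest]) simp
  then show ?thesis by (rule runs_weaken) simp_all
qed

definition "limit = 800 * N * K"

lemma runs_scan:
  assumes V: "V 0 = b" "V 1 = K" "V 2 = 0" "V 4 = 0" "V 5 = 0" "V 6 = v"
  shows "runs w \<omega> (scan N) (st r out V d) (4 * n + (2 * limit + 10) * limit + 1)
    (\<lambda>s. \<exists>V' out' m x. s = st r out' V' d \<and> V' 0 = b \<and> V' 1 = K \<and> m \<le> n \<and>
      greedy v m out' (V' 4) x \<and> (m = n \<or> limit \<le> x))"
proof -
  define Inv where "Inv s \<longleftrightarrow> (\<exists>V' out'. s = st r out' V' d \<and> V' 0 = b \<and> V' 1 = K \<and> V' 6 = v \<and>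
    V' 2 \<le> n \<and> V' 5 \<le> limit \<and> greedy v (V' 2) out' (V' 4) (V' 5))" for s
  \<comment> \<open>Four steps pay for passing any point; a visited slab point may in addition spend
    2 * limit + 10, enough for comparing it with the kept points, of which there are at most
    \<open>limit\<close>.\<close>
  define pot where "pot s = 4 * (n - wval w s i_var) + (2 * limit + 10) * (limit - wval w s visited_var) + 1" for s
  let ?b = "BAnd (WLess i_var num) (WLess visited_var (WMul (WConst (800 * N)) root_var))"
  let ?P = "Seq (Cond (slab_test N i_var) (process N) Skip) (assign 2 (WAdd i_var (WConst 1)))"
  have "800 * N < 2 ^ w"
    using limits(1) K_pos by (metis One_nat_def Suc_leI le_less_trans mult.right_neutral mult_le_mono2)
  then have test: "bval w (st r out' V' d) ?b \<longleftrightarrow> V' 2 < n \<and> V' 5 < limit" if "V' 1 = K" for out' V'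
    using that limits(1) by (simp add: limit_def)
  have "runs w \<omega> (scan N) (st r out V d) (pot (st r out V d)) (\<lambda>s. Inv s \<and> \<not> bval w s ?b)"
    unfolding scan_def
  proof (rule runs_While)
    show "Inv (st r out V d)"
      unfolding Inv_def using V by (rule_tac exI[of _ V], rule_tac exI[of _ out]) (simp add: greedy_0)
  next
    fix s assume "Inv s" and "bval w s ?b"
    then obtain V1 out1 where s: "s = st r out1 V1 d" and V1: "V1 0 = b" "V1 1 = K" "V1 6 = v"
      "greedy v (V1 2) out1 (V1 4) (V1 5)" unfolding Inv_def by blast
    have lt: "V1 2 < n" "V1 5 < limit" using \<open>bval w s ?b\<close> test[of V1] V1 unfolding s by auto
    have incr: "runs w \<omega> (assign 2 (WAdd i_var (WConst 1))) (st r out' V' d) 1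
       (\<lambda>s'. Inv s' \<and> pot s' = 4 * (n - Suc (V1 2)) + (2 * limit + 10) * (limit - V' 5) + 1)"
      if "V' 0 = b" "V' 1 = K" "V' 6 = v" "V' 2 = V1 2" "V' 5 \<le> limit"
        "greedy v (Suc (V1 2)) out' (V' 4) (V' 5)" for out' V'
    proof (rule runs_assign)
      have "wval w (st r out' V' d) (WAdd i_var (WConst 1)) = Suc (V1 2)"
        using that lt fits by (simp del: wval.simps(1))
      moreover have "Inv (st r out' (V'(2 := Suc (V1 2))) d)"
        unfolding Inv_def using that lt by (intro exI[of _ "V'(2 := Suc (V1 2))"] exI[of _ out']) auto
      ultimately show "Inv (st r out' (V'(2 := wval w (st r out' V' d) (WAdd i_var (WConst 1)))) d) \<and>
          pot (st r out' (V'(2 := wval w (st r out' V' d) (WAdd i_var (WConst 1)))) d) =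
            4 * (n - Suc (V1 2)) + (2 * limit + 10) * (limit - V' 5) + 1"
        by (simp add: pot_def)
    qed simp
    have pot_s: "pot s = 4 * (n - V1 2) + (2 * limit + 10) * (limit - V1 5) + 1"
      by (simp add: s pot_def)
    have slab_test: "bval w s (slab_test N i_var) \<longleftrightarrow> slab v (V1 2)"
      unfolding s slab_def using V1 lt by (intro bval_slab_test) auto
    show "\<exists>T. runs w \<omega> ?P s T (\<lambda>s'. Inv s' \<and> Suc T + pot s' \<le> pot s)"
    proof (cases "slab v (V1 2)")
      case True
      let ?R = "\<lambda>s'. runs w \<omega> (assign 2 (WAdd i_var (WConst 1))) s' 1
       (\<lambda>s'. Inv s' \<and> pot s' = 4 * (n - Suc (V1 2)) + (2 * limit + 10) * (limit - Suc (V1 5)) + 1)"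
      have "runs w \<omega> (process N) s (2 * V1 4 + 8) ?R"
        unfolding s
      proof (rule runs_weaken[OF runs_process[OF V1(2) refl refl refl lt(1) V1(4) True] order_refl])
        fix s' assume "\<exists>V' out'. s' = st r out' V' d \<and> (\<forall>k\<in>{0, 1, 2, 6}. V' k = V1 k) \<and> V' 5 = Suc (V1 5) \<and>
          greedy v (Suc (V1 2)) out' (V' 4) (Suc (V1 5))"
        then obtain V' out' where "s' = st r out' V' d" "\<forall>k\<in>{0, 1, 2, 6}. V' k = V1 k" "V' 5 = Suc (V1 5)"
          "greedy v (Suc (V1 2)) out' (V' 4) (Suc (V1 5))" by blast
        then show "?R s'" using incr[of V' out'] V1 lt by simp
      qed
      then have "runs w \<omega> (Cond (slab_test N i_var) (process N) Skip) s (Suc (2 * V1 4 + 8)) ?R"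
        by (rule runs_Cond) (use True slab_test in simp)
      then have "runs w \<omega> ?P s (Suc (2 * V1 4 + 8) + 1)
        (\<lambda>s'. Inv s' \<and> pot s' = 4 * (n - Suc (V1 2)) + (2 * limit + 10) * (limit - Suc (V1 5)) + 1)"
        by (rule runs_Seq)
      moreover have "Suc (Suc (2 * V1 4 + 8) + 1) + (4 * (n - Suc (V1 2)) + (2 * limit + 10) * (limit - Suc (V1 5)) + 1) \<le> pot s"
      proof -
        have "V1 4 \<le> limit" using greedy_le[OF V1(4)] lt by linarith
        moreover obtain y where "limit - V1 5 = Suc y" "limit - Suc (V1 5) = y"
          using lt by (metis Suc_diff_Suc)
        ultimately show ?thesis unfolding pot_s using lt by (simp add: algebra_simps)
      qed
      ultimately show ?thesis by (intro exI, elim runs_weaken) auto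
    next
      case False
      let ?R = "\<lambda>s'. runs w \<omega> (assign 2 (WAdd i_var (WConst 1))) s' 1
       (\<lambda>s'. Inv s' \<and> pot s' = 4 * (n - Suc (V1 2)) + (2 * limit + 10) * (limit - V1 5) + 1)"
      have "?R s" unfolding s using V1 lt False by (intro incr greedy_skip) auto
      then have "runs w \<omega> Skip s 1 ?R" by (rule runs_Skip)
      then have "runs w \<omega> (Cond (slab_test N i_var) (process N) Skip) s (Suc 1) ?R"
        by (rule runs_Cond[rotated]) (use False slab_test in simp)
      then have "runs w \<omega> ?P s (Suc 1 + 1)
        (\<lambda>s'. Inv s' \<and> pot s' = 4 * (n - Suc (V1 2)) + (2 * limit + 10) * (limit - V1 5) + 1)"
        by (rule runs_Seq)
      then show ?thesis using lt by (intro exI, elim runs_weaken) (auto simp: pot_s)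
    qed
  qed (simp add: pot_def)
  then show ?thesis
  proof (rule runs_weaken)
    show "pot (st r out V d) \<le> 4 * n + (2 * limit + 10) * limit + 1" using V by (simp add: pot_def)
  next
    fix s assume s: "Inv s \<and> \<not> bval w s ?b"
    then obtain V1 out1 where V1: "s = st r out1 V1 d" "V1 0 = b" "V1 1 = K" "V1 2 \<le> n"
      "greedy v (V1 2) out1 (V1 4) (V1 5)" unfolding Inv_def by blast
    then have "V1 2 = n \<or> limit \<le> V1 5" using s test[of V1] by auto
    then show "\<exists>V' out' m x. s = st r out' V' d \<and> V' 0 = b \<and> V' 1 = K \<and> m \<le> n \<and>
      greedy v m out' (V' 4) x \<and> (m = n \<or> limit \<le> x)" using V1 by blast
  qed
qed

text \<open>What is known after any trial, lucky or not: a greedy selection from a prefix of the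
  input, cut short only by the cap.\<close>

definition outcome :: "nat \<Rightarrow> (nat \<Rightarrow> nat) \<Rightarrow> nat \<Rightarrow> bool" where
  "outcome v out c \<longleftrightarrow> (\<exists>m x. m \<le> n \<and> greedy v m out c x \<and> (m = n \<or> limit \<le> x))"

text \<open>The final 6 consists of the 1 in the bound for \<open>scan\<close>, the four commands
  before it, and one evaluation of the guard of \<open>main_loop\<close>.\<close>

definition "trial_time = 4 * n + (2 * limit + 10) * limit + 6"

lemma runs_trial:
  assumes V: "V 0 = b" "V 1 = K"
  shows "runs w \<omega> (trial N) (st r out V d) (trial_time - 1)
    (\<lambda>s. \<exists>V' out'. s = st r out' V' (Suc d) \<and> V' 0 = b \<and> V' 1 = K \<and> outcome (\<omega> d) out' (V' 4))"
    (is "runs _ _ _ _ _ ?Q")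
proof -
  let ?T = "4 * n + (2 * limit + 10) * limit + 1"
  let ?V = "V(6 := \<omega> d, 2 := 0, 4 := 0, 5 := 0)"
  have "runs w \<omega> (scan N) (st r out ?V (Suc d)) ?T
    (\<lambda>s. \<exists>V' out' m x. s = st r out' V' (Suc d) \<and> V' 0 = b \<and> V' 1 = K \<and> m \<le> n \<and>
      greedy (\<omega> d) m out' (V' 4) x \<and> (m = n \<or> limit \<le> x))"
    using V by (intro runs_scan) simp_all
  then have "runs w \<omega> (scan N) (st r out ?V (Suc d)) ?T ?Q"
    unfolding outcome_def by (rule runs_weaken) blast+
  then have "runs w \<omega> (Seq (assign 2 (WConst 0)) (Seq (assign 4 (WConst 0)) (Seq (assign 5 (WConst 0)) (scan N))))
      (st r out (V(6 := \<omega> d)) (Suc d)) (Suc (Suc (Suc ?T))) ?Q"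
    by (intro runs_assign_Seq[OF _ wval_const]) simp_all
  then have "runs w \<omega> (trial N) (st r out V d) (1 + Suc (Suc (Suc ?T))) ?Q"
    unfolding trial_def by (intro runs_Seq runs_draw)
  then show ?thesis by (rule runs_weaken) (simp_all add: trial_time_def)
qed

text \<open>A draw whose every outcome passes the acceptance test ends the loop at trial
  \<open>i\<close> at the latest. An earlier exit does no harm, since the negated guard itself
  supplies the size bound.\<close>

lemma runs_main_loop:
  assumes V: "V 0 = b" "V 1 = K" "V 4 = 0"
    and good: "\<And>out c. outcome (\<omega> i) out c \<Longrightarrow> K \<le> 384 * N * c"
  shows "runs w \<omega> (Seq (main_loop N) (WStore (WConst 0) count_var)) (st r out V 0) (trial_time * Suc i + 2)
    (\<lambda>s. \<exists>v out c. words s 0 = c \<and> words s ` {1..c} = out ` {1..c} \<and> outcome v out c \<and> K \<le> 384 * N * c)"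
proof -
  \<comment> \<open>Each trial draws exactly one word, so \<open>d\<close> counts the trials and
    \<open>d - 1\<close> indexes the word of the last one. For \<open>d = 0\<close> the count is 0,
    which keeps the guard true as K is positive.\<close>
  define Inv where "Inv s \<longleftrightarrow> (\<exists>V out d. s = st r out V d \<and> V 0 = b \<and> V 1 = K \<and> d \<le> Suc i \<and>
    (if d = 0 then V 4 = 0 else outcome (\<omega> (d - 1)) out (V 4)))" for s
  define pot where "pot s = trial_time * (Suc i - draws s) + 1" for s :: machine
  let ?b = "WLess (WMul (WConst (384 * N)) count_var) root_var"
  have c_le: "c \<le> n" if "outcome v out c" for v out c
    using that greedy_le unfolding outcome_def by (meson order_trans)
  have "384 * N < 2 ^ w"
    using limits(2) n_pos by (metis One_nat_def Suc_leI le_less_trans mult.right_neutral mult_le_mono2)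
  moreover have "384 * N * c < 2 ^ w" if "c \<le> n" for c
    using limits(2) that by (meson le_less_trans mult_le_mono2)
  ultimately have test: "bval w (st r out' V' d) ?b \<longleftrightarrow> 384 * N * V' 4 < K"
    if "V' 1 = K" "V' 4 \<le> n" for out' V' d
    using that by simp
  have "runs w \<omega> (main_loop N) (st r out V 0) (pot (st r out V 0)) (\<lambda>s. Inv s \<and> \<not> bval w s ?b)"
    unfolding main_loop_def
  proof (rule runs_While)
    show "Inv (st r out V 0)"
      unfolding Inv_def using V by (rule_tac exI[of _ V], rule_tac exI[of _ out], rule_tac exI[of _ 0]) simp
  next
    fix s assume "Inv s" and b: "bval w s ?b"
    then obtain V1 out1 d where s: "s = st r out1 V1 d" and V1: "V1 0 = b" "V1 1 = K" "d \<le> Suc i"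
      "if d = 0 then V1 4 = 0 else outcome (\<omega> (d - 1)) out1 (V1 4)" unfolding Inv_def by blast
    have "V1 4 \<le> n" using V1(4) c_le by (auto split: if_splits)
    then have fail: "384 * N * V1 4 < K" using b test[of V1] V1 unfolding s by blast
    have "d \<noteq> Suc i"
    proof
      assume "d = Suc i"
      then have "K \<le> 384 * N * V1 4" using V1(4) by (intro good) simp
      then show False using fail by simp
    qed
    then have d: "d \<le> i" using V1 by simp
    have "runs w \<omega> (trial N) s (trial_time - 1) (\<lambda>s'. Inv s' \<and> Suc (trial_time - 1) + pot s' \<le> pot s)"
      unfolding s
    proof (rule runs_weaken[OF runs_trial[OF V1(1,2)] order_refl], elim exE conjE, intro conjI)
      fix s' V2 out2
      assume s': "s' = st r out2 V2 (Suc d)" "V2 0 = b" "V2 1 = K" "outcome (\<omega> d) out2 (V2 4)"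
      then show "Inv s'" unfolding Inv_def using d by fastforce
      have "Suc i - d = Suc (i - d)" using d by simp
      then show "Suc (trial_time - 1) + pot s' \<le> pot (st r out1 V1 d)"
        using d by (simp add: pot_def s'(1) ram_def trial_time_def)
    qed
    then show "\<exists>T. runs w \<omega> (trial N) s T (\<lambda>s'. Inv s' \<and> Suc T + pot s' \<le> pot s)" ..
  qed (simp add: pot_def)
  then have "runs w \<omega> (main_loop N) (st r out V 0) (pot (st r out V 0)) (\<lambda>s. runs w \<omega> (WStore (WConst 0) count_var) s 1
    (\<lambda>s. \<exists>v out c. words s 0 = c \<and> words s ` {1..c} = out ` {1..c} \<and> outcome v out c \<and> K \<le> 384 * N * c))"
  proof (rule runs_weaken[OF _ order_refl])
    fix s assume s: "Inv s \<and> \<not> bval w s ?b"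
    then obtain V1 out1 d where V1: "s = st r out1 V1 d" "V1 0 = b" "V1 1 = K" "d \<le> Suc i"
      "if d = 0 then V1 4 = 0 else outcome (\<omega> (d - 1)) out1 (V1 4)" unfolding Inv_def by blast
    have "V1 4 \<le> n" using V1(5) c_le by (auto split: if_splits)
    then have ok: "K \<le> 384 * N * V1 4" using s test[of V1] V1 by auto
    then have "d \<noteq> 0" using V1(5) K_pos by (auto split: if_splits)
    then have out: "outcome (\<omega> (d - 1)) out1 (V1 4)" using V1(5) by simp
    let ?s' = "s\<lparr>words := (words s)(wval w s (WConst 0) := wval w s count_var)\<rparr>"
    have "exec w \<omega> (WStore (WConst 0) count_var) s 1 ?s'" by (rule exec_WStore)
    moreover have "words ?s' 0 = V1 4" by (simp add: V1(1))
    moreover have "words ?s' ` {1..V1 4} = out1 ` {1..V1 4}"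
      using \<open>V1 4 \<le> n\<close> by (intro image_cong) (auto simp: V1(1) ram_def)
    ultimately show "runs w \<omega> (WStore (WConst 0) count_var) s 1
      (\<lambda>s. \<exists>v out c. words s 0 = c \<and> words s ` {1..c} = out ` {1..c} \<and> outcome v out c \<and> K \<le> 384 * N * c)"
      unfolding runs_def using ok out by blast
  qed
  then have "runs w \<omega> (Seq (main_loop N) (WStore (WConst 0) count_var)) (st r out V 0) (pot (st r out V 0) + 1)
    (\<lambda>s. \<exists>v out c. words s 0 = c \<and> words s ` {1..c} = out ` {1..c} \<and> outcome v out c \<and> K \<le> 384 * N * c)"
    by (rule runs_Seq)
  then show ?thesis by (rule runs_weaken) (simp_all add: pot_def ram_def)
qed

text \<open>Every index is \<open>close\<close> to itself, so entries that are pairwise not close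
  cannot repeat.\<close>

lemma outcome_inj:
  assumes "outcome v out c"
  shows "inj_on out {1..c}"
proof -
  have "close i i" for i by (simp add: close_def near_def)
  then show ?thesis using assms unfolding outcome_def greedy_def by (fastforce intro: inj_onI)
qed

lemma outcome_subset: "outcome v out c \<Longrightarrow> out ` {1..c} \<subseteq> {..<n}"
  unfolding outcome_def greedy_def by fastforce

lemma outcome_convex:
  assumes "outcome v out c" "0 < r"
  shows "convex_position ((!) xs ` out ` {1..c})"
  using assms(1) unfolding outcome_def greedy_def slab_def close_def
  by (intro convex_position_slab[OF assms(2)]) auto

text \<open>A slab with fewer than \<open>limit\<close> points cannot trigger the cap, so the whole
  input was scanned and each dropped slab point has an earlier close one.\<close>

lemma outcome_maximal:
  assumes "outcome v out c" "card {i\<in>{..<n}. slab v i} < limit" "i < n" "slab v i" "i \<notin> out ` {1..c}"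
  shows "\<exists>j<i. slab v j \<and> close i j"
proof -
  from assms(1) obtain m x where mx: "m \<le> n" "greedy v m out c x" "m = n \<or> limit \<le> x"
    unfolding outcome_def by blast
  have "x \<le> card {i\<in>{..<n}. slab v i}"
    using mx unfolding greedy_def by (auto intro!: card_mono)
  then have "m = n" using mx assms(2) by linarith
  then show ?thesis using mx assms unfolding greedy_def by blast
qed

end

section \<open>Preprocessing\<close>

context small_input
begin

lemma wval_pow_exp:
  assumes "wval w s e = B" "0 < B" "B ^ k < 2 ^ w"
  shows "wval w s (pow_exp e k) = B ^ k"
  using assms(3)
proof (induction k)
  case (Suc k)
  have "B ^ k \<le> B ^ Suc k" using \<open>0 < B\<close> by simp
  then have "wval w s (pow_exp e k) = B ^ k" using Suc by (meson le_less_trans)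
  then show ?case using Suc.prems assms(1) by simp
qed (simp del: wval.simps(1))

lemma runs_base_loop:
  assumes "V 0 = 1"
  shows "runs w \<omega> base_loop (st r out V d) (4 * n + 1) (\<lambda>s. s = st r out (V(0 := 2 ^ floorlog 2 n)) d)"
proof -
  define f where "f = floorlog 2 n"
  have f: "2 ^ (f - 1) \<le> n" "n < 2 ^ f" using floorlog_bounds[of n 2] n_pos by (auto simp: f_def)
  then have f_pos: "0 < f" using n_pos by (cases f) auto
  then have f_le: "2 ^ f \<le> 2 * n" using f(1) by (cases f) auto
  define Inv where "Inv s \<longleftrightarrow> (\<exists>m\<le>f. s = st r out (V(0 := 2 ^ m)) d)" for s
  define pot where "pot s = 2 * (2 ^ f - wval w s base_var) + 1" for s
  let ?b = "BNot (WLess num base_var)"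
  have "runs w \<omega> base_loop (st r out V d) (pot (st r out V d)) (\<lambda>s. Inv s \<and> \<not> bval w s ?b)"
    unfolding base_loop_def
  proof (rule runs_While)
    have "V(0 := 2 ^ 0) = V" using assms by auto
    then show "Inv (st r out V d)" unfolding Inv_def by (intro exI[of _ 0]) simp
  next
    fix s assume "Inv s" and b: "bval w s ?b"
    then obtain m where m: "m \<le> f" "s = st r out (V(0 := 2 ^ m)) d" unfolding Inv_def by blast
    have "2 ^ m \<le> n" using b m(2) by simp
    then have "m < f" using f m(1) by (metis le_neq_implies_less not_le)
    have "wval w s (WMul (WConst 2) base_var) = 2 ^ Suc m"
      using \<open>2 ^ m \<le> n\<close> fits unfolding m(2) by (simp del: wval.simps(1))
    moreover have "Inv (st r out (V(0 := 2 ^ Suc m)) d)"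
      unfolding Inv_def using \<open>m < f\<close> by (intro exI[of _ "Suc m"]) simp
    moreover have "Suc 1 + pot (st r out (V(0 := 2 ^ Suc m)) d) \<le> pot s"
    proof -
      have "(2 :: nat) ^ Suc m \<le> 2 ^ f" using \<open>m < f\<close> by (intro power_increasing) auto
      then have le: "2 * (2 :: nat) ^ m \<le> 2 ^ f" "1 \<le> (2 :: nat) ^ m" by auto
      have "Suc 1 + (2 * (F - 2 * x) + 1) \<le> 2 * (F - x) + 1" if "2 * x \<le> F" "1 \<le> x" for F x :: nat
        using that by linarith
      from this[OF le] show ?thesis unfolding pot_def m(2) by simp
    qed
    ultimately have "runs w \<omega> (assign 0 (WMul (WConst 2) base_var)) s 1 (\<lambda>s'. Inv s' \<and> Suc 1 + pot s' \<le> pot s)"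
      unfolding m(2) by (intro runs_assign) auto
    then show "\<exists>T. runs w \<omega> (assign 0 (WMul (WConst 2) base_var)) s T (\<lambda>s'. Inv s' \<and> Suc T + pot s' \<le> pot s)" ..
  qed (simp add: pot_def)
  then show ?thesis
  proof (rule runs_weaken)
    show "pot (st r out V d) \<le> 4 * n + 1" using f_le by (simp add: pot_def)
  next
    fix s assume s: "Inv s \<and> \<not> bval w s ?b"
    then obtain m where m: "m \<le> f" "s = st r out (V(0 := 2 ^ m)) d" unfolding Inv_def by blast
    have "n < 2 ^ m" using s m(2) by simp
    then have "(2 :: nat) ^ (f - 1) < 2 ^ m" using f(1) by linarith
    then have "f - 1 < m" by (rule power_less_imp_less_exp[rotated]) simp
    then have "m = f" using m(1) f_pos by simp
    then show "s = st r out (V(0 := 2 ^ floorlog 2 n)) d" using m(2) by (simp add: f_def)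
  qed
qed

lemma runs_root_loop:
  assumes "V 1 = 0"
  shows "runs w \<omega> root_loop (st r out V d) (2 * n + 1)
    (\<lambda>s. \<exists>K. s = st r out (V(1 := K)) d \<and> n \<le> K * K \<and> K * K \<le> 4 * n)"
proof -
  define Inv where "Inv s \<longleftrightarrow> (\<exists>K\<le>n. s = st r out (V(1 := K)) d \<and> (K = 0 \<or> (K - 1) * (K - 1) < n))" for s
  define pot where "pot s = 2 * (n - wval w s root_var) + 1" for s
  let ?b = "WLess (WMul root_var root_var) num"
  \<comment> \<open>For K \<ge> 2 one has K \<le> 2 (K - 1). The bound also ensures that the square
    in the guard does not wrap around.\<close>
  have four: "K * K \<le> 4 * n" if "K = 0 \<or> (K - 1) * (K - 1) < n" for K
  proof (cases "K \<le> 1")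
    case True
    then have "K * K \<le> 1 * 1" by (intro mult_mono) auto
    then show ?thesis using n_pos by simp
  next
    case False
    then have "K * K \<le> (2 * (K - 1)) * (2 * (K - 1))" by (intro mult_mono) auto
    then show ?thesis using that False by simp
  qed
  have test: "bval w (st r out (V(1 := K)) d) ?b \<longleftrightarrow> K * K < n" if "K = 0 \<or> (K - 1) * (K - 1) < n" for K
    using four[OF that] fits by simp
  have "runs w \<omega> root_loop (st r out V d) (pot (st r out V d)) (\<lambda>s. Inv s \<and> \<not> bval w s ?b)"
    unfolding root_loop_def
  proof (rule runs_While)
    have "V(1 := 0) = V" using assms by auto
    then show "Inv (st r out V d)" unfolding Inv_def by (intro exI[of _ 0]) simp
  next
    fix s assume "Inv s" and b: "bval w s ?b"
    then obtain K where K: "K \<le> n" "s = st r out (V(1 := K)) d" "K = 0 \<or> (K - 1) * (K - 1) < n"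
      unfolding Inv_def by blast
    have sq: "K * K < n" using b test[OF K(3)] K(2) by blast
    then have "K < n" using K(1) by (cases "K = n") (auto simp: not_less)
    have "wval w s (WAdd root_var (WConst 1)) = Suc K"
      using \<open>K < n\<close> fits unfolding K(2) by (simp del: wval.simps(1))
    moreover have "Inv (st r out (V(1 := Suc K)) d)"
      unfolding Inv_def using \<open>K < n\<close> sq by (intro exI[of _ "Suc K"]) simp
    moreover have "Suc 1 + pot (st r out (V(1 := Suc K)) d) \<le> pot s"
      using \<open>K < n\<close> unfolding pot_def K(2) by simp
    ultimately have "runs w \<omega> (assign 1 (WAdd root_var (WConst 1))) s 1 (\<lambda>s'. Inv s' \<and> Suc 1 + pot s' \<le> pot s)"
      unfolding K(2) by (intro runs_assign) auto
    then show "\<exists>T. runs w \<omega> (assign 1 (WAdd root_var (WConst 1))) s T (\<lambda>s'. Inv s' \<and> Suc T + pot s' \<le> pot s)" ..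
  qed (simp add: pot_def)
  then show ?thesis
  proof (rule runs_weaken)
    show "pot (st r out V d) \<le> 2 * n + 1" by (simp add: pot_def)
  next
    fix s assume s: "Inv s \<and> \<not> bval w s ?b"
    then obtain K where K: "K \<le> n" "s = st r out (V(1 := K)) d" "K = 0 \<or> (K - 1) * (K - 1) < n"
      unfolding Inv_def by blast
    then have "n \<le> K * K" using s test[OF K(3)] by auto
    then show "\<exists>K. s = st r out (V(1 := K)) d \<and> n \<le> K * K \<and> K * K \<le> 4 * n"
      using K four[OF K(3)] by blast
  qed
qed

definition deviation :: "nat \<Rightarrow> real" where
  "deviation a = coord (xs ! (a div 3)) (a mod 3) - coord (xs ! 0) (a mod 3)"

text \<open>Besides bounding all deviations, the scale is attained by one of them unless it is 0;
  this makes it a lower bound for some distance in the input.\<close>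

definition is_scale :: "nat \<Rightarrow> real \<Rightarrow> bool" where
  "is_scale m r \<longleftrightarrow> 0 \<le> r \<and> (\<forall>a<m. \<bar>deviation a\<bar> \<le> r) \<and> (r = 0 \<or> (\<exists>a<3 * n. r = \<bar>deviation a\<bar>))"

lemma rval_diff_exp:
  assumes "V 2 = a" "a < 3 * n"
  shows "rval w (st r out V d) diff_exp = deviation a"
proof -
  have "rval w (st r out V d) (RMem i_var) = coord (xs ! (a div 3)) (a mod 3)"
    using assms by (intro rval_input) auto
  moreover have "wval w (st r out V d) (WSub i_var (WMul (WConst 3) (WDiv i_var (WConst 3)))) = a mod 3"
  proof -
    have "3 * (a div 3) < 2 ^ w" using assms fits by linarith
    then show ?thesis using assms by (simp add: minus_mult_div_eq_mod del: wval.simps(1))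
  qed
  then have "rval w (st r out V d) (RMem (WSub i_var (WMul (WConst 3) (WDiv i_var (WConst 3))))) =
      coord (xs ! ((a mod 3) div 3)) ((a mod 3) mod 3)"
    using n_pos by (intro rval_input) auto
  ultimately show ?thesis unfolding diff_exp_def rval.simps(5) by (simp add: deviation_def)
qed

lemma runs_scale_loop:
  assumes "V 2 = 0"
  shows "runs w \<omega> scale_loop (st 0 out V d) (18 * n + 1) (\<lambda>s. \<exists>r a. s = st r out (V(2 := a)) d \<and> is_scale (3 * n) r)"
proof -
  define Inv where "Inv s \<longleftrightarrow> (\<exists>r a. a \<le> 3 * n \<and> s = st r out (V(2 := a)) d \<and> is_scale a r)" for s
  define pot where "pot s = 6 * (3 * n - wval w s i_var) + 1" for s
  let ?b = "WLess i_var (WMul (WConst 3) num)"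
  let ?C1 = "Cond (RLess (RMem scale_addr) diff_exp) (RStore scale_addr diff_exp) Skip"
  let ?C2 = "Cond (RLess (RMem scale_addr) (RSub (RConst 0) diff_exp)) (RStore scale_addr (RSub (RConst 0) diff_exp)) Skip"
  have test: "bval w (st r out (V(2 := a)) d) ?b \<longleftrightarrow> a < 3 * n" for r a
    using fits by (simp del: wval.simps(1))
  have "runs w \<omega> scale_loop (st 0 out V d) (pot (st 0 out V d)) (\<lambda>s. Inv s \<and> \<not> bval w s ?b)"
    unfolding scale_loop_def
  proof (rule runs_While)
    have "V(2 := 0) = V" using assms by auto
    then show "Inv (st 0 out V d)"
      unfolding Inv_def by (rule_tac exI[of _ 0], rule_tac exI[of _ 0]) (simp add: is_scale_def)
  next
    fix s assume "Inv s" and b: "bval w s ?b"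
    then obtain r a where s: "a \<le> 3 * n" "s = st r out (V(2 := a)) d" "is_scale a r"
      unfolding Inv_def by blast
    have a: "a < 3 * n" using b test s(2) by blast
    let ?V = "V(2 := a)"
    define r1 where "r1 = (if r < deviation a then deviation a else r)"
    define r2 where "r2 = (if r1 < - deviation a then - deviation a else r1)"
    have D: "rval w (st r' out ?V d) diff_exp = deviation a" for r' using a by (intro rval_diff_exp) auto
    have r2: "r2 = max r \<bar>deviation a\<bar>" using s(3) unfolding r1_def r2_def is_scale_def by auto
    have scale: "is_scale (Suc a) r2"
      using s(3) a unfolding is_scale_def r2 by (auto simp: less_Suc_eq max_def)
    have "wval w (st r2 out ?V d) (WAdd i_var (WConst 1)) = Suc a"
      using a fits by (simp del: wval.simps(1))
    then have last: "runs w \<omega> (assign 2 (WAdd i_var (WConst 1))) (st r2 out ?V d) 1 (\<lambda>s'. Inv s' \<and> Suc 5 + pot s' \<le> pot s)"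
      (is "runs _ _ _ _ _ ?Q")
    proof (intro runs_assign)
      have "Inv (st r2 out (V(2 := Suc a)) d)" unfolding Inv_def using a scale by (intro exI conjI) auto
      moreover have "Suc 5 + pot (st r2 out (V(2 := Suc a)) d) \<le> pot s" using a unfolding s(2) pot_def by simp
      ultimately show "wval w (st r2 out ?V d) (WAdd i_var (WConst 1)) = Suc a \<Longrightarrow>
        ?Q (st r2 out (?V(2 := wval w (st r2 out ?V d) (WAdd i_var (WConst 1)))) d)" by simp
    qed simp
    have second: "runs w \<omega> (Seq ?C2 (assign 2 (WAdd i_var (WConst 1)))) (st r1 out ?V d) (Suc 1 + 1) ?Q"
    proof (intro runs_Seq runs_Cond)
      assume "bval w (st r1 out ?V d) (RLess (RMem scale_addr) (RSub (RConst 0) diff_exp))"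
      then have "r1 < - deviation a" by (simp add: D del: rval.simps(2))
      then have "r2 = rval w (st r1 out ?V d) (RSub (RConst 0) diff_exp)" by (simp add: D r2_def)
      then show "runs w \<omega> (RStore scale_addr (RSub (RConst 0) diff_exp)) (st r1 out ?V d) 1
          (\<lambda>s'. runs w \<omega> (assign 2 (WAdd i_var (WConst 1))) s' 1 ?Q)"
        using last by (intro runs_store_scale) simp
    next
      assume "\<not> bval w (st r1 out ?V d) (RLess (RMem scale_addr) (RSub (RConst 0) diff_exp))"
      then have "r2 = r1" by (simp add: D r2_def del: rval.simps(2))
      then show "runs w \<omega> Skip (st r1 out ?V d) 1 (\<lambda>s'. runs w \<omega> (assign 2 (WAdd i_var (WConst 1))) s' 1 ?Q)"
        using last by (intro runs_Skip) simp
    qed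
    have "runs w \<omega> (Seq ?C1 (Seq ?C2 (assign 2 (WAdd i_var (WConst 1))))) s (Suc 1 + (Suc 1 + 1)) ?Q"
      unfolding s(2)
    proof (intro runs_Seq[of _ _ ?C1] runs_Cond)
      assume "bval w (st r out ?V d) (RLess (RMem scale_addr) diff_exp)"
      then have "r < deviation a" by (simp add: D del: rval.simps(2))
      then have "r1 = rval w (st r out ?V d) diff_exp" by (simp add: D r1_def)
      then show "runs w \<omega> (RStore scale_addr diff_exp) (st r out ?V d) 1
          (\<lambda>s'. runs w \<omega> (Seq ?C2 (assign 2 (WAdd i_var (WConst 1)))) s' (Suc 1 + 1) (\<lambda>s'. Inv s' \<and> Suc 5 + pot s' \<le> pot (st r out ?V d)))"
        using second unfolding s(2) by (intro runs_store_scale) simp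
    next
      assume "\<not> bval w (st r out ?V d) (RLess (RMem scale_addr) diff_exp)"
      then have "r1 = r" by (simp add: D r1_def del: rval.simps(2))
      then show "runs w \<omega> Skip (st r out ?V d) 1
          (\<lambda>s'. runs w \<omega> (Seq ?C2 (assign 2 (WAdd i_var (WConst 1)))) s' (Suc 1 + 1) (\<lambda>s'. Inv s' \<and> Suc 5 + pot s' \<le> pot (st r out ?V d)))"
        using second unfolding s(2) by (intro runs_Skip) simp
    qed
    then have "runs w \<omega> (Seq ?C1 (Seq ?C2 (assign 2 (WAdd i_var (WConst 1))))) s 5 ?Q"
      by (rule runs_weaken) simp_all
    then show "\<exists>T. runs w \<omega> (Seq ?C1 (Seq ?C2 (assign 2 (WAdd i_var (WConst 1))))) s T
      (\<lambda>s'. Inv s' \<and> Suc T + pot s' \<le> pot s)" ..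
  qed (simp add: pot_def)
  then show ?thesis
  proof (rule runs_weaken)
    show "pot (st 0 out V d) \<le> 18 * n + 1" by (simp add: pot_def)
  next
    fix s assume s: "Inv s \<and> \<not> bval w s ?b"
    then obtain r a where ra: "a \<le> 3 * n" "s = st r out (V(2 := a)) d" "is_scale a r"
      unfolding Inv_def by blast
    then have "a = 3 * n" using s test by (metis le_neq_implies_less)
    then show "\<exists>r a. s = st r out (V(2 := a)) d \<and> is_scale (3 * n) r" using ra by blast
  qed
qed

lemma runs_preprocess:
  assumes "((2 :: nat) ^ floorlog 2 n) ^ k < 2 ^ w"
  shows "runs w \<omega> (preprocess k) (st 0 out (\<lambda>_. 0) d) (24 * n + 5)
    (\<lambda>s. \<exists>V K r. s = st r out V d \<and> V 0 = (2 ^ floorlog 2 n) ^ k \<and> V 1 = K \<and> V 4 = 0 \<and>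
      n \<le> K * K \<and> K * K \<le> 4 * n \<and> is_scale (3 * n) r)" (is "runs _ _ _ _ _ ?Q")
proof -
  let ?B = "2 ^ floorlog 2 n"
  let ?V1 = "(\<lambda>_. 0)(0 := ?B ^ k)"
  have scale: "runs w \<omega> scale_loop (st 0 out (?V1(1 := K)) d) (18 * n + 1) ?Q" if "n \<le> K * K" "K * K \<le> 4 * n" for K
  proof (rule runs_weaken[OF runs_scale_loop order_refl], simp, elim exE conjE)
    fix s r a assume "s = st r out (?V1(1 := K, 2 := a)) d" "is_scale (3 * n) r"
    then show "?Q s" using that by (intro exI conjI) (assumption | simp)+
  qed
  have "runs w \<omega> (Seq root_loop scale_loop) (st 0 out ?V1 d) (2 * n + 1 + (18 * n + 1)) ?Q"
  proof (rule runs_Seq, rule runs_weaken[OF runs_root_loop order_refl])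
    fix s assume "\<exists>K. s = st 0 out (?V1(1 := K)) d \<and> n \<le> K * K \<and> K * K \<le> 4 * n"
    then show "runs w \<omega> scale_loop s (18 * n + 1) ?Q" using scale by blast
  qed simp
  note root = this
  have pow: "wval w (st 0 out ((\<lambda>_. 0)(0 := ?B)) d) (pow_exp base_var k) = ?B ^ k"
    using assms by (intro wval_pow_exp) simp_all
  have "runs w \<omega> (Seq (assign 0 (pow_exp base_var k)) (Seq root_loop scale_loop)) (st 0 out ((\<lambda>_. 0)(0 := ?B)) d)
      (Suc (2 * n + 1 + (18 * n + 1))) ?Q"
    by (rule runs_assign_Seq[OF _ pow]) (use root in simp_all)
  note power = this
  have "runs w \<omega> base_loop (st 0 out ((\<lambda>_. 0)(0 := 1)) d) (4 * n + 1) (\<lambda>s. s = st 0 out ((\<lambda>_. 0)(0 := 1, 0 := ?B)) d)"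
    by (rule runs_base_loop) simp
  then have "runs w \<omega> base_loop (st 0 out ((\<lambda>_. 0)(0 := 1)) d) (4 * n + 1)
      (\<lambda>s. runs w \<omega> (Seq (assign 0 (pow_exp base_var k)) (Seq root_loop scale_loop)) s (Suc (2 * n + 1 + (18 * n + 1))) ?Q)"
    by (rule runs_weaken) (use power in simp_all)
  from runs_Seq[OF this] have base: "runs w \<omega> (Seq base_loop (Seq (assign 0 (pow_exp base_var k)) (Seq root_loop scale_loop)))
      (st 0 out ((\<lambda>_. 0)(0 := 1)) d) (4 * n + 1 + (Suc (2 * n + 1 + (18 * n + 1)))) ?Q" .
  have "runs w \<omega> (preprocess k) (st 0 out (\<lambda>_. 0) d) (Suc (4 * n + 1 + (Suc (2 * n + 1 + (18 * n + 1))))) ?Q"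
    unfolding preprocess_def by (rule runs_assign_Seq[OF _ wval_const base]) simp_all
  then show ?thesis by (rule runs_weaken) simp_all
qed

end

section \<open>Dense point sets\<close>

text \<open>Compare the left side with the maximal and the right side with the minimal pair
  distance. Nonnegativity of \<open>M\<close> comes from the minimum being positive.\<close>

lemma dist_scale_bounds:
  fixes A :: "(real ^ 3) set"
  assumes "finite A" "p \<in> A" "y \<in> A" "p \<noteq> y" "spread A \<le> M" "p' \<in> A" "y' \<in> A"
  shows "dist p' y' \<le> M * dist p y"
proof -
  have "pair_dists A \<subseteq> (\<lambda>(p, y). dist p y) ` (A \<times> A)" by (auto simp: pair_dists_def)
  then have fin: "finite (pair_dists A)" using assms(1) by (meson finite_SigmaI finite_imageI finite_subset)
  have mem: "dist p y \<in> pair_dists A" using assms unfolding pair_dists_def by blast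
  have "Min (pair_dists A) \<in> pair_dists A" using fin mem by (intro Min_in) auto
  then have Min_pos: "0 < Min (pair_dists A)" by (auto simp: pair_dists_def)
  have Max_le: "Max (pair_dists A) \<le> M * Min (pair_dists A)"
    using assms(5) Min_pos by (simp add: spread_def field_simps)
  have "Min (pair_dists A) \<le> dist p y" "dist p y \<le> Max (pair_dists A)" using fin mem by auto
  moreover have "0 \<le> M"
  proof (rule ccontr)
    assume "\<not> 0 \<le> M"
    then have "M * Min (pair_dists A) < 0" using Min_pos by (intro mult_neg_pos) auto
    then show False using Max_le calculation Min_pos by linarith
  qed
  ultimately have le: "Max (pair_dists A) \<le> M * dist p y"
    using Max_le mult_left_mono[of "Min (pair_dists A)" "dist p y" M] by linarith
  show ?thesis
  proof (cases "p' = y'")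
    case True
    then show ?thesis using \<open>0 \<le> M\<close> by simp
  next
    case False
    then have "dist p' y' \<in> pair_dists A" using assms unfolding pair_dists_def by blast
    then have "dist p' y' \<le> Max (pair_dists A)" using fin by simp
    then show ?thesis using le by linarith
  qed
qed

lemma coord_eq_nth: "coord p 0 = p $ 1" "coord p 1 = p $ 2" "coord p 2 = p $ 3"
  by (simp_all add: coord_def)

lemma coord_diff_le_dist: "c < 3 \<Longrightarrow> \<bar>coord p c - coord y c\<bar> \<le> dist p y"
proof -
  have "\<bar>p $ k - y $ k\<bar> \<le> dist p y" for k
    using component_le_norm_cart[of "p - y" k] by (simp add: dist_norm)
  then show ?thesis by (simp add: coord_def)
qed

lemma eq_if_coords_eq:
  fixes p y :: "real ^ 3"
  assumes "\<And>c. c < 3 \<Longrightarrow> coord p c = coord y c"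
  shows "p = y"
proof -
  have "p $ 1 = y $ 1" "p $ 2 = y $ 2" "p $ 3 = y $ 3"
    using assms[of 0] assms[of 1] assms[of 2] by (simp_all add: coord_def)
  then show ?thesis by (simp add: vec_eq_iff forall_3)
qed

lemma dist_le_coords:
  fixes p y :: "real ^ 3"
  assumes "\<And>c. c < 3 \<Longrightarrow> \<bar>coord p c - coord y c\<bar> \<le> e"
  shows "dist p y \<le> 2 * e"
proof -
  have e: "0 \<le> e" using assms[of 0] by simp
  have sq: "(coord p c - coord y c)\<^sup>2 \<le> e\<^sup>2" if "c < 3" for c
    using power_mono[OF assms[OF that], of 2] by simp
  have "(dist p y)\<^sup>2 = (coord p 0 - coord y 0)\<^sup>2 + (coord p 1 - coord y 1)\<^sup>2 + (coord p 2 - coord y 2)\<^sup>2"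
    unfolding dist_norm power2_norm_eq_inner coord_eq_nth
    by (simp add: inner_vec_def sum_3 power2_eq_square)
  also have "\<dots> \<le> (2 * e)\<^sup>2" 
  proof -
    have "(2 * e)\<^sup>2 = 4 * e\<^sup>2" by (simp add: power_mult_distrib)
    moreover have "0 \<le> e\<^sup>2" by simp
    ultimately show ?thesis using sq[of 0] sq[of 1] sq[of 2] by linarith
  qed
  finally show ?thesis by (rule power2_le_imp_le) (use e in simp)
qed

context small_input
begin

lemma deviation_eq: "c < 3 \<Longrightarrow> deviation (3 * i + c) = coord (xs ! i) c - coord (xs ! 0) c"
  by (simp add: deviation_def)

lemma is_scale_ge:
  assumes "is_scale (3 * n) r" "i < n" "c < 3"
  shows "\<bar>coord (xs ! i) c - coord (xs ! 0) c\<bar> \<le> r"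
proof -
  have "3 * i + c < 3 * n" using assms by linarith
  then show ?thesis using assms unfolding is_scale_def by (metis deviation_eq)
qed

lemma scale_pos:
  assumes "is_scale (3 * n) r" "2 \<le> n" "distinct xs"
  shows "0 < r"
proof (rule ccontr)
  assume "\<not> 0 < r"
  then have "coord (xs ! 1) c = coord (xs ! 0) c" if "c < 3" for c
    using is_scale_ge[OF assms(1), of 1 c] that assms(2) by simp
  then have "xs ! 1 = xs ! 0" by (rule eq_if_coords_eq)
  then show False using assms(2,3) len by (simp add: nth_eq_iff_index_eq)
qed

lemma scale_le:
  assumes "is_scale (3 * n) r" "0 < r"
  shows "\<exists>i<n. r \<le> dist (xs ! i) (xs ! 0)"
proof -
  obtain a where a: "a < 3 * n" "r = \<bar>deviation a\<bar>" using assms unfolding is_scale_def by auto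
  then have "r \<le> dist (xs ! (a div 3)) (xs ! 0)"
    using coord_diff_le_dist[of "a mod 3"] by (simp add: deviation_def)
  moreover have "a div 3 < n" using a by simp
  ultimately show ?thesis by blast
qed

end

text \<open>\<open>N\<close> is an integer substitute for the constants depending on \<alpha>: the
  first bound yields 2 \<eta> \<le> \<open>sep\<close>, and the second, with 23887872 = 8 * 12^6,
  yields \<open>volume\<close> for \<open>sep\<close> = 1/(2 \<alpha> n^(1/3)).\<close>

locale dense_input =
  fixes \<alpha> :: real and N n :: nat and A :: "(real ^ 3) set" and xs :: "(real ^ 3) list"
  assumes \<alpha>_pos: "0 < \<alpha>" and N_ge: "4 * \<alpha> \<le> real N" "23887872 * \<alpha> ^ 3 \<le> real N"
    and n_ge: "2 \<le> n" and A: "finite A" "card A = n" "spread A \<le> \<alpha> * real n powr (1 / 3)"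
    and xs: "distinct xs" "set xs = A"
begin

text \<open>One factor exceeds n and the other 2000 N factors together exceed 2000 N, since 2^x > x.
  The word length below is chosen so that 2^\<open>wlen\<close> is exactly \<open>base\<close>^3,
  hence no draw has to be rejected.\<close>

definition "base = ((2 :: nat) ^ floorlog 2 n) ^ Suc (2000 * N)"
definition "wlen = word_length (3 * Suc (2000 * N)) n"

lemma two_power_wlen: "2 ^ wlen = base ^ 3"
proof -
  have "x * y * z = z * y * x" for x y z :: nat by (simp add: ac_simps)
  from this[of 3 "Suc (2000 * N)" "floorlog 2 n"] show ?thesis
    unfolding wlen_def base_def word_length_def by (simp only: power_mult[symmetric])
qed

lemma N_gt_0: "0 < N"
proof (rule ccontr)
  assume "\<not> 0 < N"
  then show False using N_ge(1) \<alpha>_pos by simp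
qed

lemma base_ge: "2000 * N * n \<le> base"
proof -
  have n: "n < 2 ^ floorlog 2 n" using floorlog_bounds[of n 2] n_ge by auto
  have "2000 * N \<le> 2 ^ (2000 * N)" using less_exp[of "2000 * N"] by simp
  also have "\<dots> \<le> (2 ^ floorlog 2 n) ^ (2000 * N)"
    using n n_ge by (intro power_mono) auto
  finally have "2000 * N * n \<le> (2 ^ floorlog 2 n) ^ (2000 * N) * 2 ^ floorlog 2 n"
    using n by (intro mult_mono) auto
  then show ?thesis by (simp add: base_def mult.commute)
qed

lemma base_less: "base < 2 ^ wlen"
proof -
  have "2000 * 1 * 2 \<le> 2000 * N * n" using N_gt_0 n_ge by (intro mult_mono) auto
  then have "1 < base" using base_ge by linarith
  then have "base ^ 1 < base ^ 3" by (intro power_strict_increasing) auto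
  then show ?thesis by (simp add: two_power_wlen)
qed

lemma length_xs: "length xs = n"
  using A(2) xs distinct_card[OF xs(1)] by simp

sublocale small_input wlen n xs
proof
  have "2000 * 1 * n \<le> 2000 * N * n" using N_gt_0 by (intro mult_mono) auto
  then show "8 * n + 20 < 2 ^ wlen" using base_ge base_less n_ge by linarith
qed (use length_xs n_ge in auto)

definition "cbrt_n = real n powr (1 / 3)"

lemma cbrt_n: "1 \<le> cbrt_n" "cbrt_n ^ 3 = real n"
proof -
  show "1 \<le> cbrt_n" unfolding cbrt_n_def using n_ge by (intro ge_one_powr_ge_zero) auto
  have "cbrt_n ^ 3 = cbrt_n powr 3" using \<open>1 \<le> cbrt_n\<close> by (simp add: powr_numeral)
  also have "\<dots> = real n" using n_ge by (simp add: cbrt_n_def powr_powr)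
  finally show "cbrt_n ^ 3 = real n" .
qed

end

locale dense_run = dense_input +
  fixes K :: nat and r :: real
  assumes K: "n \<le> K * K" "K * K \<le> 4 * n" and r: "is_scale (3 * n) r"
begin

lemma r_pos: "0 < r"
  using scale_pos[OF r n_ge xs(1)] .

lemma K_ge_1: "1 \<le> K"
  using K(1) n_ge by (cases K) simp_all

lemma K_le: "K \<le> 2 * n"
proof (rule ccontr)
  assume "\<not> K \<le> 2 * n"
  then have "(2 * n) * (2 * n) < K * K" by (intro mult_strict_mono) auto
  moreover have "4 * n * 1 \<le> 4 * n * n" using n_ge by (intro mult_left_mono) auto
  ultimately show False using K(2) by linarith
qed

sublocale sampler wlen n xs N base K r
proof
  have "800 * N * K \<le> 1600 * N * n" using K_le by simp
  moreover have "1600 * N * n \<le> 2000 * N * n" "384 * N * n \<le> 2000 * N * n" by (intro mult_right_mono; simp)+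
  ultimately show "800 * N * K < 2 ^ wlen" "384 * N * n < 2 ^ wlen" using base_ge base_less by linarith+
qed (use N_gt_0 K_ge_1 in auto)

abbreviation "\<eta> \<equiv> 1 / (real N * real K)"
abbreviation "sep \<equiv> 1 / (2 * \<alpha> * cbrt_n)"

text \<open>Some input distance is at least the scale \<open>r\<close>, and the spread bounds its
  quotient by any other distance.\<close>

lemma dist_ge:
  assumes "p \<in> A" "y \<in> A" "p \<noteq> y"
  shows "r / (\<alpha> * cbrt_n) \<le> dist p y"
proof -
  obtain i where i: "i < n" "r \<le> dist (xs ! i) (xs ! 0)" using scale_le[OF r r_pos] by blast
  have "dist (xs ! i) (xs ! 0) \<le> \<alpha> * cbrt_n * dist p y"
    using assms A xs i n_ge length_xs unfolding cbrt_n_def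
    by (intro dist_scale_bounds) auto
  then show ?thesis using i \<alpha>_pos cbrt_n by (simp add: field_simps)
qed

lemma cbrt_le_K: "cbrt_n \<le> real K"
proof (rule ccontr)
  assume "\<not> cbrt_n \<le> real K"
  then have "(real K)\<^sup>2 < cbrt_n\<^sup>2" by (intro power_strict_mono) auto
  also have "\<dots> \<le> cbrt_n ^ 3" using cbrt_n by (intro power_increasing) auto
  also have "\<dots> = real n" by (rule cbrt_n)
  also have "\<dots> \<le> real (K * K)" using K(1) by (rule of_nat_mono)
  finally show False by (simp add: power2_eq_square)
qed

sublocale scaled_points n base "scaled_coord xs r" sep \<eta>
proof
  fix i c assume "i < n" "c < (3 :: nat)"
  then show "\<bar>scaled_coord xs r i c\<bar> \<le> 1"
    using is_scale_ge[OF r] r_pos by (simp add: scaled_coord_def abs_divide)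
next
  fix i j assume ij: "i < n" "j < n" "i \<noteq> j"
  let ?d = "\<lambda>c. \<bar>scaled_coord xs r i c - scaled_coord xs r j c\<bar>"
  show "sep \<le> ?d 0 \<or> sep \<le> ?d 1 \<or> sep \<le> ?d 2"
  proof (rule ccontr)
    assume "\<not> ?thesis"
    then have lt: "?d 0 < sep" "?d 1 < sep" "?d 2 < sep" by auto
    define e where "e = max (?d 0) (max (?d 1) (?d 2))"
    have "e < sep" using lt by (simp add: e_def)
    have "?d c \<le> e" if "c < 3" for c
    proof -
      have "c = 0 \<or> c = 1 \<or> c = 2" using that by linarith
      then show ?thesis by (auto simp: e_def)
    qed
    moreover have "?d c = \<bar>coord (xs ! i) c - coord (xs ! j) c\<bar> / r" for c
      using r_pos by (simp add: scaled_coord_def abs_divide diff_divide_distrib[symmetric])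
    ultimately have "dist (xs ! i) (xs ! j) \<le> 2 * (r * e)"
      using r_pos by (intro dist_le_coords) (simp add: field_simps)
    also have "\<dots> < 2 * (r * sep)" using \<open>e < sep\<close> r_pos by (intro mult_strict_left_mono) auto
    also have "\<dots> = r / (\<alpha> * cbrt_n)" by simp
    also have "\<dots> \<le> dist (xs ! i) (xs ! j)"
      using ij xs length_xs by (intro dist_ge) (auto simp: nth_eq_iff_index_eq)
    finally show False by simp
  qed
next
  have NK: "1 \<le> real N * real K" using N_gt_0 K_ge_1 by (metis One_nat_def Suc_leI mult_pos_pos of_nat_1 of_nat_le_iff of_nat_mult less_eq_Suc_le)
  show "0 < \<eta>" "\<eta> \<le> 1" using NK by auto
  have "(4 * \<alpha>) * cbrt_n \<le> real N * real K"
    using N_ge cbrt_le_K \<alpha>_pos cbrt_n by (intro mult_mono) auto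
  then show "2 * \<eta> \<le> sep" using \<alpha>_pos cbrt_n NK by (simp add: field_simps)
  have "24 * (N * K) \<le> 48 * (N * n)" using K_le by simp
  also have "\<dots> \<le> 2000 * N * n" by simp
  also have "\<dots> \<le> base" by (rule base_ge)
  finally have "24 * (real N * real K) \<le> real base"
    by (metis of_nat_le_iff of_nat_mult of_nat_numeral)
  then show "24 \<le> \<eta> * real base" using NK by (simp add: field_simps)
  \<comment> \<open>The left side is 2985984 / \<open>sep\<close>^3, so this is
    \<open>volume\<close> with denominators cleared; it uses K^2 \<ge> n and N^2 \<ge> N.\<close>
  have "23887872 * \<alpha> ^ 3 * n \<le> real N * real N * (real K * real K)"
  proof (rule mult_mono)
    have "real N * 1 \<le> real N * real N" using N_gt_0 by (intro mult_left_mono) auto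
    then show "23887872 * \<alpha> ^ 3 \<le> real N * real N" using N_ge by linarith
    show "real n \<le> real K * real K" using K(1) by (metis of_nat_le_iff of_nat_mult)
  qed auto
  note le = this
  have "2985984 * \<eta>\<^sup>2 = 2985984 / (real N * real N * (real K * real K))"
    by (simp add: power2_eq_square)
  also have "\<dots> \<le> 2985984 / (23887872 * \<alpha> ^ 3 * n)"
  proof (rule divide_left_mono[OF le])
    show "0 < real N * real N * (real K * real K) * (23887872 * \<alpha> ^ 3 * n)"
      using \<alpha>_pos n_ge N_gt_0 K_ge_1 by (intro mult_pos_pos zero_less_power) auto
  qed simp
  also have "\<dots> = sep ^ 3"
    by (simp add: power_divide power_mult_distrib cbrt_n)
  finally show "2985984 * \<eta>\<^sup>2 \<le> sep ^ 3" .
qed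

definition "good_draws = {v. real (slab_size v) < real limit \<and>
  real n * \<eta> / 96 \<le> real (slab_size v) - real (crowding v)}"

text \<open>The cap makes \<eta> * limit equal to 800, and K^2 \<le> 4n gives n \<eta>^2 \<ge> 1/(4
  N^2); hence the success probability is bounded below independently of n, with 19200 = 4 *
  4800.\<close>

lemma prob_good_draws:
  "1 / (19200 * (real N)\<^sup>2) * 2 ^ wlen \<le> real (card {v\<in>{..<2 ^ wlen}. v \<in> good_draws})"
proof -
  have NK: "0 < real N" "0 < real K" using N_gt_0 K_ge_1 by auto
  have "real K * real K \<le> 4 * real n" using K(2) by (metis of_nat_le_iff of_nat_mult of_nat_numeral)
  then have "1 / (19200 * (real N)\<^sup>2) \<le> real n * \<eta>\<^sup>2 / 4800"
    using NK by (simp add: field_simps power2_eq_square)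
  then have "1 / (19200 * (real N)\<^sup>2) * real (base ^ 3) \<le> real n * \<eta>\<^sup>2 / 4800 * real (base ^ 3)"
    by (intro mult_right_mono) auto
  also have "\<dots> \<le> real (card {v\<in>{..<base^3}. real (slab_size v) < real limit \<and>
      real n * \<eta> / 96 \<le> real (slab_size v) - real (crowding v)})"
    using card_good_draws[of "real limit"] NK by (simp add: limit_def)
  finally show ?thesis unfolding two_power_wlen[symmetric] good_draws_def by simp
qed

text \<open>A good draw has no capped scan, so the kept points number at least the excess n/(96 N
  K); using n \<ge> K^2/4 turns this into K \<le> 384 N c, precisely the acceptance test.\<close>

lemma outcome_good:
  assumes "v \<in> good_draws" "outcome v out c"
  shows "K \<le> 384 * N * c"
proof -
  have NK: "0 < real N" "0 < real K" using N_gt_0 K_ge_1 by auto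
  have "card {i\<in>{..<n}. slab v i} < limit"
    using assms(1) by (simp add: good_draws_def slab_size_def slab_def)
  then have "slab_size v \<le> card (out ` {1..c}) + crowding v"
    using outcome_maximal[OF assms(2)] unfolding slab_def close_def by (intro slab_size_le) auto
  moreover have "card (out ` {1..c}) \<le> c" using card_image_le[of "{1..c}" out] by simp
  ultimately have "real n * \<eta> / 96 \<le> real c" using assms(1) unfolding good_draws_def by auto
  then have "real n \<le> 96 * real N * real K * real c" using NK by (simp add: field_simps)
  moreover have "real K * real K \<le> 4 * real n" using K(2) by (metis of_nat_le_iff of_nat_mult of_nat_numeral)
  ultimately have "real K * real K \<le> 4 * (96 * real N * real K * real c)" by linarith
  also have "\<dots> = real K * (384 * real N * real c)" by simp
  finally have "real K * real K \<le> real K * (384 * real N * real c)" .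
  then have "real K \<le> 384 * real N * real c" using NK by simp
  then show ?thesis by (metis of_nat_le_iff of_nat_mult of_nat_numeral)
qed

lemma opt_convex_bound: "real (opt_convex A) \<le> 6 * (8 * \<alpha> + 1)\<^sup>2 * cbrt_n\<^sup>2"
proof -
  have "real (opt_convex A) \<le> 6 * (8 * r / (r / (\<alpha> * cbrt_n)) + 1)\<^sup>2"
  proof (rule opt_convex_le[OF A(1) r_pos])
    fix p k assume "p \<in> A"
    then obtain i where i: "i < n" "p = xs ! i" using xs length_xs by (metis in_set_conv_nth)
    have "\<bar>p $ k - (xs ! 0) $ k\<bar> \<le> r" if "k = 1 \<or> k = 2 \<or> k = 3"
      using that is_scale_ge[OF r i(1), of 0] is_scale_ge[OF r i(1), of 1] is_scale_ge[OF r i(1), of 2] i(2)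
      by (auto simp: coord_def)
    then show "\<bar>p $ k - (xs ! 0) $ k\<bar> \<le> r" using exhaust_3[of k] by blast
  qed (use dist_ge r_pos \<alpha>_pos cbrt_n in auto)
  also have "8 * r / (r / (\<alpha> * cbrt_n)) = 8 * \<alpha> * cbrt_n" using r_pos by simp
  also have "6 * (8 * \<alpha> * cbrt_n + 1)\<^sup>2 \<le> 6 * ((8 * \<alpha> + 1) * cbrt_n)\<^sup>2"
    using cbrt_n \<alpha>_pos by (intro mult_left_mono power_mono) (auto simp: algebra_simps)
  finally show ?thesis by (simp add: power_mult_distrib)
qed

text \<open>The optimum is O(n^(2/3)), and n^(-1/6) times it is O(n^(1/2)), which is O(K) and hence
  O(c). The constant is 2304 = 6 * 384.\<close>

lemma outcome_card:
  assumes "outcome v out c" "K \<le> 384 * N * c"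
  shows "1 / (2304 * real N * (8 * \<alpha> + 1)\<^sup>2) * real n powr (- 1 / 6) * real (opt_convex A)
    \<le> real (card ((!) xs ` out ` {1..c}))"
proof -
  have NK: "0 < real N" "0 < real K" using N_gt_0 K_ge_1 by auto
  have "inj_on ((!) xs) (out ` {1..c})"
    using outcome_subset[OF assms(1)] length_xs xs by (intro inj_onI) (auto simp: nth_eq_iff_index_eq subset_eq)
  then have card: "card ((!) xs ` out ` {1..c}) = c"
    using outcome_inj[OF assms(1)] by (simp add: card_image)
  have pos: "0 < (8 * \<alpha> + 1)\<^sup>2" using \<alpha>_pos by simp
  have "real n powr (- 1 / 6) * real (opt_convex A) \<le> real n powr (- 1 / 6) * (6 * (8 * \<alpha> + 1)\<^sup>2 * cbrt_n\<^sup>2)"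
    by (intro mult_left_mono opt_convex_bound) auto
  also have "cbrt_n\<^sup>2 = real n powr (2 / 3)"
    using n_ge by (simp add: cbrt_n_def powr_power)
  also have "real n powr (- 1 / 6) * (6 * (8 * \<alpha> + 1)\<^sup>2 * real n powr (2 / 3)) =
      6 * (8 * \<alpha> + 1)\<^sup>2 * (real n powr (- 1 / 6) * real n powr (2 / 3))" by simp
  also have "real n powr (- 1 / 6) * real n powr (2 / 3) = sqrt (real n)"
    using n_ge by (simp add: powr_add[symmetric] powr_half_sqrt)
  also have "sqrt (real n) \<le> real K"
    using K(1) by (intro real_le_lsqrt) (auto simp: power2_eq_square simp flip: of_nat_mult)
  also have "real K \<le> 384 * real N * real c"
    using assms(2) by (metis of_nat_le_iff of_nat_mult of_nat_numeral)
  finally have "real n powr (- 1 / 6) * real (opt_convex A) \<le> 6 * (8 * \<alpha> + 1)\<^sup>2 * (384 * real N * real c)"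
    using pos by simp
  then have "1 / (2304 * real N * (8 * \<alpha> + 1)\<^sup>2) * (real n powr (- 1 / 6) * real (opt_convex A)) \<le>
      1 / (2304 * real N * (8 * \<alpha> + 1)\<^sup>2) * (6 * (8 * \<alpha> + 1)\<^sup>2 * (384 * real N * real c))"
    by (intro mult_left_mono) auto
  also have "\<dots> = real c" using NK pos by (simp add: field_simps)
  finally show ?thesis unfolding card by simp
qed

text \<open>The cap is of order K, so its square is of order n by K^2 \<le> 4n; the lower-order
  terms are absorbed into it.\<close>

lemma trial_time_le: "real trial_time \<le> (10 + 30720000 * (real N)\<^sup>2) * real n"
proof -
  have "limit \<le> limit * limit" by (cases limit) auto
  then have "trial_time \<le> 4 * n + 12 * (limit * limit) + 6"
    unfolding trial_time_def by (simp add: algebra_simps)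
  also have "limit * limit = 640000 * (N * N) * (K * K)" by (simp add: limit_def)
  also have "4 * n + 12 * (640000 * (N * N) * (K * K)) + 6 \<le> 4 * n + 12 * (640000 * (N * N) * (4 * n)) + 6 * n"
    using K(2) n_ge by (intro add_mono mult_left_mono) auto
  finally have "real trial_time \<le> real (4 * n + 12 * (640000 * (N * N) * (4 * n)) + 6 * n)" by (rule of_nat_mono)
  then show ?thesis by (simp add: power2_eq_square algebra_simps)
qed

end

context dense_input
begin

text \<open>The time is linear in n; dividing by ln 2 expresses it through n ln n, as n \<ge> 2. The
  31 collects the 24n + 7 steps outside the trials, and 19200 N^2 is the reciprocal of the success
  probability.\<close>

definition "time_const = (31 + 19200 * (real N)\<^sup>2 * (10 + 30720000 * (real N)\<^sup>2)) / ln 2"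
definition "ratio_const = 1 / (2304 * real N * (8 * \<alpha> + 1)\<^sup>2)"

lemma program_correct:
  "expected_time wlen (program N (Suc (2000 * N))) (ram_input xs) \<le> ennreal (time_const * (real n * ln (real n)))"
  "AE \<omega> in random_tape wlen. \<exists>t s. exec wlen \<omega> (program N (Suc (2000 * N))) (ram_input xs) t s \<and>
    ram_output s \<subseteq> {..<n} \<and> convex_position ((!) xs ` ram_output s) \<and>
    ratio_const * real n powr (- 1 / 6) * real (opt_convex A) \<le> real (card ((!) xs ` ram_output s))"
proof -
  let ?P = "program N (Suc (2000 * N))"
  have init: "ram_input xs = st 0 (\<lambda>_. 0) (\<lambda>_. 0) 0" by (simp add: ram_input_eq len)
  \<comment> \<open>A dummy tape is used so that \<open>K\<close> and \<open>r\<close> are fixed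
    before quantifying over tapes, and \<open>dense_run\<close> can be interpreted once for all of
    them.\<close>
  have "runs wlen (\<lambda>_. 0) (preprocess (Suc (2000 * N))) (ram_input xs) (24 * n + 5)
    (\<lambda>s. \<exists>V K r. s = st r (\<lambda>_. 0) V 0 \<and> V 0 = (2 ^ floorlog 2 n) ^ Suc (2000 * N) \<and> V 1 = K \<and> V 4 = 0 \<and>
      n \<le> K * K \<and> K * K \<le> 4 * n \<and> is_scale (3 * n) r)"
    unfolding init by (rule runs_preprocess[OF base_less[unfolded base_def]])
  then obtain t0 V K r where
    pre: "exec wlen (\<lambda>_. 0) (preprocess (Suc (2000 * N))) (ram_input xs) t0 (st r (\<lambda>_. 0) V 0)" "t0 \<le> 24 * n + 5"
    and V: "V 0 = base" "V 1 = K" "V 4 = 0" and K: "n \<le> K * K" "K * K \<le> 4 * n" and r: "is_scale (3 * n) r"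
    unfolding runs_def base_def by blast
  interpret run: dense_run \<alpha> N n A xs K r
    by unfold_locales (fact K r)+
  \<comment> \<open>The preprocessing draws no random words, hence it ends in the same state on every tape.\<close>
  have pre': "exec wlen \<omega> (preprocess (Suc (2000 * N))) (ram_input xs) t0 (st r (\<lambda>_. 0) V 0)" for \<omega>
    by (rule exec_local[OF pre(1)]) (simp add: ram_def)
  define Q where "Q s \<longleftrightarrow> (\<exists>v out c. words s 0 = c \<and> words s ` {1..c} = out ` {1..c} \<and>
    run.outcome v out c \<and> K \<le> 384 * N * c)" for s :: machine
  have halts: "\<exists>t s'. exec wlen \<omega> ?P (ram_input xs) t s' \<and>
      real t \<le> (24 * real n + 7) + real run.trial_time * real (Suc i) \<and> Q s'"
    if "\<omega> i \<in> run.good_draws" for \<omega> i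
  proof -
    have "runs wlen \<omega> (Seq (main_loop N) (WStore (WConst 0) count_var)) (st r (\<lambda>_. 0) V 0) (run.trial_time * Suc i + 2) Q"
      unfolding Q_def using run.outcome_good[OF that] by (intro run.runs_main_loop V)
    then obtain t s' where s': "exec wlen \<omega> (Seq (main_loop N) (WStore (WConst 0) count_var)) (st r (\<lambda>_. 0) V 0) t s'"
      "t \<le> run.trial_time * Suc i + 2" "Q s'" unfolding runs_def by blast
    have "exec wlen \<omega> ?P (ram_input xs) (t0 + t) s'"
      unfolding program_def by (rule exec_Seq[OF pre' s'(1)])
    moreover have "t0 + t \<le> 24 * n + 7 + run.trial_time * Suc i" using pre(2) s'(2) by linarith
    then have "real (t0 + t) \<le> real (24 * n + 7 + run.trial_time * Suc i)" by (rule of_nat_mono)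
    then have "real (t0 + t) \<le> (24 * real n + 7) + real run.trial_time * real (Suc i)" by (simp add: algebra_simps)
    ultimately show ?thesis using s'(3) by blast
  qed
  have N1: "1 \<le> real N" using N_gt_0 by linarith
  define p where "p = 1 / (19200 * (real N)\<^sup>2)"
  have "1 \<le> 19200 * (real N)\<^sup>2" using one_le_power[OF N1, of 2] by linarith
  moreover have "0 < 1 / x" "1 / x \<le> 1" if "1 \<le> x" for x :: real using that by auto
  ultimately have p: "0 < p" "p \<le> 1" unfolding p_def by blast+
  note trials = expected_time_repeated_trials[where P = ?P and s = "ram_input xs" and Q = Q and
      w = wlen and G = run.good_draws and p = p and a = "24 * real n + 7" and T = "real run.trial_time",
      OF p run.prob_good_draws[folded p_def] _ _ halts]
  have "expected_time wlen ?P (ram_input xs) \<le> ennreal (24 * real n + 7 + real run.trial_time / p)"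
    by (rule trials(1)) simp_all
  also have "\<dots> \<le> ennreal (time_const * (real n * ln (real n)))"
  proof (rule ennreal_leI)
    have "real run.trial_time / p = real run.trial_time * (19200 * (real N)\<^sup>2)" by (simp add: p_def)
    also have "\<dots> \<le> (10 + 30720000 * (real N)\<^sup>2) * real n * (19200 * (real N)\<^sup>2)"
      by (intro mult_right_mono run.trial_time_le) auto
    finally have "24 * real n + 7 + real run.trial_time / p \<le>
        24 * real n + 7 * real n + (10 + 30720000 * (real N)\<^sup>2) * real n * (19200 * (real N)\<^sup>2)"
      using n_ge by linarith
    also have "\<dots> = time_const * (real n * ln 2)" by (simp add: time_const_def field_simps)
    also have "\<dots> \<le> time_const * (real n * ln (real n))"
      using n_ge by (intro mult_left_mono) (auto simp: time_const_def)
    finally show "24 * real n + 7 + real run.trial_time / p \<le> time_const * (real n * ln (real n))" .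
  qed
  finally show "expected_time wlen ?P (ram_input xs) \<le> ennreal (time_const * (real n * ln (real n)))" .
  have result: "ram_output s \<subseteq> {..<n} \<and> convex_position ((!) xs ` ram_output s) \<and>
    ratio_const * real n powr (- 1 / 6) * real (opt_convex A) \<le> real (card ((!) xs ` ram_output s))"
    if "Q s" for s
  proof -
    from that obtain v out c where vc: "words s 0 = c" "words s ` {1..c} = out ` {1..c}"
      "run.outcome v out c" "K \<le> 384 * N * c" unfolding Q_def by blast
    have eq: "ram_output s = out ` {1..c}" unfolding ram_output_def vc(1) by (rule vc(2))
    show ?thesis
      unfolding eq ratio_const_def using run.outcome_subset[OF vc(3)] run.outcome_convex[OF vc(3) run.r_pos]
        run.outcome_card[OF vc(3,4)] by blast
  qed
  have "AE \<omega> in random_tape wlen. \<exists>t s'. exec wlen \<omega> ?P (ram_input xs) t s' \<and> Q s'"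
    by (rule trials(2)) simp_all
  then show "AE \<omega> in random_tape wlen. \<exists>t s. exec wlen \<omega> ?P (ram_input xs) t s \<and>
    ram_output s \<subseteq> {..<n} \<and> convex_position ((!) xs ` ram_output s) \<and>
    ratio_const * real n powr (- 1 / 6) * real (opt_convex A) \<le> real (card ((!) xs ` ram_output s))"
    by (rule AE_mp, intro AE_I2 impI) (use result in blast)
qed

end

theorem theorem7:
  fixes \<alpha> :: real
  assumes "\<alpha> > 0"
  shows "\<exists>(P :: com) (k :: nat) (C :: real) (c :: real). k > 0 \<and> C > 0 \<and> c > 0 \<and>
    (\<forall>(A :: (real ^ 3) set) (n :: nat) (xs :: (real ^ 3) list).
       finite A \<and> card A = n \<and> n \<ge> 2 \<and> general_position A \<and>
       spread A \<le> \<alpha> * real n powr (1 / 3) \<and> distinct xs \<and> set xs = A \<longrightarrow>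
       expected_time (word_length k n) P (ram_input xs) \<le> ennreal (C * (real n * ln (real n))) \<and>
       (AE \<omega> in random_tape (word_length k n).
          \<exists>t s. exec (word_length k n) \<omega> P (ram_input xs) t s \<and>
            ram_output s \<subseteq> {..<n} \<and>
            convex_position ((!) xs ` ram_output s) \<and>
            real (card ((!) xs ` ram_output s)) \<ge> c * real n powr (- 1 / 6) * real (opt_convex A)))"
proof -
  \<comment> \<open>The program may contain only rational constants, so \<alpha> enters it through
    this integer, which dominates both required quantities by dominating their sum.\<close>
  define N where "N = Suc (nat \<lceil>4 * \<alpha> + 23887872 * \<alpha> ^ 3\<rceil>)"
  have pos: "0 \<le> 4 * \<alpha>" "0 \<le> 23887872 * \<alpha> ^ 3" using assms by auto
  then have "4 * \<alpha> + 23887872 * \<alpha> ^ 3 \<le> real N" unfolding N_def by linarith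
  then have N: "4 * \<alpha> \<le> real N" "23887872 * \<alpha> ^ 3 \<le> real N" using pos by linarith+
  define C where "C = (31 + 19200 * (real N)\<^sup>2 * (10 + 30720000 * (real N)\<^sup>2)) / ln 2"
  define c where "c = 1 / (2304 * real N * (8 * \<alpha> + 1)\<^sup>2)"
  have "0 < C" unfolding C_def by (intro divide_pos_pos add_pos_nonneg) auto
  moreover have "0 < N" by (simp add: N_def)
  then have "0 < c"
    unfolding c_def using assms by (intro divide_pos_pos mult_pos_pos zero_less_power) auto
  moreover have "expected_time (word_length (3 * Suc (2000 * N)) n) (program N (Suc (2000 * N))) (ram_input xs)
        \<le> ennreal (C * (real n * ln (real n)))"
      "AE \<omega> in random_tape (word_length (3 * Suc (2000 * N)) n).
        \<exists>t s. exec (word_length (3 * Suc (2000 * N)) n) \<omega> (program N (Suc (2000 * N))) (ram_input xs) t s \<and>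
          ram_output s \<subseteq> {..<n} \<and> convex_position ((!) xs ` ram_output s) \<and>
          c * real n powr (- 1 / 6) * real (opt_convex A) \<le> real (card ((!) xs ` ram_output s))"
    if "finite A \<and> card A = n \<and> n \<ge> 2 \<and> general_position A \<and>
       spread A \<le> \<alpha> * real n powr (1 / 3) \<and> distinct xs \<and> set xs = A" for A n xs
  proof -
    interpret dense_input \<alpha> N n A xs
      using that assms N by unfold_locales auto
    show "expected_time (word_length (3 * Suc (2000 * N)) n) (program N (Suc (2000 * N))) (ram_input xs)
        \<le> ennreal (C * (real n * ln (real n)))"
      "AE \<omega> in random_tape (word_length (3 * Suc (2000 * N)) n).
        \<exists>t s. exec (word_length (3 * Suc (2000 * N)) n) \<omega> (program N (Suc (2000 * N))) (ram_input xs) t s \<and>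
          ram_output s \<subseteq> {..<n} \<and> convex_position ((!) xs ` ram_output s) \<and>
          c * real n powr (- 1 / 6) * real (opt_convex A) \<le> real (card ((!) xs ` ram_output s))"
      using program_correct unfolding wlen_def time_const_def ratio_const_def C_def c_def by simp_all
  qed
  ultimately show ?thesis
    by (intro exI[of _ "program N (Suc (2000 * N))"] exI[of _ "3 * Suc (2000 * N)"] exI[of _ C] exI[of _ c]
        conjI allI impI) simp_all
qed

end
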